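(* Let $G$ be a finite group of weight one such that $|G'|=p^n$ and $G/G'=C_m$, where $G'$ is the commutator subgroup of $G$, $p$ is a prime number, $m=p^kl$ and $p\nmid l$ ($n,k\ge 0$ integers). Let $\rho\colon G\to\mathrm{GL}(mp^n,\mathbb{Z})$ be the regular representation of $G$, and let $K$ be an oriented knot in $S^3$ with Alexander polynomial $\Delta_K(t)$. Then for every epimorphism $f\colon G(K)\to G$ we have $$\overline{\Delta_K^{\rho\circ f}}(t)=\left(\prod_{j=0}^{l-1}\frac{\overline{\Delta_K}(\zeta^jt)}{\zeta^jt-1}\right)^{p^{k+n}}$$ in $\mathbb{F}_p(t)$, where $\zeta$ is a primitive $l$-th root of unity in $\mathbb{F}_{p^d}$ and $d=\mathrm{ord}_l(p)$. In particular, $\Delta_K^{\rho\circ f}(t)$ is nonzero.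
   Context: The weight of a group is the smallest integer $w$ such that the group is the normal closure of $w$ elements (the trivial group has weight $0$). $C_m$ is the cyclic group of order $m$. $\mathrm{ord}_l(p)$ is the smallest positive integer $d$ with $p^d\equiv1\pmod l$. Bar notation: $\overline{P}(t)$ denotes the result of reducing each integer coefficient of $P(t)\in\mathbb{Z}[t^{\pm1}]$ modulo $p$ (for a rational expression, of numerator and denominator); it may be regarded as having coefficients in $\mathbb{F}_{p^d}\supset\mathbb{F}_p$. Knot group: for an oriented knot $K\subset S^3$, $E_K=S^3\setminus\nu(K)$ is the complement of an open tubular neighborhood and $G(K)=\pi_1(E_K)$. Let $\phi\colon G(K)\to\mathbb{Z}=\langle t\rangle$ be the abelianization, sending an oriented meridian to $t$. Twisted Alexander polynomial (Wada): let $R$ be a Noetherian unique factorization domain with quotient field $Q$ and $\varrho\colon G(K)\to\mathrm{GL}(r,R)$ a representation. Fix a Wirtinger presentation $G(K)=\langle s_1,\dots,s_q\mid r_1,\dots,r_{q-1}\rangle$. Extend $s\mapsto\phi(s)\varrho(s)$ to a ring homomorphism $\mathbb{Z}[G(K)]\to\mathrm{Mat}(r,R[t^{\pm1}])$, and let $\Phi\colon\mathbb{Z}[F_q]\to\mathrm{Mat}(r,R[t^{\pm1}])$ be its composition with the surjection $\mathbb{Z}[F_q]\to\mathbb{Z}[G(K)]$, where $F_q=\langle s_1,\dots,s_q\rangle$ is free. Let $M$ be the $r(q-1)\times rq$ matrix with blocks $\Phi(\partial r_i/\partial s_j)$ (Fox derivatives), and let $M_j$ be $M$ with the $j$-th block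 column removed. Then $\Delta_K^{\varrho}(t)=\det M_j/\det\Phi(s_j-1)\in Q(t)$, well defined up to multiplication by $\varepsilon t^a$ ($\varepsilon\in R^\times$, $a\in\mathbb{Z}$). The equality in $\mathbb{F}_p(t)$ is likewise understood up to multiplication by units: the right-hand side is a priori in $\mathbb{F}_{p^d}(t)$, the product over $j$ lies in $\mathbb{F}_p(t)$, and equality is up to $\varepsilon t^a$ with $\varepsilon\in\mathbb{F}_p^\times$, $a\in\mathbb{Z}$. Regular representation: for a finite group $G$, the permutation representation $G\to\mathrm{Aut}_{\mathbb{Z}}(\mathbb{Z}[G])\cong\mathrm{GL}(|G|,\mathbb{Z})$ given by the action of $G$ on itself by right multiplication (matrices acting on row vectors). *)

theory Defs
  imports
    "HOL-Analysis.Analysis"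
    "HOL-Algebra.Algebra"
    "HOL-Number_Theory.Number_Theory"
    "HOL-Computational_Algebra.Computational_Algebra"
    "Jordan_Normal_Form.Determinant"
begin

section \<open>Fundamental groups\<close>

definition based_loops :: "'a::topological_space set \<Rightarrow> 'a \<Rightarrow> (real \<Rightarrow> 'a) set" where
  "based_loops S x =
     {g. path g \<and> path_image g \<subseteq> S \<and> pathstart g = x \<and> pathfinish g = x}"

definition loop_class :: "'a::topological_space set \<Rightarrow> (real \<Rightarrow> 'a) \<Rightarrow> (real \<Rightarrow> 'a) set" where
  "loop_class S g = {h. homotopic_paths S g h}"

definition fundamental_group :: "'a::topological_space set \<Rightarrow> 'a \<Rightarrow> (real \<Rightarrow> 'a) set monoid" where
  "fundamental_group S x =
     \<lparr>carrier = loop_class S ` based_loops S x,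
      monoid.mult = (\<lambda>A B. {h. \<exists>a\<in>A. \<exists>b\<in>B. homotopic_paths S (a +++ b) h}),
      one = loop_class S (\<lambda>_. x)\<rparr>"

lemma loop_class_eq_iff:
  assumes "g \<in> based_loops S x"
  shows "loop_class S g = loop_class S h \<longleftrightarrow> homotopic_paths S g h"
proof
  assume eq: "loop_class S g = loop_class S h"
  have "g \<in> loop_class S g"
    using assms by (auto simp: loop_class_def based_loops_def)
  then have "g \<in> loop_class S h" using eq by simp
  then show "homotopic_paths S g h"
    by (simp add: loop_class_def homotopic_paths_sym)
next
  assume "homotopic_paths S g h"
  then show "loop_class S g = loop_class S h"
    by (auto simp: loop_class_def intro: homotopic_paths_trans homotopic_paths_sym)
qed

lemma based_loops_join:
  "g \<in> based_loops S x \<Longrightarrow> h \<in> based_loops S x \<Longrightarrow> g +++ h \<in> based_loops S x"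
  by (auto simp: based_loops_def path_image_join)

lemma fundamental_group_mult:
  assumes g: "g \<in> based_loops S x" and h: "h \<in> based_loops S x"
  shows "loop_class S g \<otimes>\<^bsub>fundamental_group S x\<^esub> loop_class S h = loop_class S (g +++ h)"
proof -
  have fg: "pathfinish g = pathstart h" using g h by (auto simp: based_loops_def)
  have gg: "homotopic_paths S g g" and hh: "homotopic_paths S h h"
    using g h by (auto simp: based_loops_def)
  have "(\<exists>a\<in>loop_class S g. \<exists>b\<in>loop_class S h. homotopic_paths S (a +++ b) k)
      \<longleftrightarrow> homotopic_paths S (g +++ h) k" for k
  proof
    assume "\<exists>a\<in>loop_class S g. \<exists>b\<in>loop_class S h. homotopic_paths S (a +++ b) k"
    then obtain a b where "homotopic_paths S g a" "homotopic_paths S h b"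
      and k: "homotopic_paths S (a +++ b) k" by (auto simp: loop_class_def)
    then have "homotopic_paths S (g +++ h) (a +++ b)"
      by (intro homotopic_paths_join fg)
    then show "homotopic_paths S (g +++ h) k" using k by (rule homotopic_paths_trans)
  next
    assume "homotopic_paths S (g +++ h) k"
    then show "\<exists>a\<in>loop_class S g. \<exists>b\<in>loop_class S h. homotopic_paths S (a +++ b) k"
      using gg hh unfolding loop_class_def by blast
  qed
  then show ?thesis by (simp add: fundamental_group_def loop_class_def)
qed

lemma group_fundamental_group:
  fixes S :: "'a::real_normed_vector set"
  assumes x: "x \<in> S"
  shows "group (fundamental_group S x)"
proof -
  let ?G = "fundamental_group S x"
  have const: "(\<lambda>_. x) = linepath x x"
    by (auto simp: linepath_def algebra_simps simp flip: scaleR_left_distrib)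
  have one: "linepath x x \<in> based_loops S x"
    using x by (auto simp: based_loops_def)
  have car: "carrier ?G = loop_class S ` based_loops S x"
    and oneG: "\<one>\<^bsub>?G\<^esub> = loop_class S (linepath x x)"
    by (auto simp: fundamental_group_def const)
  show ?thesis
  proof (rule groupI)
    show "\<one>\<^bsub>?G\<^esub> \<in> carrier ?G" using one by (auto simp: car oneG)
  next
    fix U V assume "U \<in> carrier ?G" "V \<in> carrier ?G"
    then show "U \<otimes>\<^bsub>?G\<^esub> V \<in> carrier ?G"
      by (auto simp: car fundamental_group_mult based_loops_join)
  next
    fix U V W assume "U \<in> carrier ?G" "V \<in> carrier ?G" "W \<in> carrier ?G"
    then obtain a b c where *: "a \<in> based_loops S x" "b \<in> based_loops S x" "c \<in> based_loops S x"
      and UVW: "U = loop_class S a" "V = loop_class S b" "W = loop_class S c" by (auto simp: car)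
    have "homotopic_paths S (a +++ (b +++ c)) ((a +++ b) +++ c)"
      using * by (intro homotopic_paths_assoc) (auto simp: based_loops_def)
    then have "loop_class S ((a +++ b) +++ c) = loop_class S (a +++ (b +++ c))"
      using * by (metis based_loops_join loop_class_eq_iff)
    then show "U \<otimes>\<^bsub>?G\<^esub> V \<otimes>\<^bsub>?G\<^esub> W = U \<otimes>\<^bsub>?G\<^esub> (V \<otimes>\<^bsub>?G\<^esub> W)"
      using * by (simp add: UVW fundamental_group_mult based_loops_join)
  next
    fix U assume "U \<in> carrier ?G"
    then obtain a where a: "a \<in> based_loops S x" and U: "U = loop_class S a" by (auto simp: car)
    have "homotopic_paths S (linepath x x +++ a) a"
      using a by (intro homotopic_paths_lid') (auto simp: based_loops_def)
    then show "\<one>\<^bsub>?G\<^esub> \<otimes>\<^bsub>?G\<^esub> U = U"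
      using a one by (simp add: U oneG fundamental_group_mult)
        (metis based_loops_join loop_class_eq_iff)
    have r: "reversepath a \<in> based_loops S x" using a by (auto simp: based_loops_def)
    have "homotopic_paths S (reversepath a +++ a) (linepath x x)"
      using a homotopic_paths_linv[of a S] by (auto simp: based_loops_def)
    then have "loop_class S (reversepath a) \<otimes>\<^bsub>?G\<^esub> U = \<one>\<^bsub>?G\<^esub>"
      using a r by (simp add: U oneG fundamental_group_mult)
        (metis based_loops_join loop_class_eq_iff)
    then show "\<exists>V\<in>carrier ?G. V \<otimes>\<^bsub>?G\<^esub> U = \<one>\<^bsub>?G\<^esub>" using r by (auto simp: car)
  qed
qed


section \<open>Oriented knots in the 3-sphere\<close>

text \<open>
  The 3-sphere is the unit sphere of \<open>\<real>\<^sup>4\<close>.  An oriented knot is given by a 1-periodic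
  smooth regular parametrization, injective on a period.
\<close>

definition smooth_curve :: "(real \<Rightarrow> 'a::real_normed_vector) \<Rightarrow> bool" where
  "smooth_curve \<gamma> \<longleftrightarrow>
     (\<exists>D. D 0 = \<gamma> \<and> (\<forall>(i::nat) t. (D i has_vector_derivative D (Suc i) t) (at t)))"

definition oriented_knot :: "(real \<Rightarrow> real^4) \<Rightarrow> bool" where
  "oriented_knot \<gamma> \<longleftrightarrow>
     smooth_curve \<gamma> \<and> range \<gamma> \<subseteq> sphere 0 1 \<and>
     (\<forall>t. \<gamma> (t + 1) = \<gamma> t) \<and> inj_on \<gamma> {0..<1} \<and>
     (\<forall>t. vector_derivative \<gamma> (at t) \<noteq> 0)"

text \<open>
  The open \<open>\<epsilon>\<close>-neighbourhood of \<open>K\<close> is a tubular neighbourhood as soon as nearest-point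
  projection to \<open>K\<close> is well defined slightly beyond radius \<open>\<epsilon>\<close>; smooth knots admit such \<open>\<epsilon>\<close>.
\<close>

definition tubular_radius :: "(real^4) set \<Rightarrow> real \<Rightarrow> bool" where
  "tubular_radius K \<epsilon> \<longleftrightarrow>
     \<epsilon> > 0 \<and>
     (\<exists>\<delta>>\<epsilon>. \<forall>x\<in>sphere 0 1. infdist x K < \<delta> \<longrightarrow> (\<exists>!y. y \<in> K \<and> dist x y = infdist x K))"

definition knot_exterior :: "(real \<Rightarrow> real^4) \<Rightarrow> real \<Rightarrow> (real^4) set" where
  "knot_exterior \<gamma> \<epsilon> = sphere 0 1 - {x. infdist x (range \<gamma>) < \<epsilon>}"

abbreviation knot_group :: "(real \<Rightarrow> real^4) \<Rightarrow> real \<Rightarrow> real^4 \<Rightarrow> (real \<Rightarrow> real^4) set monoid" where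
  "knot_group \<gamma> \<epsilon> x\<^sub>0 \<equiv> fundamental_group (knot_exterior \<gamma> \<epsilon>) x\<^sub>0"

text \<open>
  The geodesic circle of radius \<open>r\<close> in the 3-sphere around \<open>y\<close>, in the plane spanned by the
  orthonormal tangent vectors \<open>u, v\<close>.
\<close>

definition geodesic_circle :: "real^4 \<Rightarrow> real^4 \<Rightarrow> real^4 \<Rightarrow> real \<Rightarrow> real \<Rightarrow> real^4" where
  "geodesic_circle y u v r =
     (\<lambda>\<theta>. cos r *\<^sub>R y + sin r *\<^sub>R (cos (2 * pi * \<theta>) *\<^sub>R u + sin (2 * pi * \<theta>) *\<^sub>R v))"

text \<open>
  An oriented meridian bounds a disc that is normal to \<open>K\<close> at its centre \<open>\<gamma> \<tau>\<close> and meets \<open>K\<close>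
  nowhere else; it is joined to the base point by an arc \<open>a\<close> in the exterior.  With the
  3-sphere oriented as boundary of the ball (outward normal first), positivity of the
  determinant says that \<open>(u, v, \<gamma>' \<tau>)\<close> is a positive frame, so the linking number is \<open>+1\<close>.
\<close>

definition oriented_meridians ::
    "(real \<Rightarrow> real^4) \<Rightarrow> real \<Rightarrow> real^4 \<Rightarrow> (real \<Rightarrow> real^4) set set" where
  "oriented_meridians \<gamma> \<epsilon> x\<^sub>0 =
     {loop_class (knot_exterior \<gamma> \<epsilon>) (a +++ (geodesic_circle (\<gamma> \<tau>) u v r +++ reversepath a)) | a \<tau> u v r.
        norm u = 1 \<and> norm v = 1 \<and> u \<bullet> v = 0 \<and>
        u \<bullet> \<gamma> \<tau> = 0 \<and> v \<bullet> \<gamma> \<tau> = 0 \<and>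
        u \<bullet> vector_derivative \<gamma> (at \<tau>) = 0 \<and> v \<bullet> vector_derivative \<gamma> (at \<tau>) = 0 \<and>
        Determinants.det (vector [\<gamma> \<tau>, u, v, vector_derivative \<gamma> (at \<tau>)] :: real^4^4) > 0 \<and>
        0 < r \<and> r < pi \<and>
        (\<forall>r'\<in>{0<..r}. \<forall>\<theta>. geodesic_circle (\<gamma> \<tau>) u v r' \<theta> \<notin> range \<gamma>) \<and>
        range (geodesic_circle (\<gamma> \<tau>) u v r) \<subseteq> knot_exterior \<gamma> \<epsilon> \<and>
        path a \<and> path_image a \<subseteq> knot_exterior \<gamma> \<epsilon> \<and>
        pathstart a = x\<^sub>0 \<and> pathfinish a = geodesic_circle (\<gamma> \<tau>) u v r 0}"

definition knot_abelianization ::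
    "(real \<Rightarrow> real^4) \<Rightarrow> real \<Rightarrow> real^4 \<Rightarrow> ((real \<Rightarrow> real^4) set \<Rightarrow> int) \<Rightarrow> bool" where
  "knot_abelianization \<gamma> \<epsilon> x\<^sub>0 \<phi> \<longleftrightarrow>
     \<phi> \<in> epi (knot_group \<gamma> \<epsilon> x\<^sub>0) integer_group \<and>
     kernel (knot_group \<gamma> \<epsilon> x\<^sub>0) integer_group \<phi> =
       derived (knot_group \<gamma> \<epsilon> x\<^sub>0) (carrier (knot_group \<gamma> \<epsilon> x\<^sub>0)) \<and>
     (\<forall>\<mu>\<in>oriented_meridians \<gamma> \<epsilon> x\<^sub>0. \<phi> \<mu> = 1)"


section \<open>Presentations and Wirtinger presentations\<close>

text \<open>
  A word is a list of letters; \<open>(i, True)\<close> is the generator \<open>s\<^sub>i\<close> and \<open>(i, False)\<close> its inverse.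
  The free group on \<open>q\<close> generators consists of the words modulo \<open>word_equiv q {}\<close>.
\<close>

type_synonym word = "(nat \<times> bool) list"

definition words :: "nat \<Rightarrow> word set" where
  "words q = {w. \<forall>(i, b)\<in>set w. i < q}"

definition word_eval :: "('g, 'b) monoid_scheme \<Rightarrow> (nat \<Rightarrow> 'g) \<Rightarrow> word \<Rightarrow> 'g" where
  "word_eval G s w =
     foldr (\<lambda>(i, b) y. (if b then s i else inv\<^bsub>G\<^esub> (s i)) \<otimes>\<^bsub>G\<^esub> y) w \<one>\<^bsub>G\<^esub>"

inductive word_equiv :: "nat \<Rightarrow> word set \<Rightarrow> word \<Rightarrow> word \<Rightarrow> bool" for q R where
  refl: "word_equiv q R w w"
| sym: "word_equiv q R v w \<Longrightarrow> word_equiv q R w v"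
| trans: "word_equiv q R u v \<Longrightarrow> word_equiv q R v w \<Longrightarrow> word_equiv q R u w"
| cancel: "i < q \<Longrightarrow> word_equiv q R (u @ [(i, b), (i, \<not> b)] @ v) (u @ v)"
| relator: "r \<in> R \<Longrightarrow> word_equiv q R (u @ r @ v) (u @ v)"

definition presents :: "nat \<Rightarrow> word list \<Rightarrow> ('g, 'b) monoid_scheme \<Rightarrow> (nat \<Rightarrow> 'g) \<Rightarrow> bool" where
  "presents q rs G s \<longleftrightarrow>
     set rs \<subseteq> words q \<and>
     (\<forall>i<q. s i \<in> carrier G) \<and>
     word_eval G s ` words q = carrier G \<and>
     (\<forall>w\<in>words q. word_eval G s w = \<one>\<^bsub>G\<^esub> \<longleftrightarrow> word_equiv q (set rs) w [])"

text \<open>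
  The arcs of an oriented diagram are numbered \<open>0, \<dots>, q - 1\<close> along the knot.  At the \<open>i\<close>-th
  crossing arc \<open>i\<close> passes under arc \<open>ov i\<close> and continues as arc \<open>i + 1\<close> (modulo \<open>q\<close>); the
  relator is \<open>s\<^sub>o s\<^sub>i s\<^sub>o\<inverse> s\<^sub>i\<^sub>+\<^sub>1\<inverse>\<close> or \<open>s\<^sub>o\<inverse> s\<^sub>i s\<^sub>o s\<^sub>i\<^sub>+\<^sub>1\<inverse>\<close> with \<open>o = ov i\<close>, according to the
  sign of the crossing.  One crossing \<open>c\<close> is left out.  A diagram without crossings has
  \<open>q = 1\<close> and no relators.
\<close>

definition crossing_relator :: "nat \<Rightarrow> (nat \<Rightarrow> nat) \<Rightarrow> (nat \<Rightarrow> bool) \<Rightarrow> nat \<Rightarrow> word" where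
  "crossing_relator q ov sg i =
     [(ov i, sg i), (i, True), (ov i, \<not> sg i), (Suc i mod q, False)]"

definition wirtinger_presentation ::
    "(real \<Rightarrow> real^4) \<Rightarrow> real \<Rightarrow> real^4 \<Rightarrow> nat \<Rightarrow> (nat \<Rightarrow> (real \<Rightarrow> real^4) set) \<Rightarrow> word list \<Rightarrow> bool" where
  "wirtinger_presentation \<gamma> \<epsilon> x\<^sub>0 q s rs \<longleftrightarrow>
     (\<forall>i<q. s i \<in> oriented_meridians \<gamma> \<epsilon> x\<^sub>0) \<and>
     (\<exists>ov sg c. (\<forall>i<q. ov i < q) \<and> c < q \<and>
        rs = map (crossing_relator q ov sg) (filter (\<lambda>i. i \<noteq> c) [0..<q])) \<and>
     presents q rs (knot_group \<gamma> \<epsilon> x\<^sub>0) s"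


section \<open>Fox calculus and twisted Alexander polynomials\<close>

text \<open>
  Elements of the group ring of the free group are written as integral combinations of
  (not necessarily reduced) words.
\<close>

definition fox_letter :: "nat \<Rightarrow> nat \<times> bool \<Rightarrow> word \<Rightarrow>\<^sub>0 int" where
  "fox_letter j x =
     (if fst x \<noteq> j then 0 else if snd x then frag_of [] else - frag_of [x])"

fun fox_derivative :: "nat \<Rightarrow> word \<Rightarrow> (word \<Rightarrow>\<^sub>0 int)" where
  "fox_derivative j [] = 0"
| "fox_derivative j (x # w) =
     fox_letter j x + frag_extend (\<lambda>v. frag_of (x # v)) (fox_derivative j w)"

text \<open>
  Laurent polynomials and rational functions over a domain \<open>R\<close> live in the fraction field of
  \<open>R[t]\<close>, which is \<open>Q(t)\<close> for the quotient field \<open>Q\<close> of \<open>R\<close>.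
\<close>

abbreviation tvar :: "'a::idom poly fract" where
  "tvar \<equiv> to_fract [:0, 1:]"

definition twisted_matrix ::
    "('g, 'b) monoid_scheme \<Rightarrow> (nat \<Rightarrow> 'g) \<Rightarrow> ('g \<Rightarrow> int) \<Rightarrow> nat \<Rightarrow> ('g \<Rightarrow> 'a::idom mat) \<Rightarrow>
     (word \<Rightarrow>\<^sub>0 int) \<Rightarrow> 'a poly fract mat" where
  "twisted_matrix G s \<phi> r \<rho> x =
     Matrix.mat r r (\<lambda>(a, b). \<Sum>w\<in>Poly_Mapping.keys x.
       of_int (Poly_Mapping.lookup x w) *
       (tvar powi \<phi> (word_eval G s w) * to_fract [:\<rho> (word_eval G s w) $$ (a, b):]))"

definition fox_matrix ::
    "('g, 'b) monoid_scheme \<Rightarrow> nat \<Rightarrow> (nat \<Rightarrow> 'g) \<Rightarrow> word list \<Rightarrow> ('g \<Rightarrow> int) \<Rightarrow>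
     nat \<Rightarrow> ('g \<Rightarrow> 'a::idom mat) \<Rightarrow> 'a poly fract mat" where
  "fox_matrix G q s rs \<phi> r \<rho> =
     Matrix.mat (r * length rs) (r * q) (\<lambda>(a, b).
       twisted_matrix G s \<phi> r \<rho> (fox_derivative (b div r) (rs ! (a div r))) $$ (a mod r, b mod r))"

definition remove_block_column :: "nat \<Rightarrow> nat \<Rightarrow> 'c mat \<Rightarrow> 'c mat" where
  "remove_block_column r j M =
     Matrix.mat (dim_row M) (dim_col M - r) (\<lambda>(a, b). M $$ (a, if b < r * j then b else b + r))"

definition twisted_alexander ::
    "('g, 'b) monoid_scheme \<Rightarrow> nat \<Rightarrow> (nat \<Rightarrow> 'g) \<Rightarrow> word list \<Rightarrow> ('g \<Rightarrow> int) \<Rightarrow>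
     nat \<Rightarrow> ('g \<Rightarrow> 'a::idom mat) \<Rightarrow> nat \<Rightarrow> 'a poly fract" where
  "twisted_alexander G q s rs \<phi> r \<rho> j =
     Determinant.det (remove_block_column r j (fox_matrix G q s rs \<phi> r \<rho>)) /
     Determinant.det (twisted_matrix G s \<phi> r \<rho> (frag_of [(j, True)] - frag_of []))"

text \<open>
  The Alexander polynomial generates the smallest principal ideal of \<open>\<int>[t, t\<inverse>]\<close> containing
  the maximal minors of the Alexander matrix, the Fox matrix of the trivial representation.
\<close>

definition laurent_polys :: "'a::idom poly fract set" where
  "laurent_polys = {to_fract P * tvar powi a | P a. True}"

definition laurent_dvd :: "'a::idom poly fract \<Rightarrow> 'a poly fract \<Rightarrow> bool" where
  "laurent_dvd x y \<longleftrightarrow> (\<exists>c\<in>laurent_polys. y = x * c)"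

definition alexander_polynomial ::
    "('g, 'b) monoid_scheme \<Rightarrow> nat \<Rightarrow> (nat \<Rightarrow> 'g) \<Rightarrow> word list \<Rightarrow> ('g \<Rightarrow> int) \<Rightarrow>
     int poly fract \<Rightarrow> bool" where
  "alexander_polynomial G q s rs \<phi> D \<longleftrightarrow>
     (let minor = (\<lambda>j. Determinant.det (remove_block_column 1 j
                       (fox_matrix G q s rs \<phi> 1 (\<lambda>_. 1\<^sub>m 1)))) in
      D \<in> laurent_polys \<and>
      (\<forall>j<q. laurent_dvd D (minor j)) \<and>
      (\<forall>E\<in>laurent_polys. (\<forall>j<q. laurent_dvd E (minor j)) \<longrightarrow> laurent_dvd E D))"


section \<open>Finite groups\<close>

definition normal_closure :: "('g, 'b) monoid_scheme \<Rightarrow> 'g set \<Rightarrow> 'g set" where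
  "normal_closure G S = \<Inter>{N. N \<lhd> G \<and> S \<subseteq> N}"

definition group_weight :: "('g, 'b) monoid_scheme \<Rightarrow> nat" where
  "group_weight G =
     (LEAST w. \<exists>S. S \<subseteq> carrier G \<and> finite S \<and> card S = w \<and> normal_closure G S = carrier G)"

text \<open>
  \<open>e\<close> enumerates the basis \<open>G\<close> of \<open>\<int>[G]\<close>; row \<open>a\<close> of the matrix of \<open>g\<close> is the basis vector
  \<open>e a \<otimes> g\<close>.
\<close>

definition regular_representation ::
    "('g, 'b) monoid_scheme \<Rightarrow> nat \<Rightarrow> (nat \<Rightarrow> 'g) \<Rightarrow> 'g \<Rightarrow> int mat" where
  "regular_representation G r e g =
     Matrix.mat r r (\<lambda>(a, b). if e a \<otimes>\<^bsub>G\<^esub> g = e b then 1 else 0)"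


section \<open>Reduction modulo a prime\<close>

text \<open>
  Everything is regarded inside a field \<open>'f\<close> of characteristic \<open>p\<close>, whose prime field is
  \<open>range of_int\<close>; reducing an integer modulo \<open>p\<close> is \<open>of_int\<close>.
\<close>

abbreviation reduce_poly :: "int poly \<Rightarrow> 'f::field poly" where
  "reduce_poly \<equiv> map_poly of_int"

definition reduces_to :: "int poly fract \<Rightarrow> 'f::field poly fract \<Rightarrow> bool" where
  "reduces_to F g \<longleftrightarrow>
     (\<exists>N D. F = Fraction_Field.Fract N D \<and> (reduce_poly D :: 'f poly) \<noteq> 0 \<and>
            g = Fraction_Field.Fract (reduce_poly N) (reduce_poly D))"

lemma reduce_poly_mult: "(reduce_poly (P * Q) :: 'f::field poly) = reduce_poly P * reduce_poly Q"
  by (rule poly_eqI) (simp add: coeff_map_poly coeff_mult)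

lemma reduces_to_unique:
  fixes g h :: "'f::field poly fract"
  assumes "reduces_to F g" "reduces_to F h"
  shows "g = h"
proof -
  obtain N D where 1: "F = Fraction_Field.Fract N D" "(reduce_poly D :: 'f poly) \<noteq> 0"
    "g = Fraction_Field.Fract (reduce_poly N) (reduce_poly D)"
    using assms(1) by (auto simp: reduces_to_def)
  obtain N' D' where 2: "F = Fraction_Field.Fract N' D'" "(reduce_poly D' :: 'f poly) \<noteq> 0"
    "h = Fraction_Field.Fract (reduce_poly N') (reduce_poly D')"
    using assms(2) by (auto simp: reduces_to_def)
  have "D \<noteq> 0" "D' \<noteq> 0" using 1(2) 2(2) by auto
  then have "N * D' = N' * D" using 1(1) 2(1) by (simp add: eq_fract)
  then have "(reduce_poly N * reduce_poly D' :: 'f poly) = reduce_poly N' * reduce_poly D"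
    by (metis reduce_poly_mult)
  then show ?thesis using 1 2 by (simp add: eq_fract)
qed

definition prime_field :: "'f::field set" where
  "prime_field = range of_int"

definition prime_field_rational_functions :: "'f::field poly fract set" where
  "prime_field_rational_functions =
     {Fraction_Field.Fract P Q | P Q. range (Polynomial.coeff P) \<subseteq> prime_field \<and>
       range (Polynomial.coeff Q) \<subseteq> prime_field \<and> Q \<noteq> 0}"

definition eq_up_to_unit :: "'f::field poly fract \<Rightarrow> 'f poly fract \<Rightarrow> bool" where
  "eq_up_to_unit g h \<longleftrightarrow>
     (\<exists>u a. u \<in> prime_field \<and> u \<noteq> 0 \<and> g = to_fract [:u:] * tvar powi a * h)"

definition primitive_root_of_unity :: "nat \<Rightarrow> 'f::field \<Rightarrow> bool" where
  "primitive_root_of_unity l \<zeta> \<longleftrightarrow> l > 0 \<and> \<zeta> ^ l = 1 \<and> (\<forall>i. 0 < i \<and> i < l \<longrightarrow> \<zeta> ^ i \<noteq> 1)"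

end

theory Submission
  imports Defs "Jordan_Normal_Form.Char_Poly"
begin

text \<open>
  Let \<open>\<chi>: G \<rightarrow> F\<^sup>\<times>\<close> be a character of order \<open>l\<close> of the cyclic quotient \<open>G/G'\<close>, where \<open>F\<close> has
  characteristic \<open>p\<close>.  Its kernel is a \<open>p\<close>-group, hence fixes a nonzero vector in every
  representation of \<open>G\<close> over \<open>F\<close>, and since \<open>p\<close> does not divide \<open>l\<close> such a vector can be
  averaged to a common eigenvector of \<open>G\<close>.  So the regular representation is simultaneously
  triangular modulo \<open>p\<close>, and the twisted determinants factor into determinants twisted by the
  diagonal characters.  All meridians are conjugate, so a character of \<open>G\<close> pulled back to the knot
  group only amounts to a substitution \<open>t \<mapsto> z t\<close>.  Twisting the regular representation by \<open>\<chi>\<close>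
  gives an isomorphic representation, so the eigenvalues \<open>z\<close> of a meridian are equidistributed
  among the \<open>l\<close>-th roots of unity.  The untwisted determinant is the Alexander polynomial up to a
  unit, and it does not vanish modulo \<open>p\<close>: at \<open>t = 1\<close> a kernel vector of the Alexander matrix is
  constant along the arcs of the diagram.
\<close>

unbundle no vec_syntax
no_notation Formal_Power_Series.fps_nth (infixl \<open>$\<close> 75)

section \<open>Block matrices\<close>

text \<open>Reduction modulo \<open>p\<close> is defined on fractions of integral polynomials whose
  denominator survives, while the Fox matrix has Laurent entries. Numerator and denominator are
  therefore multiplied by explicit powers of t, and the reduced determinants have to be shown
  nonzero. The diagonal characters of the triangular form cannot be named; what is used is the
  multiset of their values at one meridian. A single choice of characters must serve the numerator,
  the denominator and the pencil t - x, whose determinant reveals that multiset. This is why the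
  triangular form is stated for all block sizes and all polynomial coefficients. The exponent
  \<open>p ^ (k + n)\<close> is the order of the kernel of \<chi>: the regular representation has
  degree m p^n = l p^(k+n), and the l roots of unity occur equally often among the eigenvalues of a
  meridian. The constants produced by the substitutions are, up to sign, powers of the product of
  all l-th roots of unity. Its square is 1, so the final unit lies in the prime field.\<close>

lemma sum_div_mod:
  fixes g :: "nat \<Rightarrow> nat \<Rightarrow> 'a::comm_monoid_add"
  shows "(\<Sum>k<r * n. g (k div n) (k mod n)) = (\<Sum>c<r. \<Sum>w<n. g c w)"
proof -
  have "(\<Sum>w=c * n..<c * n + n. g (w div n) (w mod n)) = (\<Sum>w<n. g c w)" for c
    using sum.shift_bounds_nat_ivl[of "\<lambda>w. g (w div n) (w mod n)" 0 "c * n" n]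
    by (simp add: atLeast0LessThan add.commute)
  then show ?thesis by (simp flip: sum.nat_group)
qed

text \<open>
  Row \<open>a * n + u\<close> carries the representation index \<open>a\<close> and the presentation index \<open>u\<close>.  The Fox
  matrix of the statement nests the two indices the other way round.
\<close>

definition block_mat :: "nat \<Rightarrow> nat \<Rightarrow> (nat \<Rightarrow> nat \<Rightarrow> nat \<Rightarrow> nat \<Rightarrow> 'a) \<Rightarrow> 'a mat" where
  "block_mat r n m = Matrix.mat (r * n) (r * n) (\<lambda>(i, j). m (i div n) (i mod n) (j div n) (j mod n))"

lemma block_mat_carrier [simp]: "block_mat r n m \<in> carrier_mat (r * n) (r * n)"
  by (simp add: block_mat_def)

lemma block_mat_cong:
  assumes "\<And>a u b v. a < r \<Longrightarrow> u < n \<Longrightarrow> b < r \<Longrightarrow> v < n \<Longrightarrow> m a u b v = m' a u b v"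
  shows "block_mat r n m = block_mat r n m'"
proof (cases "n = 0")
  case False
  then show ?thesis
    unfolding block_mat_def using assms
    by (intro eq_matI) (auto simp: less_mult_imp_div_less)
qed (auto simp: block_mat_def)

lemma block_mat_mult:
  fixes m m' :: "nat \<Rightarrow> nat \<Rightarrow> nat \<Rightarrow> nat \<Rightarrow> 'a::comm_semiring_0"
  shows "block_mat r n m * block_mat r n m' =
    block_mat r n (\<lambda>a u b v. \<Sum>c<r. \<Sum>w<n. m a u c w * m' c w b v)"
proof (rule eq_matI)
  fix i j
  assume "i < dim_row (block_mat r n (\<lambda>a u b v. \<Sum>c<r. \<Sum>w<n. m a u c w * m' c w b v))"
    and "j < dim_col (block_mat r n (\<lambda>a u b v. \<Sum>c<r. \<Sum>w<n. m a u c w * m' c w b v))"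
  then have ij: "i < r * n" "j < r * n" by (auto simp: block_mat_def)
  have "(block_mat r n m * block_mat r n m') $$ (i, j) =
      (\<Sum>k<r * n. m (i div n) (i mod n) (k div n) (k mod n) * m' (k div n) (k mod n) (j div n) (j mod n))"
    using ij by (simp add: block_mat_def scalar_prod_def atLeast0LessThan)
  also have "\<dots> = (\<Sum>c<r. \<Sum>w<n. m (i div n) (i mod n) c w * m' c w (j div n) (j mod n))"
    by (rule sum_div_mod)
  finally show "(block_mat r n m * block_mat r n m') $$ (i, j) =
      block_mat r n (\<lambda>a u b v. \<Sum>c<r. \<Sum>w<n. m a u c w * m' c w b v) $$ (i, j)"
    using ij by (simp add: block_mat_def)
qed (auto simp: block_mat_def)

lemma block_mat_one:
  "block_mat r n (\<lambda>a u b v. if a = b \<and> u = v then 1 else 0) = 1\<^sub>m (r * n)"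
  unfolding block_mat_def
  by (rule eq_matI) (auto, metis div_mult_mod_eq)

text \<open>With the representation index as the outer one, the hypothesis says that the lower left
  block is zero. This splits off one diagonal character.\<close>

lemma det_block_mat_triangular:
  fixes m :: "nat \<Rightarrow> nat \<Rightarrow> nat \<Rightarrow> nat \<Rightarrow> 'a::idom"
  assumes "\<And>a u v. a < r \<Longrightarrow> u < n \<Longrightarrow> v < n \<Longrightarrow> m (Suc a) u 0 v = 0"
  shows "Determinant.det (block_mat (Suc r) n m) =
    Determinant.det (Matrix.mat n n (\<lambda>(u, v). m 0 u 0 v)) *
    Determinant.det (block_mat r n (\<lambda>a u b v. m (Suc a) u (Suc b) v))"
proof (cases "n = 0")
  case False
  let ?A = "Matrix.mat n n (\<lambda>(u, v). m 0 u 0 v)"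
  let ?B = "Matrix.mat n (r * n) (\<lambda>(u, j). m 0 u (Suc (j div n)) (j mod n))"
  let ?D = "block_mat r n (\<lambda>a u b v. m (Suc a) u (Suc b) v)"
  have div: "i div n = Suc ((i - n) div n)" "i mod n = (i - n) mod n" if "\<not> i < n" for i
    using that False by (auto simp: le_div_geq le_mod_geq)
  have "block_mat (Suc r) n m = four_block_mat ?A ?B (0\<^sub>m (r * n) n) ?D"
  proof (rule eq_matI)
    fix i j assume "i < dim_row (four_block_mat ?A ?B (0\<^sub>m (r * n) n) ?D)"
      "j < dim_col (four_block_mat ?A ?B (0\<^sub>m (r * n) n) ?D)"
    then have ij: "i < n + r * n" "j < n + r * n" by (auto simp: block_mat_def)
    have "(i - n) div n < r" if "\<not> i < n" using that ij False
      by (intro less_mult_imp_div_less) simp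
    then show "block_mat (Suc r) n m $$ (i, j) = four_block_mat ?A ?B (0\<^sub>m (r * n) n) ?D $$ (i, j)"
      using ij False assms by (auto simp: block_mat_def div)
  qed (auto simp: block_mat_def)
  then show ?thesis
    by (simp add: det_four_block_mat_lower_left_zero[of ?A n ?B "r * n"])
qed (auto simp: block_mat_def)

text \<open>The sign of \<open>p\<close> enters once through the rows and once through the columns,
  and cancels.\<close>

lemma det_reindex:
  assumes A: "A \<in> carrier_mat n n" and p: "p permutes {0..<n}"
  shows "Determinant.det (Matrix.mat n n (\<lambda>(i, j). A $$ (p i, p j))) = Determinant.det A"
proof -
  let ?B = "Matrix.mat n n (\<lambda>(i, j). A $$ (p i, j))"
  have pl: "p i < n" if "i < n" for i using p that permutes_in_image[of p "{0..<n}" i] by auto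
  have "Matrix.mat n n (\<lambda>(i, j). A $$ (p i, p j)) =
      transpose_mat (Matrix.mat n n (\<lambda>(i, j). transpose_mat ?B $$ (p i, j)))"
    by (rule eq_matI) (auto simp: pl)
  then have "Determinant.det (Matrix.mat n n (\<lambda>(i, j). A $$ (p i, p j))) =
      signof p * (signof p * Determinant.det A)"
    using det_permute_rows[of "transpose_mat ?B" n p] det_permute_rows[OF A p] p
    by (simp add: det_transpose[of _ n])
  then show ?thesis by (simp add: sign_def)
qed

text \<open>The two nestings of an index pair differ by the shuffle u * r + a \<mapsto> a * n + u,
  applied to rows and columns alike. The shuffle is extended by the identity outside the index
  range, as \<open>permutes\<close> demands.\<close>

lemma det_block_mat_swap:
  fixes m :: "nat \<Rightarrow> nat \<Rightarrow> nat \<Rightarrow> nat \<Rightarrow> 'a::idom"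
  shows "Determinant.det (Matrix.mat (r * n) (r * n) (\<lambda>(i, j). m (i mod r) (i div r) (j mod r) (j div r))) =
    Determinant.det (block_mat r n m)"
proof (cases "r = 0 \<or> n = 0")
  case False
  define p where "p i = (if i < r * n then (i mod r) * n + i div r else i)" for i
  have pl: "p i < r * n" if "i < r * n" for i
  proof -
    have "i div r < n" using that by (simp add: less_mult_imp_div_less mult.commute)
    then have "(i mod r) * n + i div r < (i mod r) * n + n" by simp
    also have "\<dots> = Suc (i mod r) * n" by simp
    also have "\<dots> \<le> r * n" using False by (intro mult_le_mono1) (simp add: Suc_leI)
    finally show ?thesis using that by (simp add: p_def)
  qed
  have dm: "p i div n = i mod r" "p i mod n = i div r" if "i < r * n" for i
  proof -
    have "i div r < n" using that by (simp add: less_mult_imp_div_less mult.commute)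
    then show "p i div n = i mod r" "p i mod n = i div r" using that by (auto simp: p_def)
  qed
  have "inj_on p {0..<r * n}"
    by (rule inj_onI) (metis atLeastLessThan_iff dm div_mult_mod_eq)
  moreover have "p ` {0..<r * n} \<subseteq> {0..<r * n}" using pl by auto
  ultimately have "p ` {0..<r * n} = {0..<r * n}" by (intro endo_inj_surj) auto
  with \<open>inj_on p {0..<r * n}\<close> have "p permutes {0..<r * n}"
    by (intro bij_imp_permutes) (simp_all add: bij_betw_def, auto simp: p_def)
  from det_reindex[OF block_mat_carrier this, of m]
  have "Determinant.det (Matrix.mat (r * n) (r * n) (\<lambda>(i, j). block_mat r n m $$ (p i, p j))) =
    Determinant.det (block_mat r n m)" .
  moreover have "Matrix.mat (r * n) (r * n) (\<lambda>(i, j). block_mat r n m $$ (p i, p j)) =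
      Matrix.mat (r * n) (r * n) (\<lambda>(i, j). m (i mod r) (i div r) (j mod r) (j div r))"
    by (rule eq_matI) (auto simp: block_mat_def dm pl)
  ultimately show ?thesis by simp
qed (auto simp: block_mat_def)

section \<open>Representations of extensions of cyclic groups by p-groups\<close>

lemma prime_CHAR_finite: "Factorial_Ring.prime CHAR('f::{field,finite})"
  by (intro prime_CHAR_semidom finite_imp_CHAR_pos finite)

definition matrix_rep :: "('g, 'b) monoid_scheme \<Rightarrow> nat \<Rightarrow> ('g \<Rightarrow> 'a::comm_ring_1 mat) \<Rightarrow> bool" where
  "matrix_rep G r A \<longleftrightarrow>
     (\<forall>g\<in>carrier G. A g \<in> carrier_mat r r) \<and> A \<one>\<^bsub>G\<^esub> = 1\<^sub>m r \<and>
     (\<forall>g\<in>carrier G. \<forall>h\<in>carrier G. A (g \<otimes>\<^bsub>G\<^esub> h) = A g * A h)"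

lemma card_carrier_vec:
  "card (carrier_vec r :: 'a::finite Matrix.vec set) = CARD('a) ^ r"
  and finite_carrier_vec: "finite (carrier_vec r :: 'a::finite Matrix.vec set)"
proof -
  have *: "(carrier_vec r :: 'a Matrix.vec set) = vec_of_list ` {xs. set xs \<subseteq> UNIV \<and> length xs = r}"
    (is "?V = _ ` ?L")
  proof
    show "?V \<subseteq> vec_of_list ` ?L"
    proof
      fix v :: "'a Matrix.vec" assume "v \<in> ?V"
      then have "v = vec_of_list (list_of_vec v)" "list_of_vec v \<in> ?L"
        by (auto simp: vec_list)
      then show "v \<in> vec_of_list ` ?L" by blast
    qed
    show "vec_of_list ` ?L \<subseteq> ?V" by (rule image_subsetI, rule carrier_vecI) (metis (mono_tags, lifting) mem_Collect_eq dim_vec_of_list)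
  qed
  have inj: "inj_on vec_of_list ?L" by (metis inj_onI list_vec)
  show "finite ?V" unfolding * by (intro finite_imageI finite_lists_length_eq) simp
  show "card ?V = CARD('a) ^ r"
    unfolding * card_image[OF inj] by (rule card_lists_length_eq) simp
qed

text \<open>Count the finite space by orbits. Every orbit has p-power size, and the zero vector is
  an orbit of size 1. If no other vector were fixed, all other orbits would have size divisible by
  p, although p divides the size of the whole space.\<close>

lemma p_group_fixed_vector:
  fixes G :: "('g, 'b) monoid_scheme" (structure) and A :: "'g \<Rightarrow> 'f::{field,finite} mat"
  assumes G: "group G" and card: "card (carrier G) = CHAR('f) ^ N"
    and A: "matrix_rep G r A" and r: "r > 0"
  obtains v where "v \<in> carrier_vec r" "v \<noteq> 0\<^sub>v r" "\<And>g. g \<in> carrier G \<Longrightarrow> A g *\<^sub>v v = v"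
proof -
  interpret group G by fact
  let ?E = "carrier_vec r :: 'f Matrix.vec set"
  let ?p = "CHAR('f)"
  have p: "Factorial_Ring.prime ?p" by (rule prime_CHAR_finite)
  have Ac: "A g \<in> carrier_mat r r" if "g \<in> carrier G" for g using A that by (auto simp: matrix_rep_def)
  \<comment> \<open>The restriction to \<open>?E\<close> makes \<open>act g\<close> extensional, as
    membership in \<open>Bij ?E\<close> requires.\<close>
  define act where "act g = (\<lambda>v\<in>?E. A g *\<^sub>v v)" for g
  have act_mult: "act (g \<otimes> h) v = act g (act h v)" if "g \<in> carrier G" "h \<in> carrier G" "v \<in> ?E" for g h v
    using that A Ac by (auto simp: act_def matrix_rep_def assoc_mult_mat_vec[of _ r r _ r] dest: mult_mat_vec_carrier[of _ r r])
  have act_one: "act \<one> v = v" if "v \<in> ?E" for v using that A by (auto simp: act_def matrix_rep_def)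
  have act_closed: "act g v \<in> ?E" if "g \<in> carrier G" "v \<in> ?E" for g v
    using that Ac by (auto simp: act_def intro: mult_mat_vec_carrier)
  have "act g \<in> Bij ?E" if g: "g \<in> carrier G" for g
  proof -
    have "bij_betw (act g) ?E ?E"
    proof (rule bij_betwI[of _ _ _ "act (inv g)"])
      show "act (inv g) (act g v) = v" "act g (act (inv g) v) = v" if "v \<in> ?E" for v
        using that g by (simp_all add: act_one flip: act_mult)
    qed (use g act_closed in auto)
    then show ?thesis by (auto simp: Bij_def act_def)
  qed
  then have "act \<in> hom G (BijGroup ?E)"
  proof (intro homI)
    fix g h assume gh: "g \<in> carrier G" "h \<in> carrier G" and bij: "\<And>g. g \<in> carrier G \<Longrightarrow> act g \<in> Bij ?E"
    have "act (g \<otimes> h) = compose ?E (act g) (act h)"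
    proof (rule extensionalityI[of _ ?E])
      show "act (g \<otimes> h) \<in> extensional ?E" by (simp add: act_def)
    qed (simp_all add: act_mult gh compose_eq)
    then show "act (g \<otimes> h) = act g \<otimes>\<^bsub>BijGroup ?E\<^esub> act h"
      using gh bij by (simp add: BijGroup_def)
  qed (simp add: BijGroup_def)
  then interpret group_action G ?E act
    by (simp add: group_action_def group_hom_def group_hom_axioms_def group_BijGroup)
  note witness = that
  show ?thesis
  proof (rule ccontr)
    assume no: "\<not> thesis"
    have zero: "0\<^sub>v r \<in> ?E" by simp
    have orb0: "orbit G act (0\<^sub>v r) = {0\<^sub>v r}"
    proof -
      have "act g (0\<^sub>v r) = 0\<^sub>v r" if "g \<in> carrier G" for g
        using Ac[OF that] by (auto simp: act_def)
      then show ?thesis by (auto simp: orbit_def intro!: exI[of _ \<one>])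
    qed
    have dvd: "?p dvd card Q" if Q: "Q \<in> orbits G ?E act - {{0\<^sub>v r}}" for Q
    proof -
      obtain v where v: "v \<in> ?E" "Q = orbit G act v" using Q by (auto simp: orbits_def)
      have "card Q dvd ?p ^ N"
        using orbit_stabilizer_theorem[OF v(1)] card unfolding v(2) Coset.order_def by (metis dvd_triv_left)
      then obtain i where i: "card Q = ?p ^ i" using divides_primepow_nat[OF p] by auto
      have "i \<noteq> 0"
      proof
        assume "i = 0"
        then obtain w where w: "Q = {w}" using i by (auto simp: card_1_singleton_iff)
        moreover have "v \<in> Q" using v orbit_refl by auto
        ultimately have "Q = {v}" by auto
        then have "act g v \<in> {v}" if "g \<in> carrier G" for g using that v(2) unfolding orbit_def by blast
        then have fixed: "A g *\<^sub>v v = v" if "g \<in> carrier G" for g using that v by (simp add: act_def)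
        moreover have "v \<noteq> 0\<^sub>v r" using Q \<open>Q = {v}\<close> by auto
        ultimately show False using no witness[OF v(1)] fixed by blast
      qed
      then show ?thesis using i by simp
    qed
    have fin: "finite (orbits G ?E act)" 
      unfolding orbits_def by (simp add: finite_carrier_vec)
    have part: "Congruence.partition ?E (orbits G ?E act)" by (rule orbit_partition)
    have "card ?E = (\<Sum>Q\<in>orbits G ?E act. card Q)"
    proof -
      have cover: "\<Union>(orbits G ?E act) = ?E" using part by (rule partition.partition_coverture)
      moreover have "pairwise disjnt (orbits G ?E act)"
        using partition.disjoint_union[OF part] by (auto simp: pairwise_def disjnt_def)
      moreover have "finite Q" if "Q \<in> orbits G ?E act" for Q
        by (rule finite_subset[OF Union_upper[OF that, unfolded cover] finite_carrier_vec])
      ultimately show ?thesis using cover card_Union_disjoint[of "orbits G ?E act"] by simp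
    qed
    also have "\<dots> = 1 + (\<Sum>Q\<in>orbits G ?E act - {{0\<^sub>v r}}. card Q)"
      using fin zero orb0 by (subst sum.remove[of _ "{0\<^sub>v r}"]) (auto simp: orbits_def)
    finally have "card ?E = 1 + (\<Sum>Q\<in>orbits G ?E act - {{0\<^sub>v r}}. card Q)" .
    moreover have "?p dvd card ?E"
      unfolding card_carrier_vec by (rule dvd_trans[OF CHAR_dvd_CARD dvd_power]) (use r in simp)
    moreover have "?p dvd (\<Sum>Q\<in>orbits G ?E act - {{0\<^sub>v r}}. card Q)" by (intro dvd_sum dvd)
    ultimately have "?p dvd 1" using dvd_add_left_iff[of ?p _ 1] by simp
    then show False by simp
  qed
qed

text \<open>Put v in place of the k-th unit vector, where v has a nonzero k-th entry; by Cramer's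
  rule the determinant is that entry. A transposition then moves this column to position 0.\<close>

lemma invertible_with_first_column:
  fixes v :: "'a::field Matrix.vec"
  assumes v: "v \<in> carrier_vec n" "v \<noteq> 0\<^sub>v n"
  obtains P Q where "P \<in> carrier_mat n n" "Q \<in> carrier_mat n n" "P * Q = 1\<^sub>m n" "Q * P = 1\<^sub>m n"
    "Matrix.col P 0 = v"
proof -
  obtain k where k: "k < n" "v $ k \<noteq> 0" using v by (auto simp: vec_eq_iff)
  define P0 where "P0 = replace_col (1\<^sub>m n) v k"
  have P0: "P0 \<in> carrier_mat n n" by (simp add: P0_def replace_col_def)
  have "Determinant.det P0 = v $ k"
    using cramer_lemma_mat[of "1\<^sub>m n" n v k] v(1) k by (simp add: P0_def)
  define \<tau> where "\<tau> = Transposition.transpose 0 k"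
  have perm: "\<tau> permutes {0..<n}" unfolding \<tau>_def using k by (intro permutes_swap_id) auto
  define P where "P = transpose_mat (Matrix.mat n n (\<lambda>(i, j). transpose_mat P0 $$ (\<tau> i, j)))"
  have P: "P \<in> carrier_mat n n" by (simp add: P_def)
  have "Determinant.det P = signof \<tau> * v $ k"
    using \<open>Determinant.det P0 = v $ k\<close> P0 perm det_permute_rows[of "transpose_mat P0" n \<tau>]
    by (simp add: P_def det_transpose[of _ n])
  then have "Determinant.det P \<noteq> 0" using k by (simp add: sign_def)
  from det_non_zero_imp_unit[OF P this, of "()"] obtain Q
    where "Q \<in> carrier_mat n n" "P * Q = 1\<^sub>m n" "Q * P = 1\<^sub>m n"
    by (auto simp: Units_def ring_mat_def)
  moreover have "Matrix.col P 0 = v"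
    using k v(1) P0 by (intro eq_vecI) (auto simp: P_def \<tau>_def P0_def replace_col_def)
  ultimately show ?thesis using that P by blast
qed

lemma geometric_sum_root_of_unity:
  fixes z :: "'a::field"
  assumes "z ^ l = 1" "z \<noteq> 1"
  shows "(\<Sum>i<l. z ^ i) = 0"
  using assms by (simp add: geometric_sum)

text \<open>An extension of a group of l-th roots of unity by a p-group, p being the characteristic
  of the field. In the application \<open>N\<close> is k + n: the kernel of \<chi> contains the
  commutator subgroup, of order p^n, with index p^k.\<close>

locale character_with_p_kernel = group G for G :: "('g, 'b) monoid_scheme" (structure) +
  fixes \<chi> :: "'g \<Rightarrow> 'f::{field,finite}" and l N :: nat
  assumes finite_carrier: "finite (carrier G)"
    and char_mult: "\<And>g h. g \<in> carrier G \<Longrightarrow> h \<in> carrier G \<Longrightarrow> \<chi> (g \<otimes> h) = \<chi> g * \<chi> h"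
    and char_pow: "\<And>g. g \<in> carrier G \<Longrightarrow> \<chi> g ^ l = 1"
    and card_kernel: "card {g \<in> carrier G. \<chi> g = 1} = CHAR('f) ^ N"
    and coprime_order: "\<not> CHAR('f) dvd l"
begin

lemma l_pos: "l > 0"
  using coprime_order by (cases l) auto

lemma char_nonzero: "g \<in> carrier G \<Longrightarrow> \<chi> g \<noteq> 0"
  using char_pow[of g] l_pos by (auto simp: power_0_left)

lemma char_one: "\<chi> \<one> = 1"
  using char_mult[of \<one> \<one>] char_nonzero[of \<one>] by simp

lemma char_inv: "g \<in> carrier G \<Longrightarrow> \<chi> (inv g) = inverse (\<chi> g)"
  using char_mult[of g "inv g"] char_one char_nonzero[of g] by (simp add: field_simps)

lemma subgroup_kernel: "subgroup {g \<in> carrier G. \<chi> g = 1} G"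
  by (rule subgroupI) (auto simp: char_mult char_one char_inv intro: one_closed exI[of _ \<one>])

text \<open>If H is the kernel of \<chi> and v is fixed by H, then A g v depends only on \<chi> g.
  The finite Fourier components of this function are eigenvectors or zero, and their sum is l v,
  which is nonzero since p does not divide l.\<close>

lemma common_eigenvector:
  fixes A :: "'g \<Rightarrow> 'f mat"
  assumes A: "matrix_rep G r A" and r: "r > 0"
  obtains v c where "v \<in> carrier_vec r" "v \<noteq> 0\<^sub>v r" "\<And>g. g \<in> carrier G \<Longrightarrow> A g *\<^sub>v v = c g \<cdot>\<^sub>v v"
proof -
  let ?H = "{g \<in> carrier G. \<chi> g = 1}"
  have Ac: "A g \<in> carrier_mat r r" if "g \<in> carrier G" for g using A that by (auto simp: matrix_rep_def)
  have A_mult: "A (g \<otimes> h) = A g * A h" if "g \<in> carrier G" "h \<in> carrier G" for g h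
    using A that by (auto simp: matrix_rep_def)
  have "group (G\<lparr>carrier := ?H\<rparr>)" using subgroup_kernel by (rule subgroup.subgroup_is_group) (rule is_group)
  moreover have "matrix_rep (G\<lparr>carrier := ?H\<rparr>) r A" using A by (auto simp: matrix_rep_def)
  ultimately obtain v where v: "v \<in> carrier_vec r" "v \<noteq> 0\<^sub>v r"
    and fixed: "\<And>g. g \<in> ?H \<Longrightarrow> A g *\<^sub>v v = v"
    using card_kernel r p_group_fixed_vector[of "G\<lparr>carrier := ?H\<rparr>" N r A] by auto
  define u where "u g = A g *\<^sub>v v" for g
  have u_carrier: "u g \<in> carrier_vec r" if "g \<in> carrier G" for g
    using Ac[OF that] v(1) by (simp add: u_def)
  have u_mult: "u (g \<otimes> h) = A g *\<^sub>v u h" if "g \<in> carrier G" "h \<in> carrier G" for g h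
    using that Ac v(1) by (simp add: u_def A_mult assoc_mult_mat_vec[of _ r r _ r])
  have u_eq: "u g = u h" if gh: "g \<in> carrier G" "h \<in> carrier G" and eq: "\<chi> g = \<chi> h" for g h
  proof -
    have "inv g \<otimes> h \<in> ?H" using gh eq char_nonzero[of h] by (simp add: char_mult char_inv)
    then have "u (inv g \<otimes> h) = v" using fixed by (simp add: u_def)
    then have "u (g \<otimes> (inv g \<otimes> h)) = u g" using gh by (subst u_mult) (auto simp: u_def)
    then show ?thesis using gh by (simp flip: m_assoc)
  qed
  let ?Z = "\<chi> ` carrier G"
  \<comment> \<open>An arbitrary section of \<chi>; by \<open>u_eq\<close> the choice does not
    affect \<open>u (sec z)\<close>.\<close>
  define sec where "sec = inv_into (carrier G) \<chi>"
  have sec: "sec z \<in> carrier G" "\<chi> (sec z) = z" if "z \<in> ?Z" for z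
    using that by (auto simp: sec_def inv_into_into f_inv_into_f)
  \<comment> \<open>The component belonging to the i-th power of \<chi>.\<close>
  define w where "w i = Matrix.vec r (\<lambda>a. \<Sum>z\<in>?Z. inverse z ^ i * u (sec z) $ a)" for i
  have w_eigen: "A g *\<^sub>v w i = \<chi> g ^ i \<cdot>\<^sub>v w i" if g: "g \<in> carrier G" for g i
  proof (rule eq_vecI)
    fix a assume "a < dim_vec (\<chi> g ^ i \<cdot>\<^sub>v w i)"
    then have a: "a < r" by (simp add: w_def)
    have "(A g *\<^sub>v w i) $ a = (\<Sum>b<r. A g $$ (a, b) * (\<Sum>z\<in>?Z. inverse z ^ i * u (sec z) $ b))"
      using a Ac[OF g] by (simp add: w_def scalar_prod_def atLeast0LessThan)
    also have "\<dots> = (\<Sum>z\<in>?Z. inverse z ^ i * (\<Sum>b<r. A g $$ (a, b) * u (sec z) $ b))"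
      unfolding sum_distrib_left by (subst sum.swap) (simp add: mult.left_commute)
    also have "\<dots> = (\<Sum>z\<in>?Z. inverse z ^ i * u (sec (\<chi> g * z)) $ a)"
    proof (rule sum.cong)
      fix z assume z: "z \<in> ?Z"
      have gz: "\<chi> g * z \<in> ?Z" using z g by (auto simp flip: char_mult)
      have "(\<Sum>b<r. A g $$ (a, b) * u (sec z) $ b) = (A g *\<^sub>v u (sec z)) $ a"
        using a Ac[OF g] u_carrier[OF sec(1)[OF z]] by (simp add: scalar_prod_def atLeast0LessThan)
      also have "\<dots> = u (sec (\<chi> g * z)) $ a"
        using g sec[OF z] sec[OF gz] by (subst u_mult[symmetric]) (auto simp: char_mult intro!: arg_cong[of _ _ "\<lambda>x. x $ a"] u_eq)
      finally show "inverse z ^ i * (\<Sum>b<r. A g $$ (a, b) * u (sec z) $ b) =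
          inverse z ^ i * u (sec (\<chi> g * z)) $ a" by simp
    qed simp
    \<comment> \<open>The substitution z \<mapsto> \<chi> g * z permutes \<open>?Z\<close> and
      releases the eigenvalue.\<close>
    also have "\<dots> = (\<Sum>z\<in>?Z. \<chi> g ^ i * (inverse z ^ i * u (sec z) $ a))"
    proof (rule sum.reindex_bij_witness[of _ "\<lambda>z. inverse (\<chi> g) * z" "\<lambda>z. \<chi> g * z"])
      fix z assume z: "z \<in> ?Z"
      show "\<chi> g * z \<in> ?Z" using z g by (auto simp flip: char_mult)
      show "inverse (\<chi> g) * z \<in> ?Z" using z g by (auto simp flip: char_mult char_inv)
    qed (use g char_nonzero in \<open>auto simp: field_simps power_mult_distrib power_inverse\<close>)
    also have "\<dots> = (\<chi> g ^ i \<cdot>\<^sub>v w i) $ a"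
      using a by (simp add: w_def sum_distrib_left)
    finally show "(A g *\<^sub>v w i) $ a = (\<chi> g ^ i \<cdot>\<^sub>v w i) $ a" .
  qed (use Ac[OF g] in \<open>simp add: w_def\<close>)
  have "\<exists>i<l. w i \<noteq> 0\<^sub>v r"
  proof (rule ccontr)
    assume no: "\<not> (\<exists>i<l. w i \<noteq> 0\<^sub>v r)"
    have "v $ a = 0" if a: "a < r" for a
    proof -
      have "0 = (\<Sum>i<l. w i $ a)" using no a by simp
      also have "\<dots> = (\<Sum>z\<in>?Z. \<Sum>i<l. inverse z ^ i * u (sec z) $ a)"
        using a by (simp add: w_def sum.swap[of _ _ ?Z])
      \<comment> \<open>Orthogonality: the sum of the powers of an l-th root of unity vanishes
        unless the root is 1.\<close>
      also have "\<dots> = (\<Sum>z\<in>?Z. if z = 1 then of_nat l * v $ a else 0)"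
      proof (rule sum.cong)
        fix z assume z: "z \<in> ?Z"
        then have "inverse z ^ l = 1" using char_pow by (auto simp: power_inverse)
        moreover have "u (sec z) = v" if "z = 1"
          using fixed[of "sec z"] sec[OF z] that by (simp add: u_def)
        ultimately show "(\<Sum>i<l. inverse z ^ i * u (sec z) $ a) = (if z = 1 then of_nat l * v $ a else 0)"
          by (auto simp: geometric_sum_root_of_unity simp flip: sum_distrib_right)
      qed simp
      also have "\<dots> = of_nat l * v $ a"
        using finite_carrier char_one by (subst sum.delta) (auto simp: image_iff intro!: bexI[of _ \<one>])
      finally show ?thesis using coprime_order by (simp add: of_nat_eq_0_iff_char_dvd)
    qed
    then show False using v by (auto simp: vec_eq_iff)
  qed
  then obtain i where "w i \<noteq> 0\<^sub>v r" by auto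
  then show ?thesis using that[of "w i" "\<lambda>g. \<chi> g ^ i"] w_eigen by (auto simp: w_def)
qed

end

section \<open>Determinants with coefficients in a group ring, under change of basis and
  triangularization\<close>

lemma block_mat_conjugate:
  fixes P :: "'a::comm_ring_1 mat" and L M :: "'g \<Rightarrow> 'a mat" and C :: "nat \<Rightarrow> nat \<Rightarrow> 'g \<Rightarrow> 'a poly"
  assumes P: "P \<in> carrier_mat r r" and L: "\<And>g. g \<in> S \<Longrightarrow> L g \<in> carrier_mat r r"
    and M: "\<And>g. g \<in> S \<Longrightarrow> M g \<in> carrier_mat r r" and eq: "\<And>g. g \<in> S \<Longrightarrow> L g * P = P * M g"
  shows "block_mat r n (\<lambda>a u b v. \<Sum>g\<in>S. C u v g * [:L g $$ (a, b):]) *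
      block_mat r n (\<lambda>a u b v. if u = v then [:P $$ (a, b):] else 0) =
    block_mat r n (\<lambda>a u b v. if u = v then [:P $$ (a, b):] else 0) *
      block_mat r n (\<lambda>a u b v. \<Sum>g\<in>S. C u v g * [:M g $$ (a, b):])"
  unfolding block_mat_mult
proof (rule block_mat_cong)
  fix a u b v assume *: "a < r" "u < n" "b < r" "v < n"
  have index: "(L g * P) $$ (a, b) = (\<Sum>c<r. L g $$ (a, c) * P $$ (c, b))"
    "(P * M g) $$ (a, b) = (\<Sum>c<r. P $$ (a, c) * M g $$ (c, b))" if "g \<in> S" for g
    using L[OF that] M[OF that] P * by (simp_all add: scalar_prod_def atLeast0LessThan)
  have delta: "(\<Sum>w<n. F w * (if w = v then p else 0)) = F v * p"
    "(\<Sum>w<n. (if u = w then p else 0) * F w) = p * F u" for p :: "'a poly" and F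
    using * by (simp_all add: if_distrib[of "\<lambda>x. _ * x"] if_distrib[of "\<lambda>x. x * _"] cong: if_cong)
  have "(\<Sum>c<r. \<Sum>w<n. (\<Sum>g\<in>S. C u w g * [:L g $$ (a, c):]) * (if w = v then [:P $$ (c, b):] else 0)) =
      (\<Sum>c<r. \<Sum>g\<in>S. C u v g * [:L g $$ (a, c) * P $$ (c, b):])"
    unfolding delta by (simp add: smult_sum2 mult.commute)
  also have "\<dots> = (\<Sum>g\<in>S. C u v g * [:(L g * P) $$ (a, b):])"
    by (subst sum.swap) (simp add: index smult_sum cong: sum.cong)
  also have "\<dots> = (\<Sum>g\<in>S. C u v g * [:(P * M g) $$ (a, b):])"
    by (simp add: eq)
  also have "\<dots> = (\<Sum>c<r. \<Sum>g\<in>S. C u v g * [:P $$ (a, c) * M g $$ (c, b):])"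
    by (subst sum.swap) (simp add: index smult_sum cong: sum.cong)
  also have "\<dots> = (\<Sum>c<r. \<Sum>w<n. (if u = w then [:P $$ (a, c):] else 0) * (\<Sum>g\<in>S. C w v g * [:M g $$ (c, b):]))"
    unfolding delta by (simp add: smult_sum2)
  finally show "(\<Sum>c<r. \<Sum>w<n. (\<Sum>g\<in>S. C u w g * [:L g $$ (a, c):]) * (if w = v then [:P $$ (c, b):] else 0)) =
    (\<Sum>c<r. \<Sum>w<n. (if u = w then [:P $$ (a, c):] else 0) * (\<Sum>g\<in>S. C w v g * [:M g $$ (c, b):]))" .
qed

text \<open>The block matrices are sums of Kronecker products, and the intertwining by P passes to P
  tensored with the identity. That factor has nonzero determinant and cancels. Only the intertwining
  matters, so \<open>M\<close> may be a twist of \<open>L\<close> by scalars.\<close>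

lemma det_block_mat_conjugate:
  fixes P :: "'a::idom mat" and L M :: "'g \<Rightarrow> 'a mat" and C :: "nat \<Rightarrow> nat \<Rightarrow> 'g \<Rightarrow> 'a poly"
  assumes P: "P \<in> carrier_mat r r" and Q: "Q \<in> carrier_mat r r" and PQ: "P * Q = 1\<^sub>m r"
    and L: "\<And>g. g \<in> S \<Longrightarrow> L g \<in> carrier_mat r r"
    and M: "\<And>g. g \<in> S \<Longrightarrow> M g \<in> carrier_mat r r" and eq: "\<And>g. g \<in> S \<Longrightarrow> L g * P = P * M g"
  shows "Determinant.det (block_mat r n (\<lambda>a u b v. \<Sum>g\<in>S. C u v g * [:L g $$ (a, b):])) =
    Determinant.det (block_mat r n (\<lambda>a u b v. \<Sum>g\<in>S. C u v g * [:M g $$ (a, b):]))"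
proof -
  let ?K = "\<lambda>P. block_mat r n (\<lambda>a u b v. if u = v then [:P $$ (a, b) :: 'a:] else 0)"
  have const: "(\<Sum>c<r. [:f c:]) = [:\<Sum>c<r. f c:]" for f :: "nat \<Rightarrow> 'a"
    by (induction r) auto
  have "?K P * ?K Q = block_mat r n (\<lambda>a u b v. if a = b \<and> u = v then 1 else 0)"
    unfolding block_mat_mult
  proof (rule block_mat_cong)
    fix a u b v assume *: "a < r" "u < n" "b < r" "v < n"
    have "(\<Sum>c<r. \<Sum>w<n. (if u = w then [:P $$ (a, c):] else 0) * (if w = v then [:Q $$ (c, b):] else 0)) =
        (if u = v then [:(P * Q) $$ (a, b):] else 0)"
      using * P Q
      by (simp add: if_distrib[of "\<lambda>x. x * _"] scalar_prod_def atLeast0LessThan const[symmetric] cong: if_cong)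
    then show "(\<Sum>c<r. \<Sum>w<n. (if u = w then [:P $$ (a, c):] else 0) * (if w = v then [:Q $$ (c, b):] else 0)) =
        (if a = b \<and> u = v then 1 else 0)"
      using * by (auto simp: PQ)
  qed
  then have "Determinant.det (?K P * ?K Q) = 1"
    by (simp add: block_mat_one)
  then have "Determinant.det (?K P) * Determinant.det (?K Q) = 1"
    by (simp add: det_mult[of _ "r * n"])
  then have "Determinant.det (?K P) \<noteq> 0" by auto
  moreover have "Determinant.det (block_mat r n (\<lambda>a u b v. \<Sum>g\<in>S. C u v g * [:L g $$ (a, b):])) * Determinant.det (?K P) =
      Determinant.det (?K P) * Determinant.det (block_mat r n (\<lambda>a u b v. \<Sum>g\<in>S. C u v g * [:M g $$ (a, b):]))"
    using arg_cong[where f = Determinant.det, OF block_mat_conjugate[OF P L M eq, where n = n and C = C]]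
    by (simp add: det_mult[of _ "r * n"])
  ultimately show ?thesis by simp
qed

context character_with_p_kernel
begin

text \<open>Induction on the degree: a common eigenvector, taken as first basis vector, splits off a
  character \<open>c\<close> and leaves the quotient representation. The characters are chosen
  before \<open>n\<close> and \<open>C\<close>, so the same ones compute every determinant formed
  from this representation.\<close>

lemma det_block_mat_rep:
  fixes A :: "'g \<Rightarrow> 'f mat"
  assumes "matrix_rep G r A"
  shows "\<exists>d. (\<forall>a<r. d a \<one> = 1 \<and> (\<forall>g\<in>carrier G. \<forall>h\<in>carrier G. d a (g \<otimes> h) = d a g * d a h)) \<and>
    (\<forall>n C. Determinant.det (block_mat r n (\<lambda>a u b v. \<Sum>g\<in>carrier G. C u v g * [:A g $$ (a, b):])) =
      (\<Prod>a<r. Determinant.det (Matrix.mat n n (\<lambda>(u, v). \<Sum>g\<in>carrier G. C u v g * [:d a g:]))))"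
  using assms
proof (induction r arbitrary: A)
  case 0
  then show ?case by (simp add: block_mat_def)
next
  case (Suc r)
  let ?r = "Suc r"
  have Ac: "A g \<in> carrier_mat ?r ?r" if "g \<in> carrier G" for g using Suc.prems that by (auto simp: matrix_rep_def)
  have A_mult: "A (g \<otimes> h) = A g * A h" if "g \<in> carrier G" "h \<in> carrier G" for g h
    using Suc.prems that by (auto simp: matrix_rep_def)
  have A_one: "A \<one> = 1\<^sub>m ?r" using Suc.prems by (auto simp: matrix_rep_def)
  obtain v c where v: "v \<in> carrier_vec ?r" "v \<noteq> 0\<^sub>v ?r"
    and eigen: "\<And>g. g \<in> carrier G \<Longrightarrow> A g *\<^sub>v v = c g \<cdot>\<^sub>v v"
    using common_eigenvector[OF Suc.prems] by blast
  obtain P Q where P: "P \<in> carrier_mat ?r ?r" and Q: "Q \<in> carrier_mat ?r ?r"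
    and PQ: "P * Q = 1\<^sub>m ?r" and QP: "Q * P = 1\<^sub>m ?r" and col: "Matrix.col P 0 = v"
    using invertible_with_first_column[OF v] .
  define B where "B g = Q * (A g * P)" for g
  have Bc: "B g \<in> carrier_mat ?r ?r" if "g \<in> carrier G" for g using Ac[OF that] P Q by (simp add: B_def)
  have conj: "A g * P = P * B g" if "g \<in> carrier G" for g
  proof -
    have "P * B g = (P * Q) * (A g * P)"
      unfolding B_def using Ac[OF that] P Q by (intro assoc_mult_mat[symmetric]) auto
    then show ?thesis using Ac[OF that] P by (simp add: PQ)
  qed
  have B_mult: "B (g \<otimes> h) = B g * B h" if gh: "g \<in> carrier G" "h \<in> carrier G" for g h
  proof -
    have "B (g \<otimes> h) = Q * (A g * (A h * P))"
      unfolding B_def A_mult[OF gh]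
      by (rule arg_cong[of _ _ "(*) Q"], rule assoc_mult_mat) (use Ac[OF gh(1)] Ac[OF gh(2)] P in auto)
    also have "\<dots> = Q * ((A g * P) * B h)"
      unfolding conj[OF gh(2)]
      by (rule arg_cong[of _ _ "(*) Q"], rule assoc_mult_mat[symmetric]) (use Ac[OF gh(1)] P Bc[OF gh(2)] in auto)
    also have "\<dots> = (Q * (A g * P)) * B h"
      using Ac[OF gh(1)] P Q Bc[OF gh(2)] by (intro assoc_mult_mat[symmetric]) auto
    also have "\<dots> = B g * B h" by (simp only: B_def[of g])
    finally show ?thesis .
  qed
  have B_one: "B \<one> = 1\<^sub>m ?r" using P by (simp add: B_def A_one QP)
  have B_col: "B g $$ (i, 0) = (if i = 0 then c g else 0)" if g: "g \<in> carrier G" and i: "i < ?r" for g i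
  proof -
    have "Matrix.col (A g * P) 0 = A g *\<^sub>v v" using Ac[OF g] P col col_mult2[of "A g" ?r ?r P ?r 0] by simp
    then have "Matrix.col (B g) 0 = Q *\<^sub>v (c g \<cdot>\<^sub>v v)"
      using Ac[OF g] P Q eigen[OF g] col_mult2[of Q ?r ?r "A g * P" ?r 0] by (simp add: B_def)
    also have "\<dots> = c g \<cdot>\<^sub>v Matrix.col (Q * P) 0"
      using P Q v col col_mult2[of Q ?r ?r P ?r 0] by (simp add: mult_mat_vec[of _ ?r ?r])
    finally have "Matrix.col (B g) 0 = c g \<cdot>\<^sub>v Matrix.col (1\<^sub>m ?r) 0" by (simp add: QP)
    then have "Matrix.col (B g) 0 $ i = (c g \<cdot>\<^sub>v Matrix.col (1\<^sub>m ?r) 0) $ i" by simp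
    then show ?thesis using Bc[OF g] i by auto
  qed
  \<comment> \<open>The action on the quotient by the eigenvector. It is multiplicative because the
    first column of \<open>B g\<close> vanishes below the corner.\<close>
  define A' where "A' g = Matrix.mat r r (\<lambda>(i, j). B g $$ (Suc i, Suc j))" for g
  have B_mult_index: "B (g \<otimes> h) $$ (i, j) = (\<Sum>k<?r. B g $$ (i, k) * B h $$ (k, j))"
    if "g \<in> carrier G" "h \<in> carrier G" "i < ?r" "j < ?r" for g h i j
    using that Bc[of g] Bc[of h] by (simp add: B_mult scalar_prod_def atLeast0LessThan del: sum.lessThan_Suc)
  have "matrix_rep G r A'"
    unfolding matrix_rep_def
  proof (intro conjI ballI)
    fix g h assume gh: "g \<in> carrier G" "h \<in> carrier G"
    show "A' (g \<otimes> h) = A' g * A' h"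
      by (rule eq_matI)
        (auto simp: A'_def B_mult_index[OF gh] B_col[OF gh(1)] sum.lessThan_Suc_shift scalar_prod_def atLeast0LessThan
          simp del: sum.lessThan_Suc)
  qed (auto simp: A'_def B_one)
  from Suc.IH[OF this] obtain d where d: "\<forall>a<r. d a \<one> = 1 \<and> (\<forall>g\<in>carrier G. \<forall>h\<in>carrier G. d a (g \<otimes> h) = d a g * d a h)"
    and det: "\<And>n C. Determinant.det (block_mat r n (\<lambda>a u b v. \<Sum>g\<in>carrier G. C u v g * [:A' g $$ (a, b):])) =
      (\<Prod>a<r. Determinant.det (Matrix.mat n n (\<lambda>(u, v). \<Sum>g\<in>carrier G. C u v g * [:d a g:])))"
    by blast
  define d' where "d' a = (case a of 0 \<Rightarrow> c | Suc a \<Rightarrow> d a)" for a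
  have c_eq: "c g = B g $$ (0, 0)" if "g \<in> carrier G" for g using B_col[OF that, of 0] by simp
  have c_mult: "c (g \<otimes> h) = c g * c h" if gh: "g \<in> carrier G" "h \<in> carrier G" for g h
  proof -
    have "c (g \<otimes> h) = B (g \<otimes> h) $$ (0, 0)" using gh by (intro c_eq) simp
    also have "\<dots> = (\<Sum>k<?r. B g $$ (0, k) * B h $$ (k, 0))" using gh by (intro B_mult_index) auto
    also have "\<dots> = c g * c h"
      unfolding sum.lessThan_Suc_shift using gh by (simp add: B_col)
    finally show ?thesis .
  qed
  have c_one: "c \<one> = 1" by (simp add: c_eq B_one)
  show ?case
  proof (intro exI[of _ d'] conjI allI impI)
    fix a assume "a < ?r"
    then show "d' a \<one> = 1" "\<forall>g\<in>carrier G. \<forall>h\<in>carrier G. d' a (g \<otimes> h) = d' a g * d' a h"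
      using d c_mult c_one by (auto simp: d'_def split: nat.split)
  next
    fix n and C :: "nat \<Rightarrow> nat \<Rightarrow> 'g \<Rightarrow> 'f poly"
    have "Determinant.det (block_mat ?r n (\<lambda>a u b v. \<Sum>g\<in>carrier G. C u v g * [:A g $$ (a, b):])) =
        Determinant.det (block_mat ?r n (\<lambda>a u b v. \<Sum>g\<in>carrier G. C u v g * [:B g $$ (a, b):]))"
      by (rule det_block_mat_conjugate[OF P Q PQ Ac Bc conj])
    also have "\<dots> = Determinant.det (Matrix.mat n n (\<lambda>(u, v). \<Sum>g\<in>carrier G. C u v g * [:B g $$ (0, 0):])) *
        Determinant.det (block_mat r n (\<lambda>a u b v. \<Sum>g\<in>carrier G. C u v g * [:B g $$ (Suc a, Suc b):]))"
      by (rule det_block_mat_triangular) (simp add: B_col)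
    also have "block_mat r n (\<lambda>a u b v. \<Sum>g\<in>carrier G. C u v g * [:B g $$ (Suc a, Suc b):]) =
        block_mat r n (\<lambda>a u b v. \<Sum>g\<in>carrier G. C u v g * [:A' g $$ (a, b):])"
      by (rule block_mat_cong) (simp add: A'_def)
    also have "Matrix.mat n n (\<lambda>(u, v). \<Sum>g\<in>carrier G. C u v g * [:B g $$ (0, 0):]) =
        Matrix.mat n n (\<lambda>(u, v). \<Sum>g\<in>carrier G. C u v g * [:c g:])"
      by (simp add: c_eq cong: sum.cong)
    finally show "Determinant.det (block_mat ?r n (\<lambda>a u b v. \<Sum>g\<in>carrier G. C u v g * [:A g $$ (a, b):])) =
        (\<Prod>a<?r. Determinant.det (Matrix.mat n n (\<lambda>(u, v). \<Sum>g\<in>carrier G. C u v g * [:d' a g:])))"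
      unfolding det prod.lessThan_Suc_shift by (simp add: d'_def)
  qed
qed

end

section \<open>Roots of unity and the distribution of eigenvalues\<close>

lemma bij_betw_roots_of_unity:
  fixes z :: "'a::field"
  assumes "primitive_root_of_unity l z"
  shows "bij_betw (\<lambda>i. z ^ i) {..<l} {y. y ^ l = 1}"
proof -
  have l: "l > 0" and zl: "z ^ l = 1" and prim: "\<And>i. 0 < i \<Longrightarrow> i < l \<Longrightarrow> z ^ i \<noteq> 1"
    using assms by (auto simp: primitive_root_of_unity_def)
  have "z \<noteq> 0" using zl l by (auto simp: power_0_left)
  have False if "i < j" "j < l" "z ^ i = z ^ j" for i j
  proof -
    have "z ^ i * z ^ (j - i) = z ^ j" using that by (metis le_add_diff_inverse less_imp_le power_add)
    then have "z ^ (j - i) = 1" using \<open>z \<noteq> 0\<close> that(3) by simp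
    then show False using prim[of "j - i"] that by simp
  qed
  then have inj: "inj_on (\<lambda>i. z ^ i) {..<l}"
    by (intro inj_onI) (metis lessThan_iff linorder_neqE_nat)
  \<comment> \<open>This polynomial has at most l roots, so the l distinct powers of z exhaust
    them.\<close>
  let ?p = "Polynomial.monom 1 l - 1 :: 'a poly"
  have "Polynomial.coeff ?p l = 1" using l by simp
  then have "?p \<noteq> 0" by force
  have roots: "{y. y ^ l = 1} = {y. poly ?p y = 0}" by (auto simp: poly_monom)
  have "Polynomial.degree ?p \<le> l" by (intro degree_diff_le) (auto simp: degree_monom_le)
  then have card: "card {y::'a. y ^ l = 1} \<le> l" and fin: "finite {y::'a. y ^ l = 1}"
    using poly_roots_degree[OF \<open>?p \<noteq> 0\<close>] poly_roots_finite[OF \<open>?p \<noteq> 0\<close>] by (auto simp: roots)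
  have "(\<lambda>i. z ^ i) ` {..<l} = {y. y ^ l = 1}"
  proof (rule card_seteq[OF fin])
    show "(\<lambda>i. z ^ i) ` {..<l} \<subseteq> {y. y ^ l = 1}"
      using zl by (auto simp flip: power_mult simp: mult.commute[of _ l]) (simp add: power_mult)
  qed (use card in \<open>simp add: card_image[OF inj]\<close>)
  with inj show ?thesis by (simp add: bij_betw_def)
qed

lemma prod_roots_of_unity:
  fixes z :: "'a::field"
  assumes "primitive_root_of_unity l z"
  shows "(\<Prod>i<l. F (z ^ i)) = (\<Prod>y\<in>{y. y ^ l = 1}. F y)"
  using prod.reindex_bij_betw[OF bij_betw_roots_of_unity[OF assms]] .

text \<open>By the Frobenius identity, y^(p^N) - 1 is the p^N-th power of y - 1.\<close>

lemma power_CHAR_power_eq_one: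
  fixes y :: "'f::{field,finite}"
  assumes "y ^ (CHAR('f) ^ N) = 1"
  shows "y = 1"
proof -
  have "Factorial_Ring.prime CHAR('f)" by (rule prime_CHAR_finite)
  then have "((y - 1) + 1) ^ (CHAR('f) ^ N) = (y - 1) ^ (CHAR('f) ^ N) + 1"
    by (subst freshmans_dream') auto
  then show ?thesis using assms by simp
qed

text \<open>By unique factorization the hypothesis \<open>inv\<close> makes the multiset of the
  values \<open>c a\<close> invariant under multiplication by z. Since z generates the l-th roots of
  unity, they all have the same multiplicity, and comparing sizes shows that it is k.\<close>

lemma prod_scaling_invariant:
  fixes c :: "nat \<Rightarrow> 'a::field"
  assumes z: "primitive_root_of_unity l z" and roots: "\<And>a. a < r \<Longrightarrow> c a ^ l = 1"
    and inv: "(\<Prod>a<r. [:- c a, 1:]) = (\<Prod>a<r. [:- (z * c a), 1:])"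
    and r: "r = l * k"
  shows "(\<Prod>a<r. F (c a)) = (\<Prod>i<l. F (z ^ i)) ^ k"
proof -
  have l: "l > 0" and zl: "z ^ l = 1" using z by (auto simp: primitive_root_of_unity_def)
  have "z \<noteq> 0" using zl l by (auto simp: power_0_left)
  define S where "S = image_mset c (mset_set {..<r})"
  have proots: "proots (\<Prod>a<r. [:- b a, 1:]) = image_mset b (mset_set {..<r})" for b :: "nat \<Rightarrow> 'a"
    by (subst proots_prod) (auto simp: sum_unfold_sum_mset)
  have S_inv: "image_mset (\<lambda>y. z * y) S = S"
    using arg_cong[OF inv, of proots] unfolding proots S_def image_mset.compositionality o_def by (rule HOL.sym)
  have "count S (z * y) = count S y" for y
  proof -
    have "count (image_mset (\<lambda>y. z * y) T) (z * y) = count T y" for T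
      using \<open>z \<noteq> 0\<close> by (induction T) auto
    from this[of S] show ?thesis by (simp only: S_inv)
  qed
  then have count_pow: "count S (z ^ i) = count S 1" for i by (induction i) auto
  let ?U = "image_mset (\<lambda>i. z ^ i) (mset_set {..<l})"
  have bij: "bij_betw (\<lambda>i. z ^ i) {..<l} {y. y ^ l = 1}" by (rule bij_betw_roots_of_unity[OF z])
  have U: "?U = mset_set {y. y ^ l = 1}"
    using bij by (simp add: image_mset_mset_set bij_betw_def)
  have "S = repeat_mset (count S 1) ?U"
  proof (rule multiset_eqI)
    fix y
    show "count S y = count (repeat_mset (count S 1) ?U) y"
    proof (cases "y ^ l = 1")
      case True
      then obtain i where "y = z ^ i" using bij by (auto simp: bij_betw_def)
      moreover have "finite {y::'a. y ^ l = 1}" using bij by (metis bij_betw_finite finite_lessThan)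
      ultimately show ?thesis using True count_pow by (simp add: U)
    next
      case False
      then have "y \<notin># S" using roots by (auto simp: S_def)
      then show ?thesis using False by (simp add: U not_in_iff)
    qed
  qed
  moreover have "size S = r" by (simp add: S_def)
  ultimately have "r = count S 1 * l" by (metis size_repeat_mset size_image_mset size_mset_set card_lessThan)
  then have "count S 1 = k" using r l by simp
  then have "S = repeat_mset k ?U" using \<open>S = repeat_mset (count S 1) ?U\<close> by simp
  then have "prod_mset (image_mset F S) = prod_mset (image_mset F ?U) ^ k"
  proof -
    have "prod_mset (image_mset F (repeat_mset k T)) = prod_mset (image_mset F T) ^ k" for T
      by (induction k) auto
    then show ?thesis by (simp only: \<open>S = repeat_mset k ?U\<close>)
  qed
  then show ?thesis
    by (simp add: S_def image_mset.compositionality o_def prod_unfold_prod_mset)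
qed

text \<open>The fibres of \<chi> over the l powers of \<open>\<chi> x\<close> partition the group,
  and left translation by a power of x carries the kernel to each of them.\<close>

lemma (in group) card_kernel_character:
  fixes \<chi> :: "'a \<Rightarrow> 'f::field"
  assumes fin: "finite (carrier G)"
    and mult: "\<And>g h. g \<in> carrier G \<Longrightarrow> h \<in> carrier G \<Longrightarrow> \<chi> (g \<otimes> h) = \<chi> g * \<chi> h"
    and pow: "\<And>g. g \<in> carrier G \<Longrightarrow> \<chi> g ^ l = 1"
    and x: "x \<in> carrier G" "primitive_root_of_unity l (\<chi> x)"
  shows "card (carrier G) = l * card {g \<in> carrier G. \<chi> g = 1}"
proof -
  let ?F = "\<lambda>i. {g \<in> carrier G. \<chi> g = \<chi> x ^ i}"
  have bij: "bij_betw (\<lambda>i. \<chi> x ^ i) {..<l} {y. y ^ l = 1}" by (rule bij_betw_roots_of_unity[OF x(2)])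
  have l: "l > 0" using x(2) by (simp add: primitive_root_of_unity_def)
  have nz: "\<chi> g \<noteq> 0" if "g \<in> carrier G" for g using pow[OF that] l by (auto simp: power_0_left)
  have one: "\<chi> \<one> = 1" using mult[of \<one> \<one>] nz[of \<one>] by simp
  have inv: "\<chi> (inv g) = inverse (\<chi> g)" if "g \<in> carrier G" for g
    using mult[of g "inv g"] that one nz[of g] by (simp add: field_simps)
  have xpow: "\<chi> (x [^] (i::nat)) = \<chi> x ^ i" for i
    using x(1) by (induction i) (simp_all add: one mult)
  have "card (?F i) = card (?F 0)" for i
  proof (rule bij_betw_same_card[symmetric], rule bij_betwI[of "\<lambda>g. x [^] i \<otimes> g" _ _ "\<lambda>g. inv (x [^] i) \<otimes> g"])
    show "(\<lambda>g. x [^] i \<otimes> g) \<in> ?F 0 \<rightarrow> ?F i" using x(1) by (auto simp: mult xpow)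
    show "(\<lambda>g. inv (x [^] i) \<otimes> g) \<in> ?F i \<rightarrow> ?F 0" using x(1) nz[of "x"] by (auto simp: mult inv xpow)
  qed (use x(1) in \<open>auto simp flip: m_assoc\<close>)
  then have "(\<Sum>i<l. card (?F i)) = l * card (?F 0)" by simp
  moreover have "card (\<Union>i<l. ?F i) = (\<Sum>i<l. card (?F i))"
    using bij fin by (intro card_UN_disjoint) (auto simp: bij_betw_def inj_on_def)
  moreover have "(\<Union>i<l. ?F i) = carrier G"
  proof -
    have "\<exists>i<l. \<chi> g = \<chi> x ^ i" if "g \<in> carrier G" for g
    proof -
      have "\<chi> g \<in> (\<lambda>i. \<chi> x ^ i) ` {..<l}" using bij pow[OF that] by (simp add: bij_betw_def)
      then show ?thesis by auto
    qed
    then show ?thesis by auto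
  qed
  ultimately show ?thesis by simp
qed

text \<open>The matrices act on row vectors, so right multiplication gives a homomorphism and not an
  antihomomorphism.\<close>

lemma matrix_rep_regular:
  fixes G (structure) and e :: "nat \<Rightarrow> 'g"
  assumes "group G" and e: "bij_betw e {..<r} (carrier G)"
  shows "matrix_rep G r (\<lambda>g. Matrix.mat r r (\<lambda>(a, b). if e a \<otimes> g = e b then 1 else 0 :: 'a::comm_ring_1))"
proof -
  interpret group G by fact
  have ec: "e a \<in> carrier G" if "a < r" for a using e that by (auto simp: bij_betw_def)
  have inj: "e a = e b \<longleftrightarrow> a = b" if "a < r" "b < r" for a b
    using e that by (auto simp: bij_betw_def inj_on_def)
  show ?thesis
    unfolding matrix_rep_def
  proof (intro conjI ballI)
    fix g h assume gh: "g \<in> carrier G" "h \<in> carrier G"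
    have "(\<Sum>c<r. (if e a \<otimes> g = e c then 1 else 0) * (if e c \<otimes> h = e b then 1 else 0)) =
        (if e a \<otimes> (g \<otimes> h) = e b then 1 else 0 :: 'a)" if ab: "a < r" "b < r" for a b
    proof -
      have "e a \<otimes> g \<in> e ` {..<r}" using e gh ec[OF ab(1)] by (auto simp: bij_betw_def)
      then obtain c where c: "c < r" "e a \<otimes> g = e c" by auto
      have "(\<Sum>c'<r. (if e a \<otimes> g = e c' then 1 else 0) * (if e c' \<otimes> h = e b then 1 else 0)) =
        (\<Sum>c'<r. if c' = c then (if e c \<otimes> h = e b then 1 else 0) else (0 :: 'a))"
        using c inj by (intro sum.cong) auto
      then show ?thesis using c gh ec[OF ab(1)] by (simp flip: m_assoc)
    qed
    then show "Matrix.mat r r (\<lambda>(a, b). if e a \<otimes> (g \<otimes> h) = e b then 1 else 0 :: 'a) =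
        Matrix.mat r r (\<lambda>(a, b). if e a \<otimes> g = e b then 1 else 0) *
        Matrix.mat r r (\<lambda>(a, b). if e a \<otimes> h = e b then 1 else 0)"
      by (intro eq_matI) (auto simp: scalar_prod_def atLeast0LessThan)
  qed (auto intro!: eq_matI simp: ec inj)
qed

context character_with_p_kernel
begin

text \<open>The regular representation is isomorphic to its twist by \<chi>. Comparing
  characteristic polynomials at x shows that the multiset of the values \<open>d a x\<close> is
  invariant under multiplication by \<open>\<chi> x\<close>, a primitive l-th root of unity.\<close>

lemma det_block_mat_regular:
  fixes e :: "nat \<Rightarrow> 'g" and n :: nat and C :: "nat \<Rightarrow> nat \<Rightarrow> 'g \<Rightarrow> 'f poly"
  assumes e: "bij_betw e {..<r} (carrier G)"
    and x: "x \<in> carrier G" "primitive_root_of_unity l (\<chi> x)"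
    and order: "card (carrier G) = l * CHAR('f) ^ N"
  obtains d where "\<And>a. a < r \<Longrightarrow> d a \<one> = 1"
    "\<And>a g h. a < r \<Longrightarrow> g \<in> carrier G \<Longrightarrow> h \<in> carrier G \<Longrightarrow> d a (g \<otimes> h) = d a g * d a h"
    "\<And>n C. Determinant.det (block_mat r n (\<lambda>a u b v. \<Sum>g\<in>carrier G. C u v g * (if e a \<otimes> g = e b then 1 else 0))) =
      (\<Prod>a<r. Determinant.det (Matrix.mat n n (\<lambda>(u, v). \<Sum>g\<in>carrier G. C u v g * [:d a g:])))"
    "\<And>F :: 'f \<Rightarrow> 'f poly. (\<Prod>a<r. F (d a x)) = (\<Prod>i<l. F (\<chi> x ^ i)) ^ (CHAR('f) ^ N)"
proof -
  define A where "A g = Matrix.mat r r (\<lambda>(a, b). if e a \<otimes> g = e b then 1 else 0 :: 'f)" for g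
  have rep: "matrix_rep G r A"
    unfolding A_def[abs_def] by (rule matrix_rep_regular[OF is_group e])
  obtain d where d: "\<forall>a<r. d a \<one> = 1 \<and> (\<forall>g\<in>carrier G. \<forall>h\<in>carrier G. d a (g \<otimes> h) = d a g * d a h)"
    and det: "\<And>n C. Determinant.det (block_mat r n (\<lambda>a u b v. \<Sum>g\<in>carrier G. C u v g * [:A g $$ (a, b):])) =
      (\<Prod>a<r. Determinant.det (Matrix.mat n n (\<lambda>(u, v). \<Sum>g\<in>carrier G. C u v g * [:d a g:])))"
    using det_block_mat_rep[OF rep] by blast
  have r: "r = l * CHAR('f) ^ N" using bij_betw_same_card[OF e] order by simp
  have ec: "e a \<in> carrier G" if "a < r" for a using e that by (auto simp: bij_betw_def)
  \<comment> \<open>Rescaling the basis vector \<open>e a\<close> by \<open>\<chi> (e a)\<close>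
    realizes the isomorphism with the twist.\<close>
  define P where "P = Matrix.mat r r (\<lambda>(a, b). if a = b then \<chi> (e a) else 0)"
  define Q where "Q = Matrix.mat r r (\<lambda>(a, b). if a = b then inverse (\<chi> (e a)) else 0)"
  have diag: "(\<Sum>c<r. (if a = c then y c else 0) * w c) = y a * w a"
    "(\<Sum>c<r. w c * (if c = a then y c else 0)) = w a * y a" if "a < r" for a and y w :: "nat \<Rightarrow> 'f"
    using that by (simp_all add: if_distrib[of "\<lambda>x. _ * x"] if_distrib[of "\<lambda>x. x * _"] cong: if_cong)
  have "P * Q = 1\<^sub>m r"
    by (rule eq_matI) (auto simp: P_def Q_def scalar_prod_def atLeast0LessThan diag char_nonzero ec)
  have twist: "A g * P = P * (\<chi> g \<cdot>\<^sub>m A g)" if g: "g \<in> carrier G" for g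
  proof (rule eq_matI)
    fix a b assume "a < dim_row (P * (\<chi> g \<cdot>\<^sub>m A g))" "b < dim_col (P * (\<chi> g \<cdot>\<^sub>m A g))"
    then have ab: "a < r" "b < r" by (auto simp: P_def A_def)
    then have "(A g * P) $$ (a, b) = A g $$ (a, b) * \<chi> (e b)"
      by (simp add: P_def A_def scalar_prod_def atLeast0LessThan diag)
    also have "\<dots> = \<chi> (e a) * (\<chi> g * A g $$ (a, b))"
      using ab g ec by (auto simp: A_def simp flip: char_mult)
    also have "\<dots> = (P * (\<chi> g \<cdot>\<^sub>m A g)) $$ (a, b)"
      using ab by (simp add: P_def A_def scalar_prod_def atLeast0LessThan diag)
    finally show "(A g * P) $$ (a, b) = (P * (\<chi> g \<cdot>\<^sub>m A g)) $$ (a, b)" .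
  qed (auto simp: P_def A_def)
  \<comment> \<open>The group ring element t - y x, whose 1 by 1 block determinant is a
    characteristic polynomial. Writing it as a difference of two delta functions also covers the
    case that x is the identity.\<close>
  let ?C = "\<lambda>y g. (if g = \<one> then [:0, 1:] else 0) - (if g = x then [:y:] else 0 :: 'f poly)"
  have single: "Determinant.det (Matrix.mat 1 1 (\<lambda>(u, v). \<Sum>g\<in>carrier G. ?C y g * [:d a g:])) = [:- (y * d a x), 1:]"
    if "a < r" for a y
  proof -
    have "(\<Sum>g\<in>carrier G. ?C y g * [:d a g:]) =
        (\<Sum>g\<in>carrier G. if g = \<one> then [:0, 1:] * [:d a g:] else 0) - (\<Sum>g\<in>carrier G. if g = x then [:y:] * [:d a g:] else 0)"
      unfolding sum_subtractf[symmetric] by (intro sum.cong) (auto simp: algebra_simps)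
    also have "\<dots> = [:- (y * d a x), 1:]"
      using d that x(1) finite_carrier by simp
    finally show ?thesis by (simp add: det_single)
  qed
  have "(\<Prod>a<r. [:- (1 * d a x), 1:]) =
      Determinant.det (block_mat r 1 (\<lambda>a u b v. \<Sum>g\<in>carrier G. ?C 1 g * [:A g $$ (a, b):]))"
    unfolding det by (rule prod.cong[OF HOL.refl], rule single[symmetric], erule lessThan_iff[THEN iffD1])
  also have "\<dots> = Determinant.det (block_mat r 1 (\<lambda>a u b v. \<Sum>g\<in>carrier G. ?C 1 g * [:(\<chi> g \<cdot>\<^sub>m A g) $$ (a, b):]))"
    by (rule det_block_mat_conjugate[OF _ _ \<open>P * Q = 1\<^sub>m r\<close> _ _ twist]) (auto simp: P_def Q_def A_def)
  \<comment> \<open>The twist is trivial on the identity, and at x it is absorbed into the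
    coefficient y.\<close>
  also have "\<dots> = Determinant.det (block_mat r 1 (\<lambda>a u b v. \<Sum>g\<in>carrier G. ?C (\<chi> x) g * [:A g $$ (a, b):]))"
    by (intro arg_cong[of _ _ Determinant.det] block_mat_cong sum.cong HOL.refl)
      (auto simp: char_one A_def)
  also have "\<dots> = (\<Prod>a<r. [:- (\<chi> x * d a x), 1:])"
    unfolding det by (rule prod.cong[OF HOL.refl], rule single, erule lessThan_iff[THEN iffD1])
  finally have inv: "(\<Prod>a<r. [:- d a x, 1:]) = (\<Prod>a<r. [:- (\<chi> x * d a x), 1:])" by simp
  \<comment> \<open>The group order is l p^N, and p-power roots of 1 are trivial in characteristic
    p.\<close>
  have root: "d a x ^ l = 1" if a: "a < r" for a
  proof -
    have "d a (x [^] (i::nat)) = d a x ^ i" for i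
      using d a x(1) by (induction i) auto
    moreover have "x [^] order G = \<one>" using x(1) by (rule pow_order_eq_1)
    ultimately have "d a x ^ order G = 1" using d a by metis
    then have "(d a x ^ l) ^ (CHAR('f) ^ N) = 1" by (simp add: Coset.order_def order power_mult)
    then show ?thesis by (rule power_CHAR_power_eq_one)
  qed
  show ?thesis
  proof (rule that[of d])
    show "(\<Prod>a<r. F (d a x)) = (\<Prod>i<l. F (\<chi> x ^ i)) ^ (CHAR('f) ^ N)" for F :: "'f \<Rightarrow> 'f poly"
      by (rule prod_scaling_invariant[OF x(2) root inv r])
    show "Determinant.det (block_mat r n (\<lambda>a u b v. \<Sum>g\<in>carrier G. C u v g * (if e a \<otimes> g = e b then 1 else 0))) =
      (\<Prod>a<r. Determinant.det (Matrix.mat n n (\<lambda>(u, v). \<Sum>g\<in>carrier G. C u v g * [:d a g:])))" for n C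
      unfolding det[symmetric]
      by (intro arg_cong[of _ _ Determinant.det] block_mat_cong sum.cong HOL.refl) (auto simp: A_def)
  qed (use d in auto)
qed

end

section \<open>Fox calculus of Wirtinger presentations\<close>

text \<open>Every entry of a twisted Fox matrix is such a linear extension, of the corresponding
  matrix entry regarded as a function of the word.\<close>

definition lin_ext :: "('w \<Rightarrow> 'a::comm_ring_1) \<Rightarrow> ('w \<Rightarrow>\<^sub>0 int) \<Rightarrow> 'a" where
  "lin_ext h x = (\<Sum>w\<in>Poly_Mapping.keys x. of_int (Poly_Mapping.lookup x w) * h w)"

lemma lin_ext_superset:
  assumes "finite K" "Poly_Mapping.keys x \<subseteq> K"
  shows "lin_ext h x = (\<Sum>w\<in>K. of_int (Poly_Mapping.lookup x w) * h w)"
  unfolding lin_ext_def using assms by (intro sum.mono_neutral_left) (auto simp: in_keys_iff)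

lemma lin_ext_zero [simp]: "lin_ext h 0 = 0"
  by (simp add: lin_ext_def)

lemma lin_ext_frag_of [simp]: "lin_ext h (frag_of w) = h w"
  by (simp add: lin_ext_def)

lemma lin_ext_add: "lin_ext h (x + y) = lin_ext h x + lin_ext h y"
proof -
  let ?K = "Poly_Mapping.keys x \<union> Poly_Mapping.keys y"
  have "Poly_Mapping.keys (x + y) \<subseteq> ?K" by (rule Poly_Mapping.keys_add)
  then show ?thesis
    by (simp add: lin_ext_superset[of ?K] lookup_add algebra_simps sum.distrib)
qed

lemma lin_ext_uminus [simp]: "lin_ext h (- x) = - lin_ext h x"
  using lin_ext_add[of h x "- x"] by (simp add: eq_neg_iff_add_eq_0 add.commute)

lemma lin_ext_diff: "lin_ext h (x - y) = lin_ext h x - lin_ext h y"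
  using lin_ext_add[of h x "- y"] by simp

lemma lin_ext_frag_cmul: "lin_ext h (frag_cmul k x) = of_int k * lin_ext h x"
proof (cases "k = 0")
  case False
  then show ?thesis
    by (simp add: lin_ext_def keys_cmul_iff sum_distrib_left mult.assoc cong: sum.cong)
      (rule sum.cong, auto simp: in_keys_iff mult.assoc)
qed (simp add: lin_ext_def)

lemma lin_ext_sum: "lin_ext h (\<Sum>i\<in>K. g i) = (\<Sum>i\<in>K. lin_ext h (g i))"
  by (induction K rule: infinite_finite_induct) (auto simp: lin_ext_add)

lemma lin_ext_frag_extend: "lin_ext h (frag_extend b x) = lin_ext (\<lambda>w. lin_ext h (b w)) x"
  unfolding frag_extend_def lin_ext_sum lin_ext_frag_cmul by (simp add: lin_ext_def[of _ x])

lemma words_simps [simp]: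
  "[] \<in> words q" "x # w \<in> words q \<longleftrightarrow> fst x < q \<and> w \<in> words q"
  by (auto simp: words_def split: prod.splits)

lemma keys_fox_derivative:
  assumes "w \<in> words q"
  shows "Poly_Mapping.keys (fox_derivative j w) \<subseteq> words q"
  using assms
proof (induction w)
  case (Cons x w)
  have "Poly_Mapping.keys (fox_letter j x) \<subseteq> words q"
    using Cons.prems by (auto simp: fox_letter_def)
  moreover have "Poly_Mapping.keys (frag_extend (\<lambda>v. frag_of (x # v)) (fox_derivative j w)) \<subseteq> words q"
    by (rule order_trans[OF keys_frag_extend]) (use Cons in auto)
  ultimately show ?case
    using Poly_Mapping.keys_add[of "fox_letter j x" "frag_extend (\<lambda>v. frag_of (x # v)) (fox_derivative j w)"] by auto
qed simp

lemma lin_ext_fox_derivative_Cons: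
  "lin_ext h (fox_derivative j (x # w)) =
    lin_ext h (fox_letter j x) + lin_ext (\<lambda>v. h (x # v)) (fox_derivative j w)"
  by (simp add: lin_ext_add lin_ext_frag_extend)

text \<open>A circle broken at one place is still connected: indices up to c lead forward to c, the
  others run to q - 1, wrap around to 0 and then reach c. Here the knot having a single component
  enters, even though one crossing is left out.\<close>

lemma cyclic_eq:
  fixes v :: "nat \<Rightarrow> 'a"
  assumes c: "c < q" and step: "\<And>i. i < q \<Longrightarrow> i \<noteq> c \<Longrightarrow> v i = v (Suc i mod q)" and i: "i < q"
  shows "v i = v c"
proof -
  have low: "v i = v c" if "i \<le> c" for i
    using that
  proof (induction i rule: inc_induct)
    case (step n)
    then show ?case using assms(2)[of n] c by simp
  qed simp
  show ?thesis
  proof (cases "i \<le> c")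
    case False
    then have "i \<le> q - 1" using i by simp
    then have "v i = v (q - 1)"
      using False
    proof (induction i rule: inc_induct)
      case (step n)
      then show ?case using assms(2)[of n] by simp
    qed simp
    also have "\<dots> = v (Suc (q - 1) mod q)" by (rule step) (use False i c in auto)
    also have "\<dots> = v c" using i low[of 0] by simp
    finally show ?thesis .
  qed (rule low)
qed

text \<open>The column of the full Fox matrix that stands at position v once column j is
  deleted.\<close>

definition skip :: "nat \<Rightarrow> nat \<Rightarrow> nat" where
  "skip j v = (if v < j then v else Suc v)"

lemma bij_betw_skip:
  assumes "j < Suc n"
  shows "bij_betw (skip j) {..<n} ({..<Suc n} - {j})"
  by (rule bij_betwI[of _ _ _ "\<lambda>v. if v < j then v else v - 1"]) (use assms in \<open>auto simp: skip_def split: if_splits\<close>)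

text \<open>Since the columns add up to zero, column j' is minus the sum of the others. Hence either
  minor matrix is the other one times an integral matrix, and exchanging j and j' yields
  divisibility in both directions.\<close>

lemma det_skip_column_dvd:
  fixes E :: "nat \<Rightarrow> nat \<Rightarrow> 'a::comm_ring_1"
  assumes j: "j < Suc n" and j': "j' < Suc n" and sum0: "\<And>u. u < n \<Longrightarrow> (\<Sum>k<Suc n. E u k) = 0"
  obtains k :: int where
    "Determinant.det (Matrix.mat n n (\<lambda>(u, v). E u (skip j v))) =
     Determinant.det (Matrix.mat n n (\<lambda>(u, v). E u (skip j' v))) * of_int k"
proof -
  \<comment> \<open>Column v expresses column \<open>skip j v\<close> through the columns other than
    j': a unit vector, or constantly -1 if that column is j' itself.\<close>
  define U where "U = Matrix.mat n n (\<lambda>(w, v). if skip j v = j' then - 1 else if skip j' w = skip j v then 1 else (0::int))"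
  have "Matrix.mat n n (\<lambda>(u, v). E u (skip j v)) =
      Matrix.mat n n (\<lambda>(u, v). E u (skip j' v)) * map_mat of_int U"
  proof (rule eq_matI)
    fix u v
    assume "u < dim_row (Matrix.mat n n (\<lambda>(u, v). E u (skip j' v)) * map_mat of_int U)"
      "v < dim_col (Matrix.mat n n (\<lambda>(u, v). E u (skip j' v)) * map_mat of_int U)"
    then have uv: "u < n" "v < n" by (auto simp: U_def)
    have "(Matrix.mat n n (\<lambda>(u, v). E u (skip j' v)) * map_mat of_int U) $$ (u, v) =
        (\<Sum>w<n. E u (skip j' w) * (if skip j v = j' then - 1 else if skip j' w = skip j v then 1 else 0))"
      using uv by (simp add: U_def scalar_prod_def atLeast0LessThan if_distrib[of of_int] cong: if_cong)
    also have "\<dots> = (\<Sum>k\<in>{..<Suc n} - {j'}. E u k * (if skip j v = j' then - 1 else if k = skip j v then 1 else 0))"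
      by (rule sum.reindex_bij_betw[OF bij_betw_skip[OF j'], of "\<lambda>k. E u k * (if skip j v = j' then - 1 else if k = skip j v then 1 else 0)"])
    also have "\<dots> = E u (skip j v)"
    proof (cases "skip j v = j'")
      case True
      have "(\<Sum>k<Suc n. E u k) = E u j' + (\<Sum>k\<in>{..<Suc n} - {j'}. E u k)"
        using j' by (intro sum.remove) auto
      then have "(\<Sum>k\<in>{..<Suc n} - {j'}. E u k) = - E u j'"
        using sum0[OF uv(1)] by (metis add_eq_0_iff)
      then show ?thesis using True by (simp add: sum_negf)
    next
      case False
      moreover have "skip j v < Suc n" using uv by (auto simp: skip_def)
      ultimately show ?thesis by (simp add: if_distrib[of "\<lambda>x. _ * x"] cong: if_cong)
    qed
    finally show "Matrix.mat n n (\<lambda>(u, v). E u (skip j v)) $$ (u, v) =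
      (Matrix.mat n n (\<lambda>(u, v). E u (skip j' v)) * map_mat of_int U) $$ (u, v)"
      using uv by simp
  qed (auto simp: U_def)
  then have "Determinant.det (Matrix.mat n n (\<lambda>(u, v). E u (skip j v))) =
     Determinant.det (Matrix.mat n n (\<lambda>(u, v). E u (skip j' v))) * Determinant.det (map_mat of_int U)"
    by (simp add: det_mult[of _ n] U_def)
  then show ?thesis using that[of "Determinant.det U"] by (simp add: of_int_hom.hom_det)
qed

lemma lin_ext_cong:
  "(\<And>w. w \<in> Poly_Mapping.keys x \<Longrightarrow> h w = h' w) \<Longrightarrow> lin_ext h x = lin_ext h' x"
  unfolding lin_ext_def by (rule sum.cong) auto

lemma lin_ext_mult_left: "y * lin_ext h x = lin_ext (\<lambda>w. y * h w) x"
  by (simp add: lin_ext_def sum_distrib_left mult.left_commute)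

lemma (in comm_ring_hom) hom_lin_ext: "hom (lin_ext h x) = lin_ext (\<lambda>w. hom (h w)) x"
  by (simp add: lin_ext_def hom_distribs)

section \<open>Clearing negative powers of t\<close>

lemma tvar_nonzero: "(tvar :: 'a::idom poly fract) \<noteq> 0"
  by simp

lemma to_fract_monom:
  "to_fract (Polynomial.monom a k) = (tvar :: 'a::idom poly fract) ^ k * to_fract [:a:]"
proof (induction k)
  case (Suc k)
  have "Polynomial.monom a (Suc k) = [:0, 1:] * Polynomial.monom a k" by (simp add: monom_Suc)
  then show ?case using Suc by (simp only: to_fract_mult power_Suc mult.assoc)
qed (simp add: monom_0)

text \<open>
  The factor \<open>t\<^sup>N\<close> clears negative exponents; \<open>N\<close> has to be so large that \<open>nat\<close> truncates nothing
  on the support of the argument.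
\<close>

definition shifted :: "nat \<Rightarrow> ('w \<Rightarrow> int) \<Rightarrow> ('w \<Rightarrow> 'a::comm_ring_1) \<Rightarrow> ('w \<Rightarrow>\<^sub>0 int) \<Rightarrow> 'a poly" where
  "shifted N \<psi> h = lin_ext (\<lambda>w. Polynomial.monom (h w) (nat (\<psi> w + int N)))"

lemma tvar_shift:
  fixes h :: "'w \<Rightarrow> 'a::idom"
  assumes "\<And>w. w \<in> Poly_Mapping.keys x \<Longrightarrow> \<psi> w + int N \<ge> 0"
  shows "tvar ^ N * lin_ext (\<lambda>w. tvar powi \<psi> w * to_fract [:h w:]) x = to_fract (shifted N \<psi> h x)"
proof -
  interpret comm_ring_hom "to_fract :: 'a poly \<Rightarrow> 'a poly fract" by unfold_locales auto
  have "(tvar :: 'a poly fract) ^ N * (tvar powi \<psi> w * to_fract [:h w:]) =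
      to_fract (Polynomial.monom (h w) (nat (\<psi> w + int N)))" if "w \<in> Poly_Mapping.keys x" for w
  proof -
    have "(tvar :: 'a poly fract) ^ N * tvar powi \<psi> w = tvar powi (\<psi> w + int N)"
      by (simp add: power_int_add)
    also have "\<dots> = tvar ^ nat (\<psi> w + int N)"
      using assms[OF that] by (simp add: power_int_def)
    finally show ?thesis by (simp add: to_fract_monom flip: mult.assoc)
  qed
  then show ?thesis
    by (simp add: shifted_def hom_lin_ext lin_ext_mult_left cong: lin_ext_cong)
qed

lemma reduce_shifted:
  "map_poly (of_int :: int \<Rightarrow> 'f::field) (shifted N \<psi> h x) = shifted N \<psi> (\<lambda>w. of_int (h w)) x"
proof -
  have "comm_ring_hom (map_poly of_int :: int poly \<Rightarrow> 'f poly)"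
    by unfold_locales (auto simp: reduce_poly_mult intro!: poly_eqI simp: coeff_map_poly)
  then show ?thesis by (simp add: shifted_def map_poly_monom comm_ring_hom.hom_lin_ext)
qed

lemma det_tvar_shift:
  fixes E :: "nat \<Rightarrow> nat \<Rightarrow> 'a::idom poly fract"
  assumes "\<And>i j. i < m \<Longrightarrow> j < m \<Longrightarrow> tvar ^ N * E i j = to_fract (p i j)"
  shows "tvar ^ (N * m) * Determinant.det (Matrix.mat m m (\<lambda>(i, j). E i j)) =
    to_fract (Determinant.det (Matrix.mat m m (\<lambda>(i, j). p i j)))"
proof -
  interpret comm_ring_hom "to_fract :: 'a poly \<Rightarrow> 'a poly fract" by unfold_locales auto
  have "tvar ^ N \<cdot>\<^sub>m Matrix.mat m m (\<lambda>(i, j). E i j) = map_mat to_fract (Matrix.mat m m (\<lambda>(i, j). p i j))"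
    by (rule eq_matI) (auto simp: assms)
  from arg_cong[OF this, of Determinant.det] show ?thesis
    by (simp add: power_mult)
qed

text \<open>The passage from topology to algebra: generators with \<phi>-value 1 that satisfy all
  crossing relators but the one at c.\<close>

locale wirtinger_group = group G for G :: "('g, 'b) monoid_scheme" (structure) +
  fixes q :: nat and s :: "nat \<Rightarrow> 'g" and \<phi> :: "'g \<Rightarrow> int"
    and ov :: "nat \<Rightarrow> nat" and sg :: "nat \<Rightarrow> bool" and c :: nat
  assumes gen_closed: "\<And>i. i < q \<Longrightarrow> s i \<in> carrier G"
    and phi_hom: "\<phi> \<in> hom G integer_group"
    and phi_gen: "\<And>i. i < q \<Longrightarrow> \<phi> (s i) = 1"
    and ov_less: "\<And>i. i < q \<Longrightarrow> ov i < q" and c_less: "c < q"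
    and generated: "word_eval G s ` words q = carrier G"
    and relation: "\<And>i. i < q \<Longrightarrow> i \<noteq> c \<Longrightarrow> word_eval G s (crossing_relator q ov sg i) = \<one>"
begin

abbreviation ev :: "word \<Rightarrow> 'g" where "ev \<equiv> word_eval G s"

lemma ev_simps [simp]:
  "ev [] = \<one>" "ev ((i, b) # w) = (if b then s i else inv (s i)) \<otimes> ev w"
  by (simp_all add: word_eval_def)

lemma ev_closed: "w \<in> words q \<Longrightarrow> ev w \<in> carrier G"
  by (induction w) (auto simp: gen_closed)

text \<open>A character with the same value y on all generators factors through \<phi>. This turns a
  twist by it into the substitution t \<mapsto> y t.\<close>

lemma multiplicative_ev:
  fixes d :: "'g \<Rightarrow> 'a::field"
  assumes mult: "\<And>g h. g \<in> carrier G \<Longrightarrow> h \<in> carrier G \<Longrightarrow> d (g \<otimes> h) = d g * d h" and one: "d \<one> = 1"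
    and gen: "\<And>i. i < q \<Longrightarrow> d (s i) = y" and w: "w \<in> words q"
  shows "d (ev w) = y powi \<phi> (ev w)"
proof -
  have phi_mult: "\<phi> (g \<otimes> h) = \<phi> g + \<phi> h" if "g \<in> carrier G" "h \<in> carrier G" for g h
    using phi_hom that by (simp add: hom_def)
  have phi_one: "\<phi> \<one> = 0" using phi_mult[of \<one> \<one>] by simp
  have phi_inv: "\<phi> (inv g) = - \<phi> g" if "g \<in> carrier G" for g
    using phi_mult[of g "inv g"] that phi_one by simp
  have d_inv: "d (inv g) = inverse (d g)" "d g \<noteq> 0" if "g \<in> carrier G" for g
  proof -
    have "d g * d (inv g) = 1" using mult[of g "inv g"] that one by simp
    then show "d (inv g) = inverse (d g)" "d g \<noteq> 0" by (auto simp: inverse_unique)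
  qed
  from w show ?thesis
  proof (induction w)
    case (Cons x w)
    obtain i b where x: "x = (i, b)" by (cases x)
    have i: "i < q" and w: "w \<in> words q" using Cons.prems by (auto simp: x)
    have "y \<noteq> 0" using d_inv(2)[OF gen_closed[OF i]] gen[OF i] by simp
    then show ?case
      using Cons.IH[OF w] i gen_closed[OF i] ev_closed[OF w]
      by (cases b) (simp_all add: x mult phi_mult phi_inv d_inv gen phi_gen power_int_add power_int_diff field_simps)
  qed (simp add: one phi_one)
qed

lemma multiplicative_gen_eq:
  fixes d :: "'g \<Rightarrow> 'a::field"
  assumes mult: "\<And>g h. g \<in> carrier G \<Longrightarrow> h \<in> carrier G \<Longrightarrow> d (g \<otimes> h) = d g * d h" and one: "d \<one> = 1"
    and i: "i < q"
  shows "d (s i) = d (s c)"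
proof (rule cyclic_eq[OF c_less _ i])
  fix i assume i: "i < q" "i \<noteq> c"
  have j: "Suc i mod q < q" using i by simp
  note closed = gen_closed[OF i(1)] gen_closed[OF j] gen_closed[OF ov_less[OF i(1)]]
  have d_inv: "d g * d (inv g) = 1" if "g \<in> carrier G" for g
    using mult[of g "inv g"] that one by simp
  \<comment> \<open>For either sign of the crossing the contribution of the over-arc cancels in a
    commutative target.\<close>
  have "d (ev (crossing_relator q ov sg i)) = (d (s (ov i)) * d (inv (s (ov i)))) * (d (s i) * d (inv (s (Suc i mod q))))"
    using closed by (cases "sg i") (simp_all add: crossing_relator_def mult one)
  then have "d (s i) * d (inv (s (Suc i mod q))) = 1"
    using relation[OF i] one closed by (simp add: d_inv)
  then have "d (s (Suc i mod q)) * (d (s i) * d (inv (s (Suc i mod q)))) = d (s (Suc i mod q))" by simp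
  then show "d (s i) = d (s (Suc i mod q))"
    using d_inv[OF closed(2)] by (simp add: mult.left_commute)
qed

lemma phi_ev_Cons:
  assumes "i < q" "w \<in> words q"
  shows "\<phi> (ev ((i, b) # w)) = (if b then 1 else - 1) + \<phi> (ev w)"
proof -
  have phi_mult: "\<phi> (g \<otimes> h) = \<phi> g + \<phi> h" if "g \<in> carrier G" "h \<in> carrier G" for g h
    using phi_hom that by (simp add: hom_def)
  have "\<phi> (inv g) = - \<phi> g" if "g \<in> carrier G" for g
    using phi_mult[of g "inv g"] phi_mult[of \<one> \<one>] that by simp
  then show ?thesis using assms by (simp add: phi_mult gen_closed ev_closed phi_gen)
qed

text \<open>Fox's identity, by which w - 1 is the sum of the products of the derivatives by s_j - 1.
  All generators go to t, so the factor t - 1 is common. For a relator the right-hand side is 0,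
  hence the columns of the Alexander matrix add up to zero.\<close>

lemma fox_fundamental_formula:
  fixes t :: "'a::field"
  assumes "t \<noteq> 0" "w \<in> words q"
  shows "(\<Sum>j<q. lin_ext (\<lambda>v. t powi \<phi> (ev v)) (fox_derivative j w)) * (t - 1) = t powi \<phi> (ev w) - 1"
  using assms(2)
proof (induction w)
  case Nil
  have "\<phi> \<one> = \<phi> \<one> + \<phi> \<one>" using phi_hom hom_mult[of \<phi> G integer_group \<one> \<one>] by simp
  then show ?case by simp
next
  case (Cons x w)
  obtain i b where x: "x = (i, b)" by (cases x)
  have i: "i < q" and w: "w \<in> words q" using Cons.prems by (auto simp: x)
  let ?h = "\<lambda>v. t powi \<phi> (ev v)"
  let ?e = "if b then t else inverse t"
  have h_Cons: "?h (x # v) = ?e * ?h v" if "v \<in> words q" for v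
    using assms(1) phi_ev_Cons[OF i that, of b] by (auto simp: x power_int_add power_int_minus simp del: ev_simps)
  have "lin_ext (\<lambda>v. ?h (x # v)) (fox_derivative j w) = ?e * lin_ext ?h (fox_derivative j w)" for j
    unfolding lin_ext_mult_left using keys_fox_derivative[OF w, of j]
    by (intro lin_ext_cong h_Cons) auto
  moreover have "lin_ext ?h (fox_letter j x) = (if j = i then (if b then 1 else - inverse t) else 0)" for j
  proof -
    have "\<phi> \<one> = \<phi> \<one> + \<phi> \<one>" using phi_hom hom_mult[of \<phi> G integer_group \<one> \<one>] by simp
    then have "?h [] = 1" by simp
    moreover have "?h [x] = ?e" using h_Cons[of "[]"] \<open>?h [] = 1\<close> by simp
    ultimately show ?thesis by (auto simp: fox_letter_def x simp del: ev_simps)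
  qed
  ultimately have "(\<Sum>j<q. lin_ext ?h (fox_derivative j (x # w))) =
      (if b then 1 else - inverse t) + ?e * (\<Sum>j<q. lin_ext ?h (fox_derivative j w))"
    using i by (simp add: lin_ext_fox_derivative_Cons sum.distrib sum_distrib_left del: fox_derivative.simps)
  then have "(\<Sum>j<q. lin_ext ?h (fox_derivative j (x # w))) * (t - 1) =
      (if b then 1 else - inverse t) * (t - 1) + ?e * (?h w - 1)"
    by (simp only: distrib_right mult.assoc Cons.IH[OF w])
  also have "\<dots> = ?e * ?h w - 1" using assms(1) by (auto simp: algebra_simps)
  finally show ?case using h_Cons[OF w] by simp
qed

lemma crossing_relator_words: "i < q \<Longrightarrow> crossing_relator q ov sg i \<in> words q"
  by (auto simp: crossing_relator_def ov_less)

text \<open>At t = 1 the two occurrences of the over-arc cancel, so the row of a crossing is the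
  difference of its two under-arcs.\<close>

lemma augmentation_fox_derivative:
  assumes "i < q"
  shows "lin_ext (\<lambda>_. 1 :: 'a::comm_ring_1) (fox_derivative j (crossing_relator q ov sg i)) =
    (if j = i then 1 else 0) - (if j = Suc i mod q then 1 else 0)"
  by (cases "sg i")
    (auto simp: crossing_relator_def lin_ext_fox_derivative_Cons fox_letter_def simp del: fox_derivative.simps(2))

end

section \<open>Units of the integral Laurent polynomials\<close>

lemma dvd_monom_int:
  fixes P :: "int poly"
  assumes "P * Q = Polynomial.monom 1 m"
  obtains \<epsilon> i where "\<epsilon> = 1 \<or> \<epsilon> = - 1" "P = Polynomial.monom \<epsilon> i"
proof -
  have "\<exists>\<epsilon> i. (\<epsilon> = 1 \<or> \<epsilon> = - 1) \<and> P = Polynomial.monom \<epsilon> i"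
    using assms
  proof (induction m arbitrary: P Q)
    case 0
    then have "P dvd 1" by (metis dvd_triv_left one_poly_eq_simps(1) monom_0 pCons_one)
    then obtain \<epsilon> where "P = [:\<epsilon>:]" "\<epsilon> dvd 1" using is_unit_poly_iff by blast
    then show ?case by (intro exI[of _ \<epsilon>] exI[of _ 0]) (auto simp: monom_0)
  next
    case (Suc m)
    \<comment> \<open>Unless m is 0, one of the constant terms vanishes, so t can be divided out of
      one factor.\<close>
    have "Polynomial.coeff P 0 * Polynomial.coeff Q 0 = 0"
      using arg_cong[OF Suc.prems, of "\<lambda>p. Polynomial.coeff p 0"] by (simp add: coeff_mult)
    then consider P' where "P = pCons 0 P'" | Q' where "Q = pCons 0 Q'"
      by (cases P; cases Q) auto
    then show ?case
    proof cases
      case 1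
      then have "P' * Q = Polynomial.monom 1 m" using Suc.prems by (simp add: monom_Suc)
      from Suc.IH[OF this] show ?thesis using 1 by (metis monom_Suc)
    next
      case 2
      then have "P * Q' = Polynomial.monom 1 m" using Suc.prems by (simp add: monom_Suc)
      from Suc.IH[OF this] show ?thesis .
    qed
  qed
  then show ?thesis using that by blast
qed

text \<open>Splits an exponent of unknown sign into negative and positive part, which turns Laurent
  identities into polynomial ones.\<close>

lemma tvar_powi_split:
  "(tvar :: 'a::idom poly fract) ^ nat (- k) * tvar powi k = tvar ^ nat k"
  by (cases "k \<ge> 0") (simp_all add: power_int_def power_inverse)

text \<open>After the exponents are cleared, the polynomial part divides a monomial and is therefore
  a signed monomial.\<close>

lemma laurent_poly_unit:
  fixes c c' :: "int poly fract"
  assumes "c \<in> laurent_polys" "c' \<in> laurent_polys" "c * c' = 1"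
  obtains \<epsilon> :: int and z where "\<epsilon> = 1 \<or> \<epsilon> = - 1" "c = to_fract [:\<epsilon>:] * tvar powi z"
proof -
  obtain P a P' b where c: "c = to_fract P * tvar powi a" and c': "c' = to_fract P' * tvar powi b"
    using assms by (auto simp: laurent_polys_def)
  let ?k = "a + b"
  have "to_fract P * to_fract P' * tvar powi ?k = 1"
    using assms(3) by (simp add: c c' power_int_add mult_ac)
  then have "tvar ^ nat (- ?k) * (to_fract P * to_fract P' * tvar powi ?k) = tvar ^ nat (- ?k)" by simp
  then have "to_fract P * to_fract P' * (tvar ^ nat (- ?k) * tvar powi ?k) = tvar ^ nat (- ?k)"
    by (simp only: mult_ac)
  then have "to_fract (P * (P' * Polynomial.monom 1 (nat ?k))) = to_fract (Polynomial.monom 1 (nat (- ?k)))"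
    unfolding tvar_powi_split by (simp add: to_fract_monom to_fract_mult mult.assoc flip: one_pCons)
  then have "P * (P' * Polynomial.monom 1 (nat ?k)) = Polynomial.monom 1 (nat (- ?k))" by (simp only: to_fract_eq_iff)
  from dvd_monom_int[OF this] obtain \<epsilon> i where "\<epsilon> = 1 \<or> \<epsilon> = - 1" "P = Polynomial.monom \<epsilon> i" by metis
  then show ?thesis
    using that[of \<epsilon> "a + int i"] by (simp add: c to_fract_monom power_int_add mult_ac)
qed

section \<open>Minors of the Alexander matrix\<close>

lemma twisted_matrix_index:
  assumes "a < r" "b < r"
  shows "twisted_matrix G s \<phi> r \<rho> x $$ (a, b) =
    lin_ext (\<lambda>w. tvar powi \<phi> (word_eval G s w) * to_fract [:\<rho> (word_eval G s w) $$ (a, b):]) x"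
  using assms by (simp add: twisted_matrix_def lin_ext_def)

text \<open>Deleting r consecutive columns keeps the remainder of a column index modulo r and lets
  its quotient jump over j. The matrix is square because there is one relator fewer than
  generators.\<close>

lemma remove_block_column_fox_matrix:
  assumes q: "q = Suc (length rs)" and j: "j < q" and r: "r > 0"
  shows "remove_block_column r j (fox_matrix G q s rs \<phi> r \<rho>) =
    Matrix.mat (r * length rs) (r * length rs) (\<lambda>(a, b).
      twisted_matrix G s \<phi> r \<rho> (fox_derivative (skip j (b div r)) (rs ! (a div r))) $$ (a mod r, b mod r))"
proof (rule eq_matI)
  fix a b
  assume "a < dim_row (Matrix.mat (r * length rs) (r * length rs) (\<lambda>(a, b).
      twisted_matrix G s \<phi> r \<rho> (fox_derivative (skip j (b div r)) (rs ! (a div r))) $$ (a mod r, b mod r)))"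
    "b < dim_col (Matrix.mat (r * length rs) (r * length rs) (\<lambda>(a, b).
      twisted_matrix G s \<phi> r \<rho> (fox_derivative (skip j (b div r)) (rs ! (a div r))) $$ (a mod r, b mod r)))"
  then have ab: "a < r * length rs" "b < r * length rs" by auto
  have "b < r * j \<longleftrightarrow> b div r < j" using r by (simp add: div_less_iff_less_mult mult.commute)
  then have "(if b < r * j then b else b + r) div r = skip j (b div r)" using r by (simp add: skip_def)
  then show "remove_block_column r j (fox_matrix G q s rs \<phi> r \<rho>) $$ (a, b) =
    Matrix.mat (r * length rs) (r * length rs) (\<lambda>(a, b).
      twisted_matrix G s \<phi> r \<rho> (fox_derivative (skip j (b div r)) (rs ! (a div r))) $$ (a mod r, b mod r)) $$ (a, b)"
    using ab q by (auto simp: remove_block_column_def fox_matrix_def)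
qed (auto simp: remove_block_column_def fox_matrix_def q)

context wirtinger_group
begin

definition relators :: "word list" where
  "relators = map (crossing_relator q ov sg) (filter (\<lambda>i. i \<noteq> c) [0..<q])"

lemma length_relators: "q = Suc (length relators)"
proof -
  have "length relators = card ({0..<q} - {c})"
    by (simp add: relators_def length_filter_conv_card set_diff_eq)
      (intro arg_cong[of _ _ card], auto simp: nth_append)
  then show ?thesis using c_less by simp
qed

lemma nth_relators:
  assumes "u < length relators"
  obtains i where "i < q" "i \<noteq> c" "relators ! u = crossing_relator q ov sg i"
proof -
  have "relators ! u \<in> set relators" using assms by simp
  then show ?thesis using that by (auto simp: relators_def)
qed

lemma relators_words: "u < length relators \<Longrightarrow> relators ! u \<in> words q"
  by (metis nth_relators crossing_relator_words)

lemma ev_relators: "u < length relators \<Longrightarrow> ev (relators ! u) = \<one>"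
  by (metis nth_relators relation)

lemma phi_one: "\<phi> \<one> = 0"
  using phi_hom hom_mult[of \<phi> G integer_group \<one> \<one>] by simp

abbreviation alex_minor :: "nat \<Rightarrow> int poly fract" where
  "alex_minor j \<equiv> Determinant.det (remove_block_column 1 j (fox_matrix G q s relators \<phi> 1 (\<lambda>_. 1\<^sub>m 1)))"

lemma alex_minor_eq:
  assumes "j < q"
  shows "alex_minor j = Determinant.det (Matrix.mat (length relators) (length relators)
    (\<lambda>(u, v). lin_ext (\<lambda>w. tvar powi \<phi> (ev w)) (fox_derivative (skip j v) (relators ! u))))"
proof -
  have "0 < (1::nat)" by simp
  note rem = remove_block_column_fox_matrix[OF length_relators assms this]
  show ?thesis
    unfolding rem
    by (intro arg_cong[of _ _ Determinant.det] eq_matI) (simp_all add: twisted_matrix_index flip: one_pCons)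
qed

definition shifted_minor :: "nat \<Rightarrow> nat \<Rightarrow> int poly" where
  "shifted_minor N j = Determinant.det (Matrix.mat (length relators) (length relators)
    (\<lambda>(u, v). shifted N (\<lambda>w. \<phi> (ev w)) (\<lambda>_. 1) (fox_derivative (skip j v) (relators ! u))))"

lemma alex_minor_shift:
  assumes j: "j < q"
    and N: "\<And>u v w. u < length relators \<Longrightarrow> v < q \<Longrightarrow> w \<in> Poly_Mapping.keys (fox_derivative v (relators ! u)) \<Longrightarrow> \<phi> (ev w) + int N \<ge> 0"
  shows "tvar ^ (N * length relators) * alex_minor j = to_fract (shifted_minor N j)"
  unfolding alex_minor_eq[OF j] shifted_minor_def
proof (rule det_tvar_shift)
  fix u v assume uv: "u < length relators" "v < length relators"
  then have "skip j v < q" using length_relators by (simp add: skip_def)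
  then show "tvar ^ N * lin_ext (\<lambda>w. tvar powi \<phi> (ev w)) (fox_derivative (skip j v) (relators ! u)) =
      to_fract (shifted N (\<lambda>w. \<phi> (ev w)) (\<lambda>_. 1) (fox_derivative (skip j v) (relators ! u)))"
    by (subst tvar_shift[symmetric]) (use N[OF uv(1)] in \<open>auto simp flip: one_pCons\<close>)
qed

lemma alex_minor_dvd:
  assumes "i < q" "j < q"
  shows "laurent_dvd (alex_minor i) (alex_minor j)"
proof -
  let ?n = "length relators"
  let ?E = "\<lambda>u k. lin_ext (\<lambda>w. (tvar :: int poly fract) powi \<phi> (ev w)) (fox_derivative k (relators ! u))"
  \<comment> \<open>Needed to cancel the factor t - 1 in Fox's identity.\<close>
  have "(tvar :: int poly fract) \<noteq> 1"
    by (metis to_fract_1 to_fract_eq_iff one_pCons pCons_eq_iff zero_neq_one)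
  then have "(\<Sum>k<Suc ?n. ?E u k) = 0" if "u < ?n" for u
    using fox_fundamental_formula[OF tvar_nonzero[where 'a = int] relators_words[OF that]] ev_relators[OF that] phi_one
    by (simp flip: length_relators)
  from det_skip_column_dvd[of j ?n i ?E, OF _ _ this] obtain k :: int
    where "Determinant.det (Matrix.mat ?n ?n (\<lambda>(u, v). ?E u (skip j v))) =
      Determinant.det (Matrix.mat ?n ?n (\<lambda>(u, v). ?E u (skip i v))) * of_int k"
    using assms length_relators by metis
  then have "alex_minor j = alex_minor i * of_int k" unfolding alex_minor_eq[OF assms(1)] alex_minor_eq[OF assms(2)] .
  moreover have "of_int k = to_fract [:k:] * tvar powi 0"
  proof -
    interpret comm_ring_hom "to_fract :: int poly \<Rightarrow> int poly fract" by unfold_locales auto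
    show ?thesis using hom_of_int[of k] by (simp add: of_int_poly)
  qed
  ultimately show ?thesis unfolding laurent_dvd_def laurent_polys_def by blast
qed

text \<open>It suffices that the value at t = 1 is nonzero; there the shift by N disappears. The
  field is arbitrary: finite fields give nonvanishing modulo p, the rationals give it over the
  integers.\<close>

lemma shifted_minor_mod_nonzero:
  assumes j: "j < q"
  shows "(reduce_poly (shifted_minor N j) :: 'f::field poly) \<noteq> 0"
proof
  assume zero: "(reduce_poly (shifted_minor N j) :: 'f poly) = 0"
  let ?n = "length relators"
  have hom: "comm_ring_hom (\<lambda>p. of_int (poly p 1) :: 'f)"
    by unfold_locales auto
  define A where "A = Matrix.mat ?n ?n (\<lambda>(u, v). lin_ext (\<lambda>_. 1 :: 'f) (fox_derivative (skip j v) (relators ! u)))"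
  have "of_int (poly (shifted_minor N j) 1) = Determinant.det A"
    unfolding shifted_minor_def comm_ring_hom.hom_det[OF hom, symmetric] A_def
    by (intro arg_cong[of _ _ Determinant.det] eq_matI)
      (auto simp: shifted_def comm_ring_hom.hom_lin_ext[OF hom] poly_monom)
  moreover have "of_int (poly (shifted_minor N j) 1) = poly (reduce_poly (shifted_minor N j)) (1 :: 'f)" by simp
  ultimately have "Determinant.det A = 0" using zero by simp
  moreover have "A \<in> carrier_mat ?n ?n" by (simp add: A_def)
  ultimately obtain x where x: "x \<in> carrier_vec ?n" "x \<noteq> 0\<^sub>v ?n" "A *\<^sub>v x = 0\<^sub>v ?n"
    using det_0_iff_vec_prod_zero_field by blast
  \<comment> \<open>The kernel vector, extended by 0 at the deleted column j. Being constant along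
    the arcs, it is then zero.\<close>
  define V where "V k = (if k = j then 0 else x $ (if k < j then k else k - 1))" for k
  have V_skip: "V (skip j v) = x $ v" for v by (auto simp: V_def skip_def)
  have "V i = V (Suc i mod q)" if i: "i < q" "i \<noteq> c" for i
  proof -
    have "crossing_relator q ov sg i \<in> set relators" using i by (simp add: relators_def)
    then obtain u where u: "u < ?n" "relators ! u = crossing_relator q ov sg i" by (metis in_set_conv_nth)
    let ?a = "\<lambda>k. (if k = i then 1 else 0) - (if k = Suc i mod q then 1 else 0) :: 'f"
    have "0 = (A *\<^sub>v x) $ u" using x u by simp
    also have "\<dots> = (\<Sum>v<?n. ?a (skip j v) * V (skip j v))"
      using u x(1) i by (simp add: A_def scalar_prod_def atLeast0LessThan augmentation_fox_derivative V_skip)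
    also have "\<dots> = (\<Sum>k\<in>{..<Suc ?n} - {j}. ?a k * V k)"
      by (rule sum.reindex_bij_betw[OF bij_betw_skip, of j ?n "\<lambda>k. ?a k * V k"]) (use j length_relators in simp)
    also have "\<dots> = (\<Sum>k<q. ?a k * V k)"
      unfolding length_relators[symmetric] by (rule sum.mono_neutral_left) (auto simp: V_def)
    also have "\<dots> = (\<Sum>k<q. if k = i then V k else 0) - (\<Sum>k<q. if k = Suc i mod q then V k else 0)"
      unfolding sum_subtractf[symmetric] by (intro sum.cong) (auto simp: algebra_simps)
    also have "\<dots> = V i - V (Suc i mod q)" using i by simp
    finally show ?thesis by simp
  qed
  then have const: "V i = V c" if "i < q" for i using cyclic_eq[OF c_less _ that, of V] by blast
  have "x $ v = 0" if "v < ?n" for v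
  proof -
    have "skip j v < q" using that length_relators by (simp add: skip_def)
    then have "V (skip j v) = V j" using const[of "skip j v"] const[OF j] by simp
    then show ?thesis unfolding V_skip by (simp add: V_def)
  qed
  then show False using x by (auto simp: vec_eq_iff)
qed

text \<open>Each minor divides all the others, so it is itself a greatest common divisor. Hence it
  and D divide each other and differ by a unit of the Laurent ring.\<close>

lemma alexander_polynomial_shifted_minor:
  assumes alex: "alexander_polynomial G q s relators \<phi> (to_fract D)" and j: "j < q"
    and N: "\<And>u v w. u < length relators \<Longrightarrow> v < q \<Longrightarrow> w \<in> Poly_Mapping.keys (fox_derivative v (relators ! u)) \<Longrightarrow> \<phi> (ev w) + int N \<ge> 0"
  obtains \<epsilon> :: int and a b where "\<epsilon> = 1 \<or> \<epsilon> = - 1"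
    "D * Polynomial.monom 1 a = shifted_minor N j * Polynomial.monom \<epsilon> b"
proof -
  let ?n = "length relators"
  have shift: "tvar ^ (N * ?n) * alex_minor j = to_fract (shifted_minor N j)"
    by (rule alex_minor_shift[OF j N])
  have "shifted_minor N j \<noteq> 0" using shifted_minor_mod_nonzero[OF j, of N, where 'f = rat] by auto
  then have nz: "alex_minor j \<noteq> 0" using shift by (metis mult_zero_right to_fract_eq_0_iff)
  have "alex_minor j = to_fract (shifted_minor N j) * tvar powi (- int (N * ?n))"
    unfolding shift[symmetric] by (simp add: power_int_minus del: of_nat_mult)
  then have "alex_minor j \<in> laurent_polys" unfolding laurent_polys_def by blast
  then have "laurent_dvd (alex_minor j) (to_fract D)" "laurent_dvd (to_fract D) (alex_minor j)"
    using alex alex_minor_dvd[OF j] j unfolding alexander_polynomial_def Let_def by blast+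
  then obtain c1 c2 where c: "c1 \<in> laurent_polys" "c2 \<in> laurent_polys"
    and D: "to_fract D = alex_minor j * c1" "alex_minor j = to_fract D * c2" unfolding laurent_dvd_def by blast
  have "alex_minor j * (c1 * c2) = alex_minor j * 1"
    using D by (metis mult.assoc mult.right_neutral)
  then have "c1 * c2 = 1" using nz by (metis mult_left_cancel)
  from laurent_poly_unit[OF c this] obtain \<epsilon> :: int and z where \<epsilon>: "\<epsilon> = 1 \<or> \<epsilon> = - 1"
    and c1: "c1 = to_fract [:\<epsilon>:] * tvar powi z" by metis
  have "to_fract D * tvar ^ (N * ?n + nat (- z)) = tvar ^ (N * ?n) * alex_minor j * (to_fract [:\<epsilon>:] * (tvar ^ nat (- z) * tvar powi z))"
    unfolding D(1) c1 power_add by (simp only: mult_ac)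
  then have "to_fract (D * Polynomial.monom 1 (N * ?n + nat (- z))) = to_fract (shifted_minor N j * Polynomial.monom \<epsilon> (nat z))"
    unfolding tvar_powi_split shift by (simp add: to_fract_monom to_fract_mult mult_ac flip: one_pCons)
  then have "D * Polynomial.monom 1 (N * ?n + nat (- z)) = shifted_minor N j * Polynomial.monom \<epsilon> (nat z)"
    by (simp only: to_fract_eq_iff)
  with \<epsilon> show ?thesis by (rule that)
qed

end

section \<open>Twisted determinants modulo p\<close>

text \<open>Collects the words by their images in a finite group, so that a Fox derivative becomes a
  sum over group elements with polynomial coefficients.\<close>

lemma sum_lin_ext_fibres:
  assumes S: "finite S" and F: "\<And>w. w \<in> Poly_Mapping.keys x \<Longrightarrow> F w \<in> S"
  shows "(\<Sum>g\<in>S. lin_ext (\<lambda>w. if F w = g then h w else 0) x * B g) = lin_ext (\<lambda>w. h w * B (F w)) x"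
proof -
  have "(\<Sum>g\<in>S. lin_ext (\<lambda>w. if F w = g then h w else 0) x * B g) =
      (\<Sum>w\<in>Poly_Mapping.keys x. \<Sum>g\<in>S. if F w = g then of_int (Poly_Mapping.lookup x w) * (h w * B g) else 0)"
    unfolding lin_ext_def sum_distrib_right
    by (subst sum.swap) (intro sum.cong HOL.refl, auto simp: mult.assoc)
  also have "\<dots> = lin_ext (\<lambda>w. h w * B (F w)) x"
    unfolding lin_ext_def using S F by (intro sum.cong) auto
  finally show ?thesis .
qed

context character_with_p_kernel
begin

text \<open>Each diagonal character contributes the untwisted determinant with t replaced by z t,
  where z is its value at y. Stated for any square matrix over the group ring of words, so that it
  covers the Fox minor as well as the 1 by 1 denominator.\<close>

lemma reduce_det_regular:
  fixes e :: "nat \<Rightarrow> 'g" and x :: "nat \<Rightarrow> nat \<Rightarrow> ('w \<Rightarrow>\<^sub>0 int)" and \<psi> :: "'w \<Rightarrow> int" and F :: "'w \<Rightarrow> 'g"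
  assumes e: "bij_betw e {..<r} (carrier G)"
    and y: "y \<in> carrier G" "primitive_root_of_unity l (\<chi> y)"
    and order: "card (carrier G) = l * CHAR('f) ^ N"
    and keys: "\<And>u v. u < n \<Longrightarrow> v < n \<Longrightarrow> Poly_Mapping.keys (x u v) \<subseteq> W"
    and F: "\<And>w. w \<in> W \<Longrightarrow> F w \<in> carrier G"
    and F_char: "\<And>(d :: 'g \<Rightarrow> 'f) w. (\<And>g h. g \<in> carrier G \<Longrightarrow> h \<in> carrier G \<Longrightarrow> d (g \<otimes> h) = d g * d h) \<Longrightarrow>
      d \<one> = 1 \<Longrightarrow> w \<in> W \<Longrightarrow> d (F w) = d y powi \<psi> w"
    and M: "\<And>u v w. u < n \<Longrightarrow> v < n \<Longrightarrow> w \<in> Poly_Mapping.keys (x u v) \<Longrightarrow> \<psi> w + int M \<ge> 0"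
  shows "map_poly of_int (Determinant.det (Matrix.mat (r * n) (r * n) (\<lambda>(i, j).
      shifted M \<psi> (\<lambda>w. regular_representation G r e (F w) $$ (i mod r, j mod r)) (x (i div r) (j div r))))) =
    (\<Prod>z\<in>{z :: 'f. z ^ l = 1}. [:inverse z ^ (M * n):] *
      pcompose (map_poly of_int (Determinant.det (Matrix.mat n n (\<lambda>(u, v). shifted M \<psi> (\<lambda>_. 1) (x u v))))) [:0, z:])
    ^ (CHAR('f) ^ N)"
proof -
  have of_int_hom: "comm_ring_hom (map_poly of_int :: int poly \<Rightarrow> 'f poly)"
    by unfold_locales (auto simp: reduce_poly_mult intro!: poly_eqI simp: coeff_map_poly)
  obtain d where d_one: "\<And>a. a < r \<Longrightarrow> d a \<one> = 1"
    and d_mult: "\<And>a g h. a < r \<Longrightarrow> g \<in> carrier G \<Longrightarrow> h \<in> carrier G \<Longrightarrow> d a (g \<otimes> h) = d a g * d a h"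
    and det: "\<And>n C. Determinant.det (block_mat r n (\<lambda>a u b v. \<Sum>g\<in>carrier G. C u v g * (if e a \<otimes> g = e b then 1 else 0))) =
      (\<Prod>a<r. Determinant.det (Matrix.mat n n (\<lambda>(u, v). \<Sum>g\<in>carrier G. C u v g * [:d a g:])))"
    and prod: "\<And>H :: 'f \<Rightarrow> 'f poly. (\<Prod>a<r. H (d a y)) = (\<Prod>i<l. H (\<chi> y ^ i)) ^ (CHAR('f) ^ N)"
    by (rule det_block_mat_regular[OF e y order]) (rule that)
  let ?mon = "\<lambda>w. Polynomial.monom 1 (nat (\<psi> w + int M)) :: 'f poly"
  define C where "C u v g = lin_ext (\<lambda>w. if F w = g then ?mon w else 0) (x u v)" for u v g
  have C: "(\<Sum>g\<in>carrier G. C u v g * B g) = lin_ext (\<lambda>w. ?mon w * B (F w)) (x u v)"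
    if "u < n" "v < n" for u v B
    unfolding C_def using keys[OF that] F by (intro sum_lin_ext_fibres[OF finite_carrier]) auto
  let ?m = "\<lambda>a u b v. shifted M \<psi> (\<lambda>w. if e a \<otimes> F w = e b then 1 else 0 :: 'f) (x u v)"
  have "map_poly of_int (Determinant.det (Matrix.mat (r * n) (r * n) (\<lambda>(i, j).
      shifted M \<psi> (\<lambda>w. regular_representation G r e (F w) $$ (i mod r, j mod r)) (x (i div r) (j div r))))) =
    Determinant.det (Matrix.mat (r * n) (r * n) (\<lambda>(i, j). ?m (i mod r) (i div r) (j mod r) (j div r)))"
  proof (cases "r = 0")
    case False
    then show ?thesis
      unfolding comm_ring_hom.hom_det[OF of_int_hom, symmetric]
      by (intro arg_cong[of _ _ Determinant.det] eq_matI)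
        (auto simp: reduce_shifted regular_representation_def if_distrib[of of_int] cong: if_cong)
  qed (use det_dim_zero in simp)
  also have "\<dots> = Determinant.det (block_mat r n ?m)"
    by (rule det_block_mat_swap)
  also have "block_mat r n ?m =
      block_mat r n (\<lambda>a u b v. \<Sum>g\<in>carrier G. C u v g * (if e a \<otimes> g = e b then 1 else 0))"
    by (rule block_mat_cong) (auto simp: C shifted_def intro!: lin_ext_cong)
  also have "Determinant.det \<dots> = (\<Prod>a<r. Determinant.det (Matrix.mat n n (\<lambda>(u, v). \<Sum>g\<in>carrier G. C u v g * [:d a g:])))"
    by (rule det)
  also have "\<dots> = (\<Prod>a<r. [:inverse (d a y) ^ (M * n):] *
      pcompose (map_poly of_int (Determinant.det (Matrix.mat n n (\<lambda>(u, v). shifted M \<psi> (\<lambda>_. 1) (x u v))))) [:0, d a y:])"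
  proof (rule prod.cong[OF HOL.refl])
    fix a assume "a \<in> {..<r}"
    then have a: "a < r" by simp
    let ?c = "d a y"
    have "?c * d a (inv y) = 1" using d_mult[OF a y(1), of "inv y"] d_one[OF a] y(1) by simp
    then have c: "?c \<noteq> 0" by auto
    have comp_hom: "comm_ring_hom (\<lambda>p. pcompose (map_poly of_int p) [:0, ?c:])"
      by unfold_locales (auto simp: reduce_poly_mult pcompose_mult pcompose_add of_int_hom.map_poly_hom_add)
    \<comment> \<open>With exponent \<psi> the character gives c^\<psi> t^(\<psi> + M) = c^(-M) (c
      t)^(\<psi> + M): the shift costs a factor c^(-M) in each of the n rows.\<close>
    have mon: "?mon w * [:d a (F w):] = [:inverse ?c ^ M:] * pcompose (?mon w) [:0, ?c:]"
      if "w \<in> Poly_Mapping.keys (x u v)" "u < n" "v < n" for u v w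
    proof -
      have "d a (F w) = ?c powi \<psi> w"
        by (rule F_char[OF d_mult[OF a] d_one[OF a]]) (use keys[OF that(2,3)] that(1) in auto)
      also have "\<dots> = ?c powi (\<psi> w + int M - int M)" by simp
      also have "\<dots> = ?c ^ nat (\<psi> w + int M) * inverse ?c ^ M"
        using c M[OF that(2,3,1)] by (subst power_int_diff) (auto simp: power_int_def field_simps)
      finally have "d a (F w) = ?c ^ nat (\<psi> w + int M) * inverse ?c ^ M" .
      moreover have "pcompose (Polynomial.monom 1 k) [:0, ?c:] = Polynomial.monom (?c ^ k) k" for k
        by (induction k) (simp_all add: monom_0 monom_Suc pcompose_pCons smult_monom)
      ultimately show ?thesis by (simp add: smult_monom mult.commute)
    qed
    have "Matrix.mat n n (\<lambda>(u, v). \<Sum>g\<in>carrier G. C u v g * [:d a g:]) =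
      [:inverse ?c ^ M:] \<cdot>\<^sub>m map_mat (\<lambda>p. pcompose (map_poly of_int p) [:0, ?c:])
        (Matrix.mat n n (\<lambda>(u, v). shifted M \<psi> (\<lambda>_. 1) (x u v)))"
    proof (rule eq_matI)
      fix u v
      assume "u < dim_row ([:inverse ?c ^ M:] \<cdot>\<^sub>m map_mat (\<lambda>p. pcompose (map_poly of_int p) [:0, ?c:])
          (Matrix.mat n n (\<lambda>(u, v). shifted M \<psi> (\<lambda>_. 1) (x u v))))"
        "v < dim_col ([:inverse ?c ^ M:] \<cdot>\<^sub>m map_mat (\<lambda>p. pcompose (map_poly of_int p) [:0, ?c:])
          (Matrix.mat n n (\<lambda>(u, v). shifted M \<psi> (\<lambda>_. 1) (x u v))))"
      then have uv: "u < n" "v < n" by auto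
      have "(\<Sum>g\<in>carrier G. C u v g * [:d a g:]) =
          lin_ext (\<lambda>w. [:inverse ?c ^ M:] * pcompose (?mon w) [:0, ?c:]) (x u v)"
        unfolding C[OF uv] by (rule lin_ext_cong) (rule mon[OF _ uv])
      also have "\<dots> = [:inverse ?c ^ M:] * pcompose (map_poly of_int (shifted M \<psi> (\<lambda>_. 1) (x u v))) [:0, ?c:]"
        unfolding shifted_def comm_ring_hom.hom_lin_ext[OF comp_hom]
        by (simp add: map_poly_monom lin_ext_mult_left del: mult_pCons_left)
      finally show "Matrix.mat n n (\<lambda>(u, v). \<Sum>g\<in>carrier G. C u v g * [:d a g:]) $$ (u, v) =
        ([:inverse ?c ^ M:] \<cdot>\<^sub>m map_mat (\<lambda>p. pcompose (map_poly of_int p) [:0, ?c:])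
          (Matrix.mat n n (\<lambda>(u, v). shifted M \<psi> (\<lambda>_. 1) (x u v)))) $$ (u, v)"
        using uv by simp
    qed auto
    then show "Determinant.det (Matrix.mat n n (\<lambda>(u, v). \<Sum>g\<in>carrier G. C u v g * [:d a g:])) =
      [:inverse ?c ^ (M * n):] *
      pcompose (map_poly of_int (Determinant.det (Matrix.mat n n (\<lambda>(u, v). shifted M \<psi> (\<lambda>_. 1) (x u v))))) [:0, ?c:]"
      using comm_ring_hom.hom_det[OF comp_hom] by (simp add: poly_const_pow power_mult)
  qed
  also have "\<dots> = (\<Prod>z\<in>{z. z ^ l = 1}. [:inverse z ^ (M * n):] *
      pcompose (map_poly of_int (Determinant.det (Matrix.mat n n (\<lambda>(u, v). shifted M \<psi> (\<lambda>_. 1) (x u v))))) [:0, z:])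
    ^ (CHAR('f) ^ N)"
    unfolding prod[of "\<lambda>z. [:inverse z ^ (M * n):] * pcompose _ [:0, z:]"]
    by (subst prod_roots_of_unity[OF y(2)]) (rule HOL.refl)
  finally show ?thesis .
qed

end

section \<open>Rationality over the prime field and bookkeeping of units\<close>

lemma prod_roots_of_unity_square:
  fixes z :: "'a::field"
  assumes "primitive_root_of_unity l z"
  shows "(\<Prod>y\<in>{y :: 'a. y ^ l = 1}. y) ^ 2 = 1"
proof -
  let ?U = "{y :: 'a. y ^ l = 1}"
  have l: "l > 0" using assms by (simp add: primitive_root_of_unity_def)
  then have nz: "y \<noteq> 0" if "y \<in> ?U" for y using that by (auto simp: power_0_left)
  \<comment> \<open>Inversion permutes the roots, so their product is its own inverse.\<close>
  have "(\<Prod>y\<in>?U. y) = (\<Prod>y\<in>?U. inverse y)"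
    by (rule prod.reindex_bij_witness[of _ inverse inverse]) (auto simp: power_inverse)
  then have "(\<Prod>y\<in>?U. y) ^ 2 = (\<Prod>y\<in>?U. y * inverse y)"
    by (simp add: power2_eq_square prod.distrib)
  also have "\<dots> = 1" using nz by (intro prod.neutral) auto
  finally show ?thesis .
qed

text \<open>The fixed points of Frobenius are the roots of t^p - t, at most p in number, and the
  prime field already supplies p of them.\<close>

lemma prime_field_eq_frobenius_fixed:
  "(prime_field :: 'f::{field,finite} set) = {y. y ^ CHAR('f) = y}"
proof -
  let ?p = "CHAR('f)"
  have p: "Factorial_Ring.prime ?p" by (rule prime_CHAR_finite)
  have sub: "of_nat ` {..<?p} \<subseteq> (prime_field :: 'f set)"
    unfolding prime_field_def by (rule image_subsetI) (metis of_int_of_nat_eq rangeI)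
  have nat: "(of_nat k :: 'f) ^ ?p = of_nat k" for k
    using prime_gt_0_nat[OF p] by (induction k) (auto simp: freshmans_dream[OF p] power_0_left)
  have "(of_int k :: 'f) = of_nat (nat (k mod int ?p))" for k
  proof -
    have "(of_int k :: 'f) = of_int (k mod int ?p)"
      by (rule of_int_eq_iff_cong_CHAR[THEN iffD2]) (simp add: cong_def)
    then show ?thesis using prime_gt_0_nat[OF p] by (simp add: of_nat_nat)
  qed
  then have "prime_field \<subseteq> {y :: 'f. y ^ ?p = y}" unfolding prime_field_def using nat by auto
  moreover have "card {y :: 'f. y ^ ?p = y} \<le> card (prime_field :: 'f set)"
  proof -
    let ?q = "Polynomial.monom 1 ?p - Polynomial.monom 1 1 :: 'f poly"
    have "Polynomial.coeff ?q ?p = 1" using prime_gt_1_nat[OF p] by simp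
    then have "?q \<noteq> 0" by (metis coeff_0 zero_neq_one)
    have "Polynomial.degree ?q \<le> ?p"
      using prime_gt_1_nat[OF p] by (intro degree_diff_le) (auto simp: degree_monom_eq)
    then have "card {y :: 'f. y ^ ?p = y} \<le> ?p"
      using poly_roots_degree[OF \<open>?q \<noteq> 0\<close>] by (simp add: poly_monom)
    also have "?p = card (of_nat ` {..<?p} :: 'f set)"
      by (subst card_image) (auto simp: inj_on_def of_nat_eq_iff_cong_CHAR cong_def)
    also have "\<dots> \<le> card (prime_field :: 'f set)" by (intro card_mono sub) simp
    finally show ?thesis .
  qed
  ultimately show ?thesis by (intro card_seteq) auto
qed

lemma coeff_pcompose_scale: "Polynomial.coeff (pcompose B [:0, z:]) n = Polynomial.coeff B n * z ^ n"
  for B :: "'a::comm_ring_1 poly"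
  by (induction B arbitrary: n) (auto simp: pcompose_pCons coeff_pCons split: nat.split)

text \<open>Frobenius fixes the coefficients of B and permutes the roots of unity, hence only
  permutes the factors. The product is therefore fixed coefficientwise.\<close>

lemma coeffs_prod_roots_of_unity:
  fixes B :: "'f::{field,finite} poly"
  assumes l: "\<not> CHAR('f) dvd l" and B: "range (Polynomial.coeff B) \<subseteq> prime_field"
  shows "range (Polynomial.coeff (\<Prod>z\<in>{z. z ^ l = 1}. pcompose B [:0, z:])) \<subseteq> prime_field"
proof -
  let ?p = "CHAR('f)" and ?U = "{z :: 'f. z ^ l = 1}"
  have p: "Factorial_Ring.prime ?p" by (rule prime_CHAR_finite)
  interpret frob: comm_ring_hom "\<lambda>y :: 'f. y ^ ?p"
    by unfold_locales (use prime_gt_0_nat[OF p] in \<open>auto simp: freshmans_dream[OF p] power_mult_distrib power_0_left\<close>)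
  let ?\<sigma> = "map_poly (\<lambda>y :: 'f. y ^ ?p)"
  interpret \<sigma>: map_poly_comm_ring_hom "\<lambda>y :: 'f. y ^ ?p" ..
  have fixed: "?\<sigma> A = A \<longleftrightarrow> range (Polynomial.coeff A) \<subseteq> prime_field" for A
    by (auto simp: poly_eq_iff prime_field_eq_frobenius_fixed coeff_map_poly)
  have "?\<sigma> (\<Prod>z\<in>?U. pcompose B [:0, z:]) = (\<Prod>z\<in>?U. pcompose B [:0, z ^ ?p:])"
  proof -
    have "?\<sigma> (pcompose B [:0, z:]) = pcompose (?\<sigma> B) [:0, z ^ ?p:]" for z
    proof (rule poly_eqI)
      fix n
      have "(z ^ n) ^ ?p = (z ^ ?p) ^ n" by (simp only: power_mult[symmetric] mult.commute)
      then show "Polynomial.coeff (?\<sigma> (pcompose B [:0, z:])) n = Polynomial.coeff (pcompose (?\<sigma> B) [:0, z ^ ?p:]) n"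
        by (simp only: coeff_map_poly[of "\<lambda>y. y ^ ?p", OF frob.hom_zero] coeff_pcompose_scale power_mult_distrib)
    qed
    then show ?thesis using B by (simp add: \<sigma>.hom_prod fixed[symmetric])
  qed
  also have "\<dots> = (\<Prod>z\<in>?U. pcompose B [:0, z:])"
  proof (rule prod.reindex_bij_betw)
    have "inj_on (\<lambda>z. z ^ ?p) ?U"
    proof (rule inj_onI)
      fix x y :: 'f assume "x ^ ?p = y ^ ?p"
      \<comment> \<open>Frobenius is additive, hence injective on a field.\<close>
      then have "(x - y) ^ ?p = 0" using freshmans_dream[OF p HOL.refl, of "x - y" y] by simp
      then show "x = y" by simp
    qed
    moreover have "(\<lambda>z. z ^ ?p) ` ?U \<subseteq> ?U" 
    proof (rule image_subsetI)
      fix z assume "z \<in> ?U"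
      moreover have "(z ^ ?p) ^ l = (z ^ l) ^ ?p" by (simp only: power_mult[symmetric] mult.commute)
      ultimately show "z ^ ?p \<in> ?U" by simp
    qed
    ultimately show "bij_betw (\<lambda>z. z ^ ?p) ?U ?U"
      by (simp add: bij_betw_def endo_inj_surj)
  qed
  finally show ?thesis using fixed by blast
qed

lemma finite_roots_of_unity:
  fixes z :: "'a::field"
  assumes "primitive_root_of_unity l z"
  shows "finite {y :: 'a. y ^ l = 1}"
  using bij_betw_finite[OF bij_betw_roots_of_unity[OF assms]] by simp

lemma pcompose_scale_eq_0_iff:
  fixes B :: "'a::field poly"
  assumes "z \<noteq> 0"
  shows "pcompose B [:0, z:] = 0 \<longleftrightarrow> B = 0"
  using assms by (auto simp: poly_eq_iff coeff_pcompose_scale)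

lemma pcompose_monom_scale:
  "pcompose (Polynomial.monom b n) [:0, z :: 'a::comm_ring_1:] = Polynomial.monom (b * z ^ n) n"
  by (rule poly_eqI) (simp add: coeff_pcompose_scale)

lemma prod_monom:
  "finite S \<Longrightarrow> (\<Prod>z\<in>S. Polynomial.monom (h z) n) = Polynomial.monom (\<Prod>z\<in>S. h z) (n * card S)"
  for h :: "'b \<Rightarrow> 'a::comm_ring_1"
  by (induction S rule: finite_induct) (simp_all add: mult_monom add.commute monom_0 one_pCons)

lemma to_fract_power: "to_fract (x ^ n) = to_fract x ^ n"
  by (induction n) (simp_all add: to_fract_mult)

lemma prod_Fract:
  "finite S \<Longrightarrow> (\<Prod>z\<in>S. Fraction_Field.Fract (a z) (b z)) = Fraction_Field.Fract (\<Prod>z\<in>S. a z) (\<Prod>z\<in>S. b z)"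
  for a b :: "'b \<Rightarrow> 'a::idom"
  by (induction S rule: finite_induct) (simp_all add: One_fract_def)

lemma square_eq_one_in_prime_field: "u ^ 2 = 1 \<Longrightarrow> u \<in> (prime_field :: 'f::field set)"
proof -
  assume "u ^ 2 = 1"
  then have "u = of_int 1 \<or> u = of_int (- 1)" by (simp add: power2_eq_1_iff)
  then show "u \<in> prime_field" unfolding prime_field_def by blast
qed

text \<open>\<open>A\<close> stands for the shifted minor, \<open>M\<close> and \<open>K\<close> for
  the exponents spent on clearing denominators. All scalars left over collect in
  \<open>w ^ P\<close>, and w squares to 1.\<close>

lemma prod_roots_of_unity_up_to_unit:
  fixes \<zeta> :: "'f::{field,finite}" and A D :: "int poly"
  assumes \<zeta>: "primitive_root_of_unity l \<zeta>"
    and \<epsilon>: "\<epsilon> = 1 \<or> \<epsilon> = - 1" and AD: "D * Polynomial.monom 1 a = A * Polynomial.monom \<epsilon> b"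
  shows "eq_up_to_unit
      (Fraction_Field.Fract ((\<Prod>z\<in>{z :: 'f. z ^ l = 1}. [:inverse z ^ M:] * pcompose (reduce_poly A) [:0, z:]) ^ P)
        (Polynomial.monom 1 K * (\<Prod>z\<in>{z. z ^ l = 1}. [:- 1, z:]) ^ P))
      ((\<Prod>i<l. Fraction_Field.Fract (pcompose (reduce_poly D) [:0, \<zeta> ^ i:]) [:- 1, \<zeta> ^ i:]) ^ P)"
proof -
  let ?U = "{z :: 'f. z ^ l = 1}"
  let ?\<pi> = "\<Prod>z\<in>?U. z"
  let ?n = "card ?U"
  let ?FD = "\<Prod>z\<in>?U. pcompose (reduce_poly D) [:0, z:]"
  let ?FA = "\<Prod>z\<in>?U. pcompose (reduce_poly A) [:0, z:]"
  let ?E = "\<Prod>z\<in>?U. [:- 1, z:]"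
  let ?t = "tvar :: 'f poly fract"
  have fin: "finite ?U" by (rule finite_roots_of_unity[OF \<zeta>])
  have \<pi>: "?\<pi> ^ 2 = 1" by (rule prod_roots_of_unity_square[OF \<zeta>])
  have \<epsilon>2: "(of_int \<epsilon> :: 'f) ^ 2 = 1" using \<epsilon> by auto
  have red: "reduce_poly D * Polynomial.monom 1 a = (reduce_poly A * Polynomial.monom (of_int \<epsilon>) b :: 'f poly)"
    using arg_cong[OF AD, of "reduce_poly :: int poly \<Rightarrow> 'f poly"] by (simp add: reduce_poly_mult map_poly_monom)
  \<comment> \<open>The substitution turns t^a into z^a t^a; over all roots these constants multiply
    to powers of \<open>?\<pi>\<close>.\<close>
  have "pcompose (reduce_poly D) [:0, z:] * Polynomial.monom (z ^ a) a =
      pcompose (reduce_poly A) [:0, z:] * Polynomial.monom (of_int \<epsilon> * z ^ b) b" for z :: 'f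
    using arg_cong[OF red, of "\<lambda>p. pcompose p [:0, z:]"] by (simp add: pcompose_mult pcompose_monom_scale)
  then have "(\<Prod>z\<in>?U. pcompose (reduce_poly D) [:0, z:] * Polynomial.monom (z ^ a) a) =
      (\<Prod>z\<in>?U. pcompose (reduce_poly A) [:0, z:] * Polynomial.monom (of_int \<epsilon> * z ^ b) b)" by simp
  then have "?FD * Polynomial.monom (?\<pi> ^ a) (a * ?n) = ?FA * Polynomial.monom (of_int \<epsilon> ^ ?n * ?\<pi> ^ b) (b * ?n)"
    by (simp add: prod.distrib prod_monom[OF fin] prod_power_distrib)
  then have frac: "to_fract ?FD * (?t ^ (a * ?n) * to_fract [:?\<pi> ^ a:]) =
      to_fract ?FA * (?t ^ (b * ?n) * to_fract [:of_int \<epsilon> ^ ?n * ?\<pi> ^ b:])"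
    unfolding to_fract_monom[symmetric] by (simp only: flip: to_fract_mult)
  \<comment> \<open>A scalar that is its own inverse, so that it can be moved across the equation as
    it is.\<close>
  define v where "v = of_int \<epsilon> ^ ?n * ?\<pi> ^ b"
  have v: "v * v = 1"
    using \<pi> \<epsilon>2 by (simp add: v_def power2_eq_square mult_ac flip: power_mult_distrib)
  have "to_fract ?FA * (?t ^ (b * ?n) * to_fract [:v:]) * (to_fract [:v:] * ?t powi (- int (b * ?n))) = to_fract ?FA"
  proof -
    have "to_fract [:v:] * to_fract [:v:] = (1 :: 'f poly fract)"
      by (simp add: v flip: to_fract_mult one_pCons)
    moreover have "?t ^ (b * ?n) * ?t powi (- int (b * ?n)) = 1"
      by (simp add: power_int_minus del: of_nat_mult)
    moreover have "x * (t * c) * (c * t') = x * ((c * c) * (t * t'))" for x t c t' :: "'f poly fract"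
      by (simp only: mult_ac)
    ultimately show ?thesis by (simp only: mult_1_right)
  qed
  then have FA: "to_fract ?FA = to_fract ?FD * (?t ^ (a * ?n) * to_fract [:?\<pi> ^ a:]) * (to_fract [:v:] * ?t powi (- int (b * ?n)))"
    unfolding frac v_def[symmetric] by simp
  define w where "w = inverse ?\<pi> ^ M * (?\<pi> ^ a * v)"
  have w: "w * w = 1"
  proof -
    have "?\<pi> * ?\<pi> = 1" using \<pi> by (simp add: power2_eq_square)
    then have "inverse ?\<pi> * inverse ?\<pi> = 1" by (metis inverse_1 inverse_mult_distrib)
    then have "(inverse ?\<pi> ^ M * inverse ?\<pi> ^ M) * ((?\<pi> ^ a * ?\<pi> ^ a) * (v * v)) = 1"
      using \<open>?\<pi> * ?\<pi> = 1\<close> v by (simp flip: power_mult_distrib)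
    then show ?thesis unfolding w_def by (simp only: mult_ac)
  qed
  have "(\<Prod>z\<in>?U. [:inverse z ^ M:] * pcompose (reduce_poly A) [:0, z:]) = [:inverse ?\<pi> ^ M:] * ?FA"
  proof -
    have "(\<Prod>z\<in>?U. [:inverse z ^ M:]) = [:inverse ?\<pi> ^ M:]"
      using prod_monom[OF fin, of "\<lambda>z. inverse z ^ M" 0] prod_inversef[of "\<lambda>z. z" ?U]
      by (simp add: monom_0 o_def flip: prod_power_distrib)
    then show ?thesis by (simp only: prod.distrib)
  qed
  moreover have "to_fract ([:inverse ?\<pi> ^ M:] * ?FA) = to_fract [:w:] * ?t powi (int (a * ?n) - int (b * ?n)) * to_fract ?FD"
  proof -
    have "to_fract [:w:] = to_fract [:inverse ?\<pi> ^ M:] * (to_fract [:?\<pi> ^ a:] * to_fract [:v:])"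
      by (simp add: w_def flip: to_fract_mult)
    moreover have "?t powi (int (a * ?n) - int (b * ?n)) = ?t ^ (a * ?n) * ?t powi (- int (b * ?n))"
      unfolding diff_conv_add_uminus by (subst power_int_add) (simp_all del: of_nat_mult)
    ultimately show ?thesis unfolding to_fract_mult FA by (simp only: mult_ac)
  qed
  ultimately have num: "to_fract ((\<Prod>z\<in>?U. [:inverse z ^ M:] * pcompose (reduce_poly A) [:0, z:]) ^ P) =
      (to_fract [:w:] * ?t powi (int (a * ?n) - int (b * ?n)) * to_fract ?FD) ^ P"
    by (simp only: to_fract_power)
  have R: "(\<Prod>i<l. Fraction_Field.Fract (pcompose (reduce_poly D) [:0, \<zeta> ^ i:]) [:- 1, \<zeta> ^ i:]) = to_fract ?FD / to_fract ?E"
    using prod_roots_of_unity[OF \<zeta>, of "\<lambda>z. Fraction_Field.Fract (pcompose (reduce_poly D) [:0, z:]) [:- 1, z:]"]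
    by (subst Fract_conv_to_fract[symmetric]) (simp only: prod_Fract[OF fin])
  have "Fraction_Field.Fract ((\<Prod>z\<in>?U. [:inverse z ^ M:] * pcompose (reduce_poly A) [:0, z:]) ^ P) (Polynomial.monom 1 K * ?E ^ P) =
      to_fract [:w ^ P:] * (?t powi ((int (a * ?n) - int (b * ?n)) * int P) * ?t powi (- int K)) * (to_fract ?FD / to_fract ?E) ^ P"
  proof -
    have "(x * y * c) ^ P / (t * d ^ P) = x ^ P * (y ^ P * inverse t) * (c / d) ^ P" for x y c t d :: "'f poly fract"
      by (simp add: power_mult_distrib power_divide divide_inverse power_inverse mult_ac)
    moreover have "to_fract (Polynomial.monom 1 K * ?E ^ P) = ?t ^ K * to_fract ?E ^ P"
      by (simp add: to_fract_mult to_fract_power to_fract_monom flip: one_pCons)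
    moreover have "to_fract [:w ^ P:] = to_fract [:w:] ^ P" by (simp add: poly_const_pow flip: to_fract_power)
    moreover have "?t powi ((int (a * ?n) - int (b * ?n)) * int P) = (?t powi (int (a * ?n) - int (b * ?n))) ^ P"
      by (simp only: power_int_mult power_int_of_nat)
    moreover have "?t powi (- int K) = inverse (?t ^ K)" by (simp only: power_int_minus power_int_of_nat)
    ultimately show ?thesis unfolding Fract_conv_to_fract num by (simp only:)
  qed
  also have "?t powi ((int (a * ?n) - int (b * ?n)) * int P) * ?t powi (- int K) =
      ?t powi ((int (a * ?n) - int (b * ?n)) * int P - int K)"
    unfolding diff_conv_add_uminus[of _ "int K"] by (subst power_int_add) simp_all
  finally have "Fraction_Field.Fract ((\<Prod>z\<in>?U. [:inverse z ^ M:] * pcompose (reduce_poly A) [:0, z:]) ^ P) (Polynomial.monom 1 K * ?E ^ P) =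
      to_fract [:w ^ P:] * ?t powi ((int (a * ?n) - int (b * ?n)) * int P - int K) *
      (\<Prod>i<l. Fraction_Field.Fract (pcompose (reduce_poly D) [:0, \<zeta> ^ i:]) [:- 1, \<zeta> ^ i:]) ^ P"
    unfolding R .
  moreover have "(w ^ P) ^ 2 = 1" using w by (simp add: power2_eq_square flip: power_mult_distrib)
  then have "w ^ P \<in> prime_field" by (rule square_eq_one_in_prime_field)
  moreover have "w ^ P \<noteq> 0" using w by auto
  ultimately show ?thesis unfolding eq_up_to_unit_def by blast
qed

text \<open>Since z t - 1 arises from t - 1 by the same substitution, numerator and denominator are
  both products over all roots of unity of a polynomial with coefficients in the prime
  field.\<close>

lemma prod_roots_of_unity_rational:
  fixes \<zeta> :: "'f::{field,finite}" and D :: "int poly"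
  assumes \<zeta>: "primitive_root_of_unity l \<zeta>" and l: "\<not> CHAR('f) dvd l"
  shows "(\<Prod>i<l. Fraction_Field.Fract (pcompose (reduce_poly D) [:0, \<zeta> ^ i:]) [:- 1, \<zeta> ^ i:])
    \<in> prime_field_rational_functions"
proof -
  let ?U = "{z :: 'f. z ^ l = 1}"
  have fin: "finite ?U" by (rule finite_roots_of_unity[OF \<zeta>])
  have eq: "(\<Prod>i<l. Fraction_Field.Fract (pcompose (reduce_poly D) [:0, \<zeta> ^ i:]) [:- 1, \<zeta> ^ i:]) =
      Fraction_Field.Fract (\<Prod>z\<in>?U. pcompose (reduce_poly D) [:0, z:]) (\<Prod>z\<in>?U. pcompose [:- 1, 1:] [:0, z:])"
    using prod_roots_of_unity[OF \<zeta>, of "\<lambda>z. Fraction_Field.Fract (pcompose (reduce_poly D) [:0, z:]) [:- 1, z:]"]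
    by (simp add: prod_Fract[OF fin] pcompose_pCons)
  have "range (Polynomial.coeff (reduce_poly D :: 'f poly)) \<subseteq> prime_field"
    by (auto simp: prime_field_def coeff_map_poly)
  moreover have "range (Polynomial.coeff ([:- 1, 1:] :: 'f poly)) \<subseteq> prime_field"
  proof -
    have "([:- 1, 1:] :: 'f poly) = reduce_poly [:- 1, 1:]" by (simp add: map_poly_pCons)
    then show ?thesis unfolding prime_field_def by (metis coeff_map_poly image_subsetI of_int_0 rangeI)
  qed
  moreover have "(\<Prod>z\<in>?U. pcompose [:- 1, 1:] [:0, z:]) \<noteq> 0"
    using fin by (simp add: prod_zero_iff pcompose_pCons)
  ultimately show ?thesis
    unfolding eq prime_field_rational_functions_def using coeffs_prod_roots_of_unity[OF l] by blast
qed

section \<open>The character of the cyclic quotient and the final computation\<close>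

lemma CHAR_eq_prime:
  assumes "Factorial_Ring.prime (p::nat)" "CARD('f::{field,finite}) = p ^ d"
  shows "CHAR('f) = p"
proof -
  have "Factorial_Ring.prime CHAR('f)" by (rule prime_CHAR_finite)
  moreover have "CHAR('f) dvd p ^ d" using CHAR_dvd_CARD[where 'a = 'f] assms(2) by simp
  ultimately show ?thesis using assms(1) by (blast intro: primes_dvd_imp_eq dest: prime_dvd_power)
qed

text \<open>A group element is sent to the power of \<zeta> whose exponent is its class modulo m,
  which is multiplicative because \<zeta>^m = 1.\<close>

lemma (in group) character_of_cyclic_quotient:
  fixes \<zeta> :: "'f::field"
  assumes N: "N \<lhd> G" and iso: "G Mod N \<cong> integer_mod_group m" and m: "m > 0"
    and \<zeta>: "\<zeta> ^ m = 1"
  obtains \<chi> where "\<And>g h. g \<in> carrier G \<Longrightarrow> h \<in> carrier G \<Longrightarrow> \<chi> (g \<otimes> h) = \<chi> g * \<chi> h"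
    "\<And>g. g \<in> carrier G \<Longrightarrow> \<exists>i. \<chi> g = \<zeta> ^ i" "\<zeta> \<in> \<chi> ` carrier G"
proof -
  interpret normal N G by fact
  obtain h where h: "h \<in> iso (G Mod N) (integer_mod_group m)" using iso by (auto simp: is_iso_def)
  have pow_mod: "\<zeta> ^ (i mod m) = \<zeta> ^ i" for i
  proof -
    have "\<zeta> ^ i = \<zeta> ^ (m * (i div m) + i mod m)" by simp
    also have "\<dots> = \<zeta> ^ (i mod m)" by (simp only: power_add power_mult \<zeta> power_one mult_1)
    finally show ?thesis by simp
  qed
  define \<kappa> where "\<kappa> g = h (N #> g)" for g
  have coset: "N #> g \<in> carrier (G Mod N)" if "g \<in> carrier G" for g
    using that by (auto simp: FactGroup_def RCOSETS_def)
  have \<kappa>_range: "\<kappa> g \<in> {0..<int m}" if "g \<in> carrier G" for g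
    using h coset[OF that] m by (auto simp: \<kappa>_def iso_def hom_def carrier_integer_mod_group Pi_def)
  have \<kappa>_mult: "\<kappa> (g \<otimes> g') = (\<kappa> g + \<kappa> g') mod int m" if "g \<in> carrier G" "g' \<in> carrier G" for g g'
  proof -
    have "N #> (g \<otimes> g') = (N #> g) \<otimes>\<^bsub>G Mod N\<^esub> (N #> g')"
      using that by (simp add: FactGroup_def rcos_sum)
    then show ?thesis
      using h coset that m by (auto simp: \<kappa>_def iso_def hom_def mult_integer_mod_group)
  qed
  show ?thesis
  proof (rule that[of "\<lambda>g. \<zeta> ^ nat (\<kappa> g)"])
    fix g g' assume g: "g \<in> carrier G" "g' \<in> carrier G"
    have "nat (\<kappa> (g \<otimes> g')) = (nat (\<kappa> g) + nat (\<kappa> g')) mod m"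
      using \<kappa>_range[OF g(1)] \<kappa>_range[OF g(2)] by (simp add: \<kappa>_mult[OF g] nat_mod_distrib nat_add_distrib)
    then show "\<zeta> ^ nat (\<kappa> (g \<otimes> g')) = \<zeta> ^ nat (\<kappa> g) * \<zeta> ^ nat (\<kappa> g')"
      by (simp add: pow_mod power_add)
  next
    \<comment> \<open>The reduction covers m = 1, where the residue 1 is represented by 0.\<close>
    have "int (1 mod m) \<in> carrier (integer_mod_group m)" using m by (simp add: carrier_integer_mod_group)
    moreover have "h ` carrier (G Mod N) = carrier (integer_mod_group m)"
      using h by (simp add: iso_def bij_betw_def)
    ultimately have "int (1 mod m) \<in> h ` carrier (G Mod N)" by simp
    then obtain C where "C \<in> carrier (G Mod N)" "int (1 mod m) = h C" by (rule imageE)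
    then obtain g where "g \<in> carrier G" "\<kappa> g = int (1 mod m)"
      unfolding \<kappa>_def FactGroup_def RCOSETS_def by auto
    then show "\<zeta> \<in> (\<lambda>g. \<zeta> ^ nat (\<kappa> g)) ` carrier G"
      using pow_mod[of 1] by (intro image_eqI[of _ _ g]) simp_all
  qed blast
qed

lemma fraction_up_to_tvar_power:
  fixes a :: "'a::idom poly fract"
  assumes "tvar ^ K * a = to_fract x" "b = to_fract y"
  shows "a / b = Fraction_Field.Fract x (Polynomial.monom 1 K * y)"
proof -
  have "a = to_fract x / tvar ^ K" using assms(1) by (simp add: field_simps)
  then show ?thesis
    by (simp add: Fract_conv_to_fract to_fract_mult to_fract_monom assms(2) flip: one_pCons)
qed

text \<open>Numerator and denominator are reduced separately by \<open>reduce_det_regular\<close>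
  and are nonzero modulo p. Hence the quotient may be reduced, and it is itself nonzero.\<close>

lemma (in wirtinger_group) twisted_alexander_regular:
  fixes H :: "('h, 'c) monoid_scheme" and f :: "'g \<Rightarrow> 'h" and \<zeta> :: "'f::{field,finite}"
    and e :: "nat \<Rightarrow> 'h" and D :: "int poly"
  assumes f: "f \<in> epi G H" and H: "group H" "finite (carrier H)"
    and \<chi>_mult: "\<And>g h. g \<in> carrier H \<Longrightarrow> h \<in> carrier H \<Longrightarrow> \<chi> (g \<otimes>\<^bsub>H\<^esub> h) = \<chi> g * \<chi> h"
    and \<chi>_pow: "\<And>g. g \<in> carrier H \<Longrightarrow> \<exists>i. \<chi> g = \<zeta> ^ i" and \<chi>_onto: "\<zeta> \<in> \<chi> ` carrier H"
    and \<zeta>: "primitive_root_of_unity l \<zeta>" and l: "\<not> CHAR('f) dvd l"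
    and order: "card (carrier H) = l * CHAR('f) ^ N"
    and e: "bij_betw e {..<r} (carrier H)" and j: "j < q"
    and D: "alexander_polynomial G q s relators \<phi> (to_fract D)"
  defines "\<Delta> \<equiv> twisted_alexander G q s relators \<phi> r (regular_representation H r e \<circ> f) j"
    and "R \<equiv> \<Prod>i<l. Fraction_Field.Fract (pcompose (reduce_poly D) [:0, \<zeta> ^ i:]) [:- 1, \<zeta> ^ i:]"
  shows "\<Delta> \<noteq> 0" "\<exists>g. reduces_to \<Delta> g \<and> eq_up_to_unit g (R ^ (CHAR('f) ^ N))"
proof -
  interpret H: group H by fact
  have f_hom: "f \<in> hom G H" and f_surj: "f ` carrier G = carrier H" using f by (auto simp: epi_def)
  have f_closed: "f g \<in> carrier H" if "g \<in> carrier G" for g using f_surj that by auto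
  have f_mult: "f (g \<otimes> h) = f g \<otimes>\<^bsub>H\<^esub> f h" if "g \<in> carrier G" "h \<in> carrier G" for g h
    using f_hom that by (auto simp: hom_def)
  have f_one: "f \<one> = \<one>\<^bsub>H\<^esub>" using f_hom is_group H(1) by (intro hom_one) auto
  \<comment> \<open>The image of one meridian; every character of H takes the same value on the
    images of all the others.\<close>
  define y where "y = f (s c)"
  have y: "y \<in> carrier H" unfolding y_def by (intro f_closed gen_closed c_less)
  have pull_back: "d (f (ev w)) = d y powi \<phi> (ev w)"
    if d: "\<And>g h. g \<in> carrier H \<Longrightarrow> h \<in> carrier H \<Longrightarrow> d (g \<otimes>\<^bsub>H\<^esub> h) = d g * d h" "d \<one>\<^bsub>H\<^esub> = 1"
      and w: "w \<in> words q" for d :: "'h \<Rightarrow> 'f" and w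
  proof -
    have mult: "d (f (g \<otimes> h)) = d (f g) * d (f h)" if "g \<in> carrier G" "h \<in> carrier G" for g h
      using that by (simp add: f_mult d(1) f_closed)
    have one: "d (f \<one>) = 1" by (simp add: f_one d(2))
    have gen: "d (f (s i)) = d y" if "i < q" for i
      unfolding y_def by (rule multiplicative_gen_eq[of "\<lambda>g. d (f g)", OF mult one that])
    show ?thesis by (rule multiplicative_ev[of "\<lambda>g. d (f g)", OF mult one gen w])
  qed
  have l_pos: "l > 0" and \<zeta>l: "\<zeta> ^ l = 1" using \<zeta> by (auto simp: primitive_root_of_unity_def)
  have \<chi>_l: "\<chi> g ^ l = 1" if "g \<in> carrier H" for g
  proof -
    obtain i where "\<chi> g = \<zeta> ^ i" using \<chi>_pow[OF \<open>g \<in> carrier H\<close>] by auto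
    then have "\<chi> g ^ l = (\<zeta> ^ l) ^ i" by (simp only: power_mult[symmetric] mult.commute)
    then show ?thesis by (simp add: \<zeta>l)
  qed
  have \<chi>_one: "\<chi> \<one>\<^bsub>H\<^esub> = 1"
    using \<chi>_mult[of "\<one>\<^bsub>H\<^esub>" "\<one>\<^bsub>H\<^esub>"] \<chi>_l[of "\<one>\<^bsub>H\<^esub>"] l_pos by (auto simp: power_0_left)
  have prim: "primitive_root_of_unity l (\<chi> y)"
  proof -
    obtain g where "g \<in> carrier H" "\<zeta> = \<chi> g" using \<chi>_onto by auto
    then obtain w where w: "w \<in> words q" "\<zeta> = \<chi> (f (ev w))"
      unfolding f_surj[symmetric] generated[symmetric] by auto
    then have pow: "\<zeta> = \<chi> y powi \<phi> (ev w)" using pull_back[OF \<chi>_mult \<chi>_one] by simp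
    \<comment> \<open>Since \<zeta> is a power of \<open>\<chi> y\<close>, an exponent that kills
      \<open>\<chi> y\<close> kills \<zeta>.\<close>
    have "\<chi> y ^ i \<noteq> 1" if "0 < i" "i < l" for i
    proof
      assume "\<chi> y ^ i = 1"
      have "\<zeta> ^ i = \<chi> y powi (int i * \<phi> (ev w))"
        by (subst pow) (simp only: power_int_of_nat[symmetric] power_int_mult[symmetric] mult.commute)
      then have "\<zeta> ^ i = 1" using \<open>\<chi> y ^ i = 1\<close> by (simp add: power_int_mult)
      then show False using \<zeta> that by (auto simp: primitive_root_of_unity_def)
    qed
    then show ?thesis using l_pos \<chi>_l[OF y] by (simp add: primitive_root_of_unity_def)
  qed
  have "card {g \<in> carrier H. \<chi> g = 1} = CHAR('f) ^ N"
    using H.card_kernel_character[OF H(2) \<chi>_mult \<chi>_l y prim] order l_pos by simp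
  then interpret character_with_p_kernel H \<chi> l N
    using H(2) \<chi>_mult \<chi>_l l by unfold_locales auto
  let ?n = "length relators"
  let ?\<psi> = "\<lambda>w. \<phi> (ev w)"
  let ?x = "\<lambda>u v. fox_derivative (skip j v) (relators ! u)"
  let ?\<rho> = "regular_representation H r e"
  have r: "r > 0"
  proof (rule ccontr)
    assume "\<not> r > 0"
    then show False using e y by (auto simp: bij_betw_def)
  qed
  define K where "K = (\<Union>u\<in>{..<?n}. \<Union>v\<in>{..<q}. Poly_Mapping.keys (fox_derivative v (relators ! u)))"
  \<comment> \<open>A sum of negative parts, which bounds each of them, so that this shift clears
    every exponent in the Fox matrix.\<close>
  define M where "M = (\<Sum>w\<in>K. nat (- ?\<psi> w))"
  have "finite K" by (simp add: K_def)
  have M: "?\<psi> w + int M \<ge> 0" if "u < ?n" "v < q" "w \<in> Poly_Mapping.keys (fox_derivative v (relators ! u))" for u v w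
  proof -
    have "w \<in> K" using that by (auto simp: K_def)
    then have "nat (- ?\<psi> w) \<le> M" unfolding M_def by (rule member_le_sum) (use \<open>finite K\<close> in auto)
    then show ?thesis by simp
  qed
  have skip_less: "skip j v < q" if "v < ?n" for v using that length_relators by (simp add: skip_def)
  obtain \<epsilon> :: int and a b where \<epsilon>: "\<epsilon> = 1 \<or> \<epsilon> = - 1"
    and AD: "D * Polynomial.monom 1 a = shifted_minor M j * Polynomial.monom \<epsilon> b"
    using alexander_polynomial_shifted_minor[OF D j M] .
  have F_closed: "f (ev w) \<in> carrier H" if "w \<in> words q" for w using f_closed ev_closed that by blast
  define N1 where "N1 = Determinant.det (Matrix.mat (r * ?n) (r * ?n) (\<lambda>(i, i').
      shifted M ?\<psi> (\<lambda>w. ?\<rho> (f (ev w)) $$ (i mod r, i' mod r)) (?x (i div r) (i' div r))))"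
  have red1: "reduce_poly N1 = (\<Prod>z\<in>{z :: 'f. z ^ l = 1}. [:inverse z ^ (M * ?n):] *
      pcompose (reduce_poly (shifted_minor M j)) [:0, z:]) ^ (CHAR('f) ^ N)"
    unfolding N1_def shifted_minor_def
  proof (rule reduce_det_regular[OF e y prim order _ F_closed pull_back])
    show "Poly_Mapping.keys (?x u v) \<subseteq> words q" if "u < ?n" for u v
      using keys_fox_derivative[OF relators_words[OF that]] .
    show "?\<psi> w + int M \<ge> 0" if "u < ?n" "v < ?n" "w \<in> Poly_Mapping.keys (?x u v)" for u v w
      using M[OF that(1) skip_less[OF that(2)] that(3)] .
  qed
  let ?den = "frag_of [(j, True)] - frag_of [] :: word \<Rightarrow>\<^sub>0 int"
  have keys_den: "Poly_Mapping.keys ?den \<subseteq> {[(j, True)], []}"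
    using Poly_Mapping.keys_diff[of "frag_of [(j, True)]" "frag_of []"] by auto
  have \<psi>_gen: "?\<psi> [(j, True)] = 1" using j phi_one phi_gen gen_closed by simp
  \<comment> \<open>Only the exponents 1 and 0 occur in s_j - 1, so the denominator needs no
    shift.\<close>
  have den_nonneg: "?\<psi> w + int 0 \<ge> 0" if "w \<in> Poly_Mapping.keys ?den" for w
  proof -
    have "w = [(j, True)] \<or> w = []" using that keys_den by blast
    then show ?thesis
    proof
      assume "w = [(j, True)]"
      then show ?thesis by (simp only: \<psi>_gen)
    qed (simp add: phi_one)
  qed
  \<comment> \<open>The denominator as a block matrix with n = 1. Its untwisted counterpart is t -
    1, the source of the factors z t - 1.\<close>
  define N2 where "N2 = Determinant.det (Matrix.mat (r * 1) (r * 1) (\<lambda>(i, i').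
      shifted 0 ?\<psi> (\<lambda>w. ?\<rho> (f (ev w)) $$ (i mod r, i' mod r)) ?den))"
  have "shifted 0 ?\<psi> (\<lambda>_. 1) ?den = ([:- 1, 1:] :: int poly)"
    unfolding shifted_def lin_ext_diff lin_ext_frag_of \<psi>_gen by (simp add: phi_one monom_Suc monom_0)
  then have minor2: "Determinant.det (Matrix.mat 1 1 (\<lambda>(u, v). shifted 0 ?\<psi> (\<lambda>_. 1) ?den)) = ([:- 1, 1:] :: int poly)"
    by (subst det_single) simp_all
  have "reduce_poly N2 = (\<Prod>z\<in>{z :: 'f. z ^ l = 1}. [:inverse z ^ (0 * 1):] *
      pcompose (reduce_poly (Determinant.det (Matrix.mat 1 1 (\<lambda>(u, v). shifted 0 ?\<psi> (\<lambda>_. 1) ?den)))) [:0, z:]) ^ (CHAR('f) ^ N)"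
    unfolding N2_def
  proof (rule reduce_det_regular[OF e y prim order _ F_closed pull_back, where x = "\<lambda>_ _. ?den"])
    have "{[(j, True)], []} \<subseteq> words q" using j by simp
    with keys_den show "Poly_Mapping.keys ?den \<subseteq> words q" by (rule order_trans)
    show "?\<psi> w + int 0 \<ge> 0" if "w \<in> Poly_Mapping.keys ?den" for w using den_nonneg[OF that] .
  qed
  then have red2: "reduce_poly N2 = (\<Prod>z\<in>{z :: 'f. z ^ l = 1}. [:- 1, z:]) ^ (CHAR('f) ^ N)"
    unfolding minor2 by (simp add: map_poly_pCons pcompose_pCons)
  have num: "tvar ^ (M * (r * ?n)) * Determinant.det (remove_block_column r j (fox_matrix G q s relators \<phi> r (?\<rho> \<circ> f))) = to_fract N1"
    unfolding remove_block_column_fox_matrix[OF length_relators j r] N1_def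
  proof (rule det_tvar_shift)
    fix i i' assume i: "i < r * ?n" "i' < r * ?n"
    then have d: "i div r < ?n" "i' div r < ?n" by (auto simp: less_mult_imp_div_less mult.commute)
    note shift = tvar_shift[OF M[OF d(1) skip_less[OF d(2)]], where h = "\<lambda>w. ?\<rho> (f (ev w)) $$ (i mod r, i' mod r)"]
    show "tvar ^ M * twisted_matrix G s \<phi> r (?\<rho> \<circ> f) (?x (i div r) (i' div r)) $$ (i mod r, i' mod r) =
        to_fract (shifted M ?\<psi> (\<lambda>w. ?\<rho> (f (ev w)) $$ (i mod r, i' mod r)) (?x (i div r) (i' div r)))"
      using r by (simp add: twisted_matrix_index flip: shift)
  qed
  have den: "Determinant.det (twisted_matrix G s \<phi> r (?\<rho> \<circ> f) ?den) = to_fract N2"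
  proof -
    have "twisted_matrix G s \<phi> r (?\<rho> \<circ> f) ?den =
        Matrix.mat r r (\<lambda>(i, i'). twisted_matrix G s \<phi> r (?\<rho> \<circ> f) ?den $$ (i, i'))"
      by (rule eq_matI) (auto simp: twisted_matrix_def)
    moreover have "tvar ^ (0 * r) * Determinant.det \<dots> = to_fract N2"
      unfolding N2_def mult_1_right
    proof (subst det_tvar_shift[symmetric])
      fix i i' assume "i < r" "i' < r"
      then show "tvar ^ 0 * twisted_matrix G s \<phi> r (?\<rho> \<circ> f) ?den $$ (i, i') =
        to_fract (shifted 0 ?\<psi> (\<lambda>w. ?\<rho> (f (ev w)) $$ (i mod r, i' mod r)) ?den)"
        using den_nonneg by (subst tvar_shift[symmetric]) (auto simp: twisted_matrix_index)
    qed (rule HOL.refl)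
    ultimately show ?thesis by simp
  qed
  have fin: "finite {z :: 'f. z ^ l = 1}" by (rule finite_roots_of_unity[OF \<zeta>])
  have nz: "z \<noteq> 0" if "z ^ l = 1" for z :: 'f using that l_pos by (auto simp: power_0_left)
  have red1_nz: "(reduce_poly N1 :: 'f poly) \<noteq> 0"
    unfolding red1 using fin nz shifted_minor_mod_nonzero[OF j, of M, where 'f = 'f]
    by (auto simp: pcompose_scale_eq_0_iff)
  have red2_nz: "(reduce_poly N2 :: 'f poly) \<noteq> 0"
    unfolding red2 using fin by auto
  let ?K = "M * (r * ?n)"
  have \<Delta>: "\<Delta> = Fraction_Field.Fract N1 (Polynomial.monom 1 ?K * N2)"
    unfolding \<Delta>_def twisted_alexander_def by (rule fraction_up_to_tvar_power[OF num den])
  have "N1 \<noteq> 0" "N2 \<noteq> 0" using red1_nz red2_nz by auto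
  then show "\<Delta> \<noteq> 0" unfolding \<Delta> by (simp add: Fract_conv_to_fract)
  have red_den: "reduce_poly (Polynomial.monom 1 ?K * N2) = (Polynomial.monom 1 ?K * reduce_poly N2 :: 'f poly)"
    by (simp add: reduce_poly_mult map_poly_monom)
  have "reduces_to \<Delta> (Fraction_Field.Fract (reduce_poly N1) (Polynomial.monom 1 ?K * reduce_poly N2) :: 'f poly fract)"
    unfolding reduces_to_def \<Delta> using red_den red2_nz
    by (intro exI[of _ N1] exI[of _ "Polynomial.monom 1 ?K * N2"]) simp
  moreover have "eq_up_to_unit (Fraction_Field.Fract (reduce_poly N1) (Polynomial.monom 1 ?K * reduce_poly N2)) (R ^ (CHAR('f) ^ N))"
    unfolding red1 red2 R_def by (rule prod_roots_of_unity_up_to_unit[OF \<zeta> \<epsilon> AD])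
  ultimately show "\<exists>g. reduces_to \<Delta> g \<and> eq_up_to_unit g (R ^ (CHAR('f) ^ N))" by blast
qed

theorem corollary3p9:
  fixes G :: "('g, 'b) monoid_scheme"
    and p n m k l q j :: nat
    and e :: "nat \<Rightarrow> 'g"
    and \<zeta> :: "'f::{field, finite}"
    and \<gamma> :: "real \<Rightarrow> real^4" and \<epsilon> :: real and x\<^sub>0 :: "real^4"
    and \<phi> :: "(real \<Rightarrow> real^4) set \<Rightarrow> int"
    and s :: "nat \<Rightarrow> (real \<Rightarrow> real^4) set" and rs :: "word list"
    and D :: "int poly"
    and f :: "(real \<Rightarrow> real^4) set \<Rightarrow> 'g"
  assumes "group G" and "finite (carrier G)" and "group_weight G = 1"
    and "Factorial_Ring.prime p"
    and "card (derived G (carrier G)) = p ^ n"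
    and "G Mod (derived G (carrier G)) \<cong> integer_mod_group m"
    and "m = p ^ k * l" and "\<not> p dvd l"
    and "bij_betw e {..<m * p ^ n} (carrier G)"
    and "CARD('f) = p ^ ord l p"
    and "primitive_root_of_unity l \<zeta>"
    and "oriented_knot \<gamma>" and "tubular_radius (range \<gamma>) \<epsilon>" and "x\<^sub>0 \<in> knot_exterior \<gamma> \<epsilon>"
    and "knot_abelianization \<gamma> \<epsilon> x\<^sub>0 \<phi>"
    and "wirtinger_presentation \<gamma> \<epsilon> x\<^sub>0 q s rs" and "j < q"
    and "alexander_polynomial (knot_group \<gamma> \<epsilon> x\<^sub>0) q s rs \<phi> (to_fract D)"
    and "f \<in> epi (knot_group \<gamma> \<epsilon> x\<^sub>0) G"
  shows "let \<Delta> = twisted_alexander (knot_group \<gamma> \<epsilon> x\<^sub>0) q s rs \<phi> (m * p ^ n)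
                   (regular_representation G (m * p ^ n) e \<circ> f) j;
             R = (\<Prod>i<l. Fraction_Field.Fract (pcompose (reduce_poly D) [:0, \<zeta> ^ i:]) [:- 1, \<zeta> ^ i:])
         in R \<in> prime_field_rational_functions \<and>
            (\<exists>g. reduces_to \<Delta> g \<and> eq_up_to_unit g (R ^ (p ^ (k + n)))) \<and>
            \<Delta> \<noteq> 0"
proof -
  let ?\<Pi> = "knot_group \<gamma> \<epsilon> x\<^sub>0"
  interpret G: group G by fact
  interpret P: group ?\<Pi> by (rule group_fundamental_group) fact
  obtain ov sg c where ov: "\<forall>i<q. ov i < q" "c < q"
    and rs: "rs = map (crossing_relator q ov sg) (filter (\<lambda>i. i \<noteq> c) [0..<q])"
    and mer: "\<forall>i<q. s i \<in> oriented_meridians \<gamma> \<epsilon> x\<^sub>0" and pres: "presents q rs ?\<Pi> s"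
    using assms(16) by (auto simp: wirtinger_presentation_def)
  interpret wirtinger_group ?\<Pi> q s \<phi> ov sg c
  proof unfold_locales
    show "\<phi> \<in> hom ?\<Pi> integer_group" using assms(15) by (simp add: knot_abelianization_def epi_def)
    show "\<phi> (s i) = 1" if "i < q" for i using assms(15) mer that by (simp add: knot_abelianization_def)
    show "word_eval ?\<Pi> s (crossing_relator q ov sg i) = \<one>\<^bsub>?\<Pi>\<^esub>" if i: "i < q" "i \<noteq> c" for i
    proof -
      have "crossing_relator q ov sg i \<in> set rs" using i by (auto simp: rs)
      \<comment> \<open>The rule that deletes a relator, with empty words on both sides.\<close>
      moreover from this have "word_equiv q (set rs) (crossing_relator q ov sg i) []"
        using word_equiv.relator[of "crossing_relator q ov sg i" "set rs" q "[]" "[]"] by simp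
      ultimately show ?thesis using pres by (auto simp: presents_def)
    qed
  qed (use ov pres in \<open>auto simp: presents_def\<close>)
  have rs: "rs = relators" by (simp add: rs relators_def)
  have p: "CHAR('f) = p" using assms(4,10) by (rule CHAR_eq_prime)
  have l: "l > 0" and "\<zeta> ^ l = 1" using assms(11) by (auto simp: primitive_root_of_unity_def)
  then have \<zeta>m: "\<zeta> ^ m = 1" by (simp add: assms(7) mult.commute[of _ l] power_mult)
  have m: "m > 0" using l assms(4,7) by (simp add: prime_gt_0_nat)
  obtain \<chi> where \<chi>: "\<And>g h. g \<in> carrier G \<Longrightarrow> h \<in> carrier G \<Longrightarrow> \<chi> (g \<otimes>\<^bsub>G\<^esub> h) = \<chi> g * \<chi> h"
    "\<And>g. g \<in> carrier G \<Longrightarrow> \<exists>i. \<chi> g = \<zeta> ^ i" "\<zeta> \<in> \<chi> ` carrier G"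
    by (rule G.character_of_cyclic_quotient[OF G.derived_self_is_normal assms(6) m \<zeta>m]) (rule that)
  \<comment> \<open>The group has order m p^n = p^k l p^n; this is where the exponent k + n comes
    from.\<close>
  have order: "card (carrier G) = l * CHAR('f) ^ (k + n)"
    using bij_betw_same_card[OF assms(9)] by (simp add: assms(7) p power_add mult_ac)
  have ndvd: "\<not> CHAR('f) dvd l" using assms(8) by (simp add: p)
  note main = twisted_alexander_regular[OF assms(19,1,2) \<chi> assms(11) ndvd order assms(9,17) assms(18)[unfolded rs]]
  show ?thesis
    using main prod_roots_of_unity_rational[OF assms(11) ndvd, of D] unfolding Let_def rs p by blast
qed

end
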